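(* Let $\mathcal{L},\mathcal{L}'$ be countable languages, $\mathcal{T}$ a countable $\mathcal{L}_{\omega_1\omega}$-theory and $\mathcal{T}'$ a countable $\mathcal{L}'_{\omega_1\omega}$-theory. Then every Borel functor $\mathsf{Mod}(\mathcal{L}',\mathcal{T}')\to\mathsf{Mod}(\mathcal{L},\mathcal{T})$ between the standard Borel groupoids of countable models is Borel naturally isomorphic to $F^*$ for some interpretation $F:(\mathcal{L},\mathcal{T})\to(\mathcal{L}',\mathcal{T}')$.
   Context: **Logic.** Languages are relational (functions are coded by their graphs). $\mathcal{L}_{\omega_1\omega}$ extends finitary first-order logic with equality by countable conjunctions and disjunctions; formulas have finitely many free variables and are always considered together with a finite tuple of distinct variables containing the free ones (up to renaming variables). A theory is a set of sentences. $\mathcal{T}\vdash\phi$ means provability in the standard Gentzen-type proof system for $\mathcal{L}_{\omega_1\omega}$ (empty structures are allowed); for countable $\mathcal{T}$ this is equivalent, by the completeness theorem, to truth of $\phi$ in all countable models of $\mathcal{T}$. **Imaginary sorts.** An $(\mathcal{L}_{\omega_1\omega},\mathcal{T})$-imaginary sort $A=(\bigsqcup_i\alpha_i)/(\bigsqcup_{i,j}\epsilon_{ij})$ consists of countable families of $\mathcal{L}_{\omega_1\omega}$-formulas $\alpha_i(\vec x_i)$ (with $n_i=|\vec x_i|$ possibly varying) and $\epsilon_{ij}(\vec x_i,\vec x_j)$ such that $\mathcal{T}$ proves that $\bigsqcup_{i,j}\epsilon_{ij}$ is an equivalence relation on $\bigsqcup_i\alpha_i$: $\epsilon_{ij}(\vec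 x,\vec y)\Rightarrow\alpha_i(\vec x)\wedge\alpha_j(\vec y)$; $\alpha_i(\vec x)\Rightarrow\epsilon_{ii}(\vec x,\vec x)$; $\epsilon_{ij}(\vec x,\vec y)\Rightarrow\epsilon_{ji}(\vec y,\vec x)$; $\epsilon_{ij}(\vec x,\vec y)\wedge\epsilon_{jk}(\vec y,\vec z)\Rightarrow\epsilon_{ik}(\vec x,\vec z)$ (universally quantified). For a model $\mathcal{M}$ of $\mathcal{T}$ with underlying set $M$, $A^{\mathcal M}:=(\bigsqcup_i\alpha_i^{\mathcal M})/(\bigsqcup_{i,j}\epsilon_{ij}^{\mathcal M})$, where $\alpha_i^{\mathcal M}\subseteq M^{n_i}$. A definable relation (subsort) $B\subseteq A$ is a family of formulas $(\beta_i)_i$, modulo $\mathcal{T}$-equivalence, such that $\mathcal{T}$ proves $\beta_i\Rightarrow\alpha_i$ and that $\bigsqcup_i\beta_i$ is $\bigsqcup_{i,j}\epsilon_{ij}$-invariant; it has an interpretation $B^{\mathcal M}\subseteq A^{\mathcal M}$. The product $A\times B$ of sorts $A=(\bigsqcup_i\alpha_i)/(\bigsqcup\epsilon_{ij})$, $B=(\bigsqcup_k\beta_k)/(\bigsqcup\eta_{kl})$ is given by the formulas $\alpha_i(\vec x)\wedge\beta_k(\vec y)$ and $\epsilon_{ij}(\vec x,\vec z)\wedge\eta_{kl}(\vec y,\vec w)$, so $(A\times B)^{\mathcal M}\cong A^{\mathcal M}\times B^{\mathcal M}$. **Groupoid of models.** $\mathrm{Mod}(\mathcal{L},\mathcal{T})$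 is the set of models of $\mathcal{T}$ whose underlying set is an initial segment of $\mathbb{N}$ (one of $0,1,2,\dots,\mathbb{N}$, with $n=\{0,\dots,n-1\}$), with the standard Borel structure generated by the sets $\{\mathcal{M}: |M|\ge n\}$ and $\{\mathcal{M}:\vec a\in M^n,\ R^{\mathcal M}(\vec a)\}$ for $n$-ary $R\in\mathcal{L}$, $\vec a\in\mathbb{N}^n$. $\mathsf{Mod}(\mathcal{L},\mathcal{T})$ is the standard Borel groupoid with object space $\mathrm{Mod}(\mathcal{L},\mathcal{T})$ and morphisms all isomorphisms $g:\mathcal{M}\cong\mathcal{N}$ between such models; the Borel structure on morphisms is generated by $\{g:\mathcal M\cong\mathcal N \mid \mathcal{M}\in B\}$ for $B$ Borel and $\{g:\mathcal M\cong\mathcal N\mid a,b\in M,\ g(a)=b\}$ for $a,b\in\mathbb{N}$. A Borel functor is a functor that is Borel on objects and on morphisms; a Borel natural isomorphism is a natural isomorphism whose component map is Borel. **Interpretations.** An ($\mathcal{L}'_{\omega_1\omega}$-)interpretation $F:(\mathcal{L},\mathcal{T})\to(\mathcal{L}',\mathcal{T}')$ consists of an $(\mathcal{L}'_{\omega_1\omega},\mathcal{T}')$-imaginary sort $F(\mathbb{X})$ and, for each $n$-ary $R\in\mathcal{L}$, a definable relation $F(R)\subseteq F(\mathbb{X})^n$, such that applying $F$ to each axiom of $\mathcal{T}$ gives a statement provable from $\mathcal{T}'$; equivalently (by completeness), for every countable model $\mathcal{M}$ of $\mathcal{T}'$ the $\mathcal{L}$-structure $(F(\mathbb{X})^{\mathcal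 M},F(R)^{\mathcal M})_{R\in\mathcal{L}}$ is a model of $\mathcal{T}$. **The functor $F^*$.** For an imaginary sort $A$ of $\mathcal{T}'$, let $[\![A]\!]=\{(\mathcal{M},a):\mathcal{M}\in\mathrm{Mod}(\mathcal{L}',\mathcal{T}'),\ a\in A^{\mathcal M}\}$ with its natural standard Borel structure: for a formula $\alpha$ with $n$ variables, $[\![\alpha]\!]$ is the disjoint union over $\vec a\in\mathbb{N}^n$ of copies of the Borel sets $\{\mathcal{M}:\vec a\in M^n,\ \alpha^{\mathcal M}(\vec a)\}$; $[\![\bigsqcup_i\alpha_i]\!]=\bigsqcup_i[\![\alpha_i]\!]$; and for $A=(\bigsqcup_i\alpha_i)/(\bigsqcup\epsilon_{ij})$, a subset of $[\![A]\!]$ is Borel iff its preimage in $[\![\bigsqcup_i\alpha_i]\!]$ is. Fix a Borel map $[\![F(\mathbb{X})]\!]\to\mathbb{N}$ restricting on each fiber $F(\mathbb{X})^{\mathcal M}$ to a bijection $e_{\mathcal M}$ onto an initial segment of $\mathbb{N}$. Then $F^*(\mathcal{M})$ is the model of $\mathcal{T}$ obtained from $(F(\mathbb{X})^{\mathcal M},F(R)^{\mathcal M})_{R\in\mathcal{L}}$ by transporting along $e_{\mathcal M}$, and for $g:\mathcal{M}\cong\mathcal{N}$, $F^*(g)$ is the bijection $F(\mathbb{X})^{\mathcal M}\cong F(\mathbb{X})^{\mathcal N}$ induced by $g$, transported along $e_{\mathcal M},e_{\mathcal N}$. This is a Borel functor $F^*:\mathsf{Mod}(\mathcal{L}',\mathcal{T}')\to\mathsf{Mod}(\mathcal{L},\mathcal{T})$,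 independent of the coding $e$ up to Borel natural isomorphism. *)

theory Defs
  imports "HOL-Analysis.Analysis"
begin

section \<open>Syntax of the infinitary logic\<close>

text \<open>A relational language: \<open>L R = Some n\<close> says that \<open>R\<close> is an \<open>n\<close>-ary symbol of \<open>L\<close>.\<close>

type_synonym 'r language = "'r \<Rightarrow> nat option"

text \<open>
  Formulas with de Bruijn indices; a formula is always considered in a context of \<open>n\<close> variables
  \<open>0, \<dots>, n - 1\<close> (predicate \<open>wff\<close>), so it has finitely many free variables.  Under a
  quantifier the bound variable is \<open>0\<close> and the other variables are moved up by one.  In
  \<open>Conj I \<phi>\<close> and \<open>Disj I \<phi>\<close> only the members \<open>\<phi> i\<close> with \<open>i \<in> I\<close> count; \<open>I\<close> may be any set of
  natural numbers, so that empty, finite and countably infinite families are covered.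
\<close>

datatype 'r fm =
    Atom 'r "nat list"
  | Eq nat nat
  | Neg "'r fm"
  | Conj "nat set" "nat \<Rightarrow> 'r fm"
  | Disj "nat set" "nat \<Rightarrow> 'r fm"
  | Forall "'r fm"
  | Exists "'r fm"

primrec wff :: "'r language \<Rightarrow> 'r fm \<Rightarrow> nat \<Rightarrow> bool" where
  "wff L (Atom R vs) = (\<lambda>n. L R = Some (length vs) \<and> set vs \<subseteq> {..<n})"
| "wff L (Eq j k) = (\<lambda>n. j < n \<and> k < n)"
| "wff L (Neg \<phi>) = (\<lambda>n. wff L \<phi> n)"
| "wff L (Conj I \<phi>) = (\<lambda>n. \<forall>i\<in>I. wff L (\<phi> i) n)"
| "wff L (Disj I \<phi>) = (\<lambda>n. \<forall>i\<in>I. wff L (\<phi> i) n)"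
| "wff L (Forall \<phi>) = (\<lambda>n. wff L \<phi> (Suc n))"
| "wff L (Exists \<phi>) = (\<lambda>n. wff L \<phi> (Suc n))"

text \<open>Since languages are relational, the terms are the variables and substitution is renaming.\<close>

definition lift :: "(nat \<Rightarrow> nat) \<Rightarrow> nat \<Rightarrow> nat" where
  "lift r = case_nat 0 (\<lambda>k. Suc (r k))"

primrec ren :: "'r fm \<Rightarrow> (nat \<Rightarrow> nat) \<Rightarrow> 'r fm" where
  "ren (Atom R vs) = (\<lambda>r. Atom R (map r vs))"
| "ren (Eq j k) = (\<lambda>r. Eq (r j) (r k))"
| "ren (Neg \<phi>) = (\<lambda>r. Neg (ren \<phi> r))"
| "ren (Conj I \<phi>) = (\<lambda>r. Conj I (\<lambda>i. ren (\<phi> i) r))"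
| "ren (Disj I \<phi>) = (\<lambda>r. Disj I (\<lambda>i. ren (\<phi> i) r))"
| "ren (Forall \<phi>) = (\<lambda>r. Forall (ren \<phi> (lift r)))"
| "ren (Exists \<phi>) = (\<lambda>r. Exists (ren \<phi> (lift r)))"

text \<open>\<open>sub \<phi> vs\<close> substitutes the variables \<open>vs ! 0, vs ! 1, \<dots>\<close> for \<open>0, 1, \<dots>\<close>;
  \<open>inst \<phi> k\<close> substitutes \<open>k\<close> for the variable freed by stripping a quantifier.\<close>

definition sub :: "'r fm \<Rightarrow> nat list \<Rightarrow> 'r fm" where
  "sub \<phi> vs = ren \<phi> (\<lambda>v. vs ! v)"

definition inst :: "'r fm \<Rightarrow> nat \<Rightarrow> 'r fm" where
  "inst \<phi> k = ren \<phi> (case_nat k (\<lambda>v. v))"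

definition And :: "'r fm \<Rightarrow> 'r fm \<Rightarrow> 'r fm" where
  "And \<phi> \<psi> = Conj {0, 1} (\<lambda>i. if i = 0 then \<phi> else \<psi>)"

definition Imp :: "'r fm \<Rightarrow> 'r fm \<Rightarrow> 'r fm" where
  "Imp \<phi> \<psi> = Disj {0, 1} (\<lambda>i. if i = 0 then Neg \<phi> else \<psi>)"

definition Foralls :: "nat \<Rightarrow> 'r fm \<Rightarrow> 'r fm" where
  "Foralls n \<phi> = (Forall ^^ n) \<phi>"

definition Existss :: "nat \<Rightarrow> 'r fm \<Rightarrow> 'r fm" where
  "Existss n \<phi> = (Exists ^^ n) \<phi>"

definition is_theory :: "'r language \<Rightarrow> 'r fm set \<Rightarrow> bool" where
  "is_theory L T \<longleftrightarrow> (\<forall>\<phi>\<in>T. wff L \<phi> 0)"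


section \<open>Provability\<close>

text \<open>
  \<open>derives L T n \<Gamma> \<Delta>\<close>: the sequent \<open>\<Gamma> \<Rightarrow> \<Delta>\<close>, in the context of \<open>n\<close> variables, is derivable from \<open>T\<close>
  (Gentzen-type calculus with equality and cut; exchange and contraction are built into the use of
  sets).  Keeping track of the context makes the calculus sound for empty structures: quantifier
  instances and cut formulas may only use the variables of the context.
\<close>

inductive derives :: "'r language \<Rightarrow> 'r fm set \<Rightarrow> nat \<Rightarrow> 'r fm set \<Rightarrow> 'r fm set \<Rightarrow> bool"
  for L :: "'r language" and T :: "'r fm set" where
  Init: "\<phi> \<in> \<Gamma> \<Longrightarrow> \<phi> \<in> \<Delta> \<Longrightarrow> derives L T n \<Gamma> \<Delta>"
| Axiom: "\<phi> \<in> T \<Longrightarrow> \<phi> \<in> \<Delta> \<Longrightarrow> derives L T n \<Gamma> \<Delta>"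
| EqRefl: "k < n \<Longrightarrow> Eq k k \<in> \<Delta> \<Longrightarrow> derives L T n \<Gamma> \<Delta>"
| EqSubst: "j < n \<Longrightarrow> k < n \<Longrightarrow> wff L \<phi> (Suc n) \<Longrightarrow> Eq j k \<in> \<Gamma> \<Longrightarrow> inst \<phi> j \<in> \<Gamma> \<Longrightarrow>
    inst \<phi> k \<in> \<Delta> \<Longrightarrow> derives L T n \<Gamma> \<Delta>"
| Cut: "wff L \<phi> n \<Longrightarrow> derives L T n \<Gamma> (insert \<phi> \<Delta>) \<Longrightarrow> derives L T n (insert \<phi> \<Gamma>) \<Delta> \<Longrightarrow>
    derives L T n \<Gamma> \<Delta>"
| Weaken: "derives L T n \<Gamma> \<Delta> \<Longrightarrow> \<Gamma> \<subseteq> \<Gamma>' \<Longrightarrow> \<Delta> \<subseteq> \<Delta>' \<Longrightarrow> derives L T n \<Gamma>' \<Delta>'"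
| NegL: "derives L T n \<Gamma> (insert \<phi> \<Delta>) \<Longrightarrow> derives L T n (insert (Neg \<phi>) \<Gamma>) \<Delta>"
| NegR: "derives L T n (insert \<phi> \<Gamma>) \<Delta> \<Longrightarrow> derives L T n \<Gamma> (insert (Neg \<phi>) \<Delta>)"
| ConjL: "i \<in> I \<Longrightarrow> derives L T n (insert (\<phi> i) \<Gamma>) \<Delta> \<Longrightarrow> derives L T n (insert (Conj I \<phi>) \<Gamma>) \<Delta>"
| ConjR: "(\<And>i. i \<in> I \<Longrightarrow> derives L T n \<Gamma> (insert (\<phi> i) \<Delta>)) \<Longrightarrow>
    derives L T n \<Gamma> (insert (Conj I \<phi>) \<Delta>)"
| DisjL: "(\<And>i. i \<in> I \<Longrightarrow> derives L T n (insert (\<phi> i) \<Gamma>) \<Delta>) \<Longrightarrow>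
    derives L T n (insert (Disj I \<phi>) \<Gamma>) \<Delta>"
| DisjR: "i \<in> I \<Longrightarrow> derives L T n \<Gamma> (insert (\<phi> i) \<Delta>) \<Longrightarrow> derives L T n \<Gamma> (insert (Disj I \<phi>) \<Delta>)"
| ForallL: "k < n \<Longrightarrow> derives L T n (insert (inst \<phi> k) \<Gamma>) \<Delta> \<Longrightarrow>
    derives L T n (insert (Forall \<phi>) \<Gamma>) \<Delta>"
| ForallR: "derives L T (Suc n) ((\<lambda>\<psi>. ren \<psi> Suc) ` \<Gamma>) (insert \<phi> ((\<lambda>\<psi>. ren \<psi> Suc) ` \<Delta>)) \<Longrightarrow>
    derives L T n \<Gamma> (insert (Forall \<phi>) \<Delta>)"
| ExistsL: "derives L T (Suc n) (insert \<phi> ((\<lambda>\<psi>. ren \<psi> Suc) ` \<Gamma>)) ((\<lambda>\<psi>. ren \<psi> Suc) ` \<Delta>) \<Longrightarrow>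
    derives L T n (insert (Exists \<phi>) \<Gamma>) \<Delta>"
| ExistsR: "k < n \<Longrightarrow> derives L T n \<Gamma> (insert (inst \<phi> k) \<Delta>) \<Longrightarrow>
    derives L T n \<Gamma> (insert (Exists \<phi>) \<Delta>)"

definition proves :: "'r language \<Rightarrow> 'r fm set \<Rightarrow> 'r fm \<Rightarrow> bool" where
  "proves L T \<phi> \<longleftrightarrow> derives L T 0 {} {\<phi>}"


section \<open>Structures\<close>

record ('r, 'a) rstruct =
  carrier :: "'a set"
  rel :: "'r \<Rightarrow> 'a list set"

text \<open>Symbols outside \<open>L\<close> get the empty relation, so that equality of structures is the right one.\<close>

definition is_struct :: "'r language \<Rightarrow> ('r, 'a) rstruct \<Rightarrow> bool" where
  "is_struct L M \<longleftrightarrow> (\<forall>R. case L R of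
      None \<Rightarrow> rel M R = {}
    | Some n \<Rightarrow> rel M R \<subseteq> {a \<in> lists (carrier M). length a = n})"

text \<open>The \<open>k\<close>-th entry of the tuple \<open>a\<close> is the value of the variable \<open>k\<close>.\<close>

primrec sat :: "('r, 'a) rstruct \<Rightarrow> 'r fm \<Rightarrow> 'a list \<Rightarrow> bool" where
  "sat M (Atom R vs) = (\<lambda>a. map (\<lambda>v. a ! v) vs \<in> rel M R)"
| "sat M (Eq j k) = (\<lambda>a. a ! j = a ! k)"
| "sat M (Neg \<phi>) = (\<lambda>a. \<not> sat M \<phi> a)"
| "sat M (Conj I \<phi>) = (\<lambda>a. \<forall>i\<in>I. sat M (\<phi> i) a)"
| "sat M (Disj I \<phi>) = (\<lambda>a. \<exists>i\<in>I. sat M (\<phi> i) a)"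
| "sat M (Forall \<phi>) = (\<lambda>a. \<forall>b\<in>carrier M. sat M \<phi> (b # a))"
| "sat M (Exists \<phi>) = (\<lambda>a. \<exists>b\<in>carrier M. sat M \<phi> (b # a))"

definition is_model :: "'r language \<Rightarrow> 'r fm set \<Rightarrow> ('r, 'a) rstruct \<Rightarrow> bool" where
  "is_model L T M \<longleftrightarrow> is_struct L M \<and> (\<forall>\<phi>\<in>T. sat M \<phi> [])"


section \<open>Imaginary sorts\<close>

text \<open>
  The index set of the families is \<open>idx A\<close>, the number \<open>n\<^sub>i\<close> of variables is \<open>nvars A i\<close>, and
  \<open>fml A i\<close>, \<open>eqv A i j\<close> are \<open>\<alpha>\<^sub>i\<close>, \<open>\<epsilon>\<^sub>i\<^sub>j\<close>.  The context of \<open>eqv A i j\<close> consists of the \<open>nvars A i\<close>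
  variables of the first tuple followed by the \<open>nvars A j\<close> variables of the second one.
\<close>

record ('r, 'i) isort =
  idx :: "'i set"
  nvars :: "'i \<Rightarrow> nat"
  fml :: "'i \<Rightarrow> 'r fm"
  eqv :: "'i \<Rightarrow> 'i \<Rightarrow> 'r fm"

definition is_isort :: "'r language \<Rightarrow> 'r fm set \<Rightarrow> ('r, 'i) isort \<Rightarrow> bool" where
  "is_isort L T A \<longleftrightarrow>
     countable (idx A) \<and>
     (\<forall>i\<in>idx A. wff L (fml A i) (nvars A i)) \<and>
     (\<forall>i\<in>idx A. \<forall>j\<in>idx A. wff L (eqv A i j) (nvars A i + nvars A j)) \<and>
     (\<forall>i\<in>idx A. \<forall>j\<in>idx A. let m = nvars A i; n = nvars A j in
        proves L T (Foralls (m + n)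
          (Imp (eqv A i j) (And (fml A i) (sub (fml A j) [m..<m + n]))))) \<and>
     (\<forall>i\<in>idx A. let m = nvars A i in
        proves L T (Foralls m (Imp (fml A i) (sub (eqv A i i) ([0..<m] @ [0..<m]))))) \<and>
     (\<forall>i\<in>idx A. \<forall>j\<in>idx A. let m = nvars A i; n = nvars A j in
        proves L T (Foralls (m + n)
          (Imp (eqv A i j) (sub (eqv A j i) ([m..<m + n] @ [0..<m]))))) \<and>
     (\<forall>i\<in>idx A. \<forall>j\<in>idx A. \<forall>k\<in>idx A. let m = nvars A i; n = nvars A j; p = nvars A k in
        proves L T (Foralls (m + n + p)
          (Imp (And (eqv A i j) (sub (eqv A j k) [m..<m + n + p]))
               (sub (eqv A i k) ([0..<m] @ [m + n..<m + n + p])))))"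

definition is_subsort :: "'r language \<Rightarrow> 'r fm set \<Rightarrow> ('r, 'i) isort \<Rightarrow> ('i \<Rightarrow> 'r fm) \<Rightarrow> bool" where
  "is_subsort L T A \<beta> \<longleftrightarrow>
     (\<forall>i\<in>idx A. wff L (\<beta> i) (nvars A i)) \<and>
     (\<forall>i\<in>idx A. proves L T (Foralls (nvars A i) (Imp (\<beta> i) (fml A i)))) \<and>
     (\<forall>i\<in>idx A. \<forall>j\<in>idx A. let m = nvars A i; n = nvars A j in
        proves L T (Foralls (m + n)
          (Imp (And (eqv A i j) (\<beta> i)) (sub (\<beta> j) [m..<m + n]))))"

text \<open>
  For a list \<open>is\<close> of indices, a point of sort \<open>\<alpha>\<^bsub>is ! 0\<^esub> \<times> \<alpha>\<^bsub>is ! 1\<^esub> \<times> \<dots>\<close> is the concatenation of its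
  component tuples; \<open>block A is k\<close> lists the variables of the \<open>k\<close>-th component.
\<close>

definition tdim :: "('r, 'i) isort \<Rightarrow> 'i list \<Rightarrow> nat" where
  "tdim A is = sum_list (map (nvars A) is)"

definition block :: "('r, 'i) isort \<Rightarrow> 'i list \<Rightarrow> nat \<Rightarrow> nat list" where
  "block A is k = [tdim A (take k is)..<tdim A (take k is) + nvars A (is ! k)]"

text \<open>The power \<open>A\<^sup>n\<close>, i.e. the iterated product.\<close>

definition isort_power :: "('r, 'i) isort \<Rightarrow> nat \<Rightarrow> ('r, 'i list) isort" where
  "isort_power A n = \<lparr>
     idx = {is \<in> lists (idx A). length is = n},
     nvars = tdim A,
     fml = (\<lambda>is. Conj {..<n} (\<lambda>k. sub (fml A (is ! k)) (block A is k))),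
     eqv = (\<lambda>is js. Conj {..<n} (\<lambda>k. sub (eqv A (is ! k) (js ! k))
              (block A is k @ map (\<lambda>v. tdim A is + v) (block A js k)))) \<rparr>"

text \<open>Interpretation in a structure: the points of \<open>\<Squnion>\<^sub>i \<alpha>\<^sub>i\<close>, the relation \<open>\<Squnion>\<^sub>i\<^sub>j \<epsilon>\<^sub>i\<^sub>j\<close> on them,
  and the quotient.\<close>

definition points :: "('r, 'i) isort \<Rightarrow> ('r, 'a) rstruct \<Rightarrow> ('i \<times> 'a list) set" where
  "points A M = {(i, a). i \<in> idx A \<and> a \<in> lists (carrier M) \<and> length a = nvars A i \<and>
                   sat M (fml A i) a}"

definition point_eqv :: "('r, 'i) isort \<Rightarrow> ('r, 'a) rstruct \<Rightarrow> (('i \<times> 'a list) \<times> ('i \<times> 'a list)) set"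
  where
  "point_eqv A M = {((i, a), (j, b)). (i, a) \<in> points A M \<and> (j, b) \<in> points A M \<and>
                      sat M (eqv A i j) (a @ b)}"

definition point_class :: "('r, 'i) isort \<Rightarrow> ('r, 'a) rstruct \<Rightarrow> 'i \<times> 'a list \<Rightarrow> ('i \<times> 'a list) set"
  where
  "point_class A M x = point_eqv A M `` {x}"

definition isort_val :: "('r, 'i) isort \<Rightarrow> ('r, 'a) rstruct \<Rightarrow> ('i \<times> 'a list) set set" where
  "isort_val A M = points A M // point_eqv A M"

text \<open>The interpretation of \<open>\<beta> \<subseteq> A\<^sup>n\<close> as an \<open>n\<close>-ary relation on the quotient \<open>isort_val A M\<close>,
  through the identification of the \<open>n\<close>-th power of the latter with the interpretation of \<open>A\<^sup>n\<close>.\<close>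

definition power_subsort_val ::
  "('r, 'i) isort \<Rightarrow> nat \<Rightarrow> ('i list \<Rightarrow> 'r fm) \<Rightarrow> ('r, 'a) rstruct \<Rightarrow> ('i \<times> 'a list) set list set" where
  "power_subsort_val A n \<beta> M =
     {map (point_class A M) xs | xs. xs \<in> lists (points A M) \<and> length xs = n \<and>
        sat M (\<beta> (map fst xs)) (concat (map snd xs))}"


section \<open>The groupoid of models\<close>

definition init_seg :: "nat set \<Rightarrow> bool" where
  "init_seg S \<longleftrightarrow> S = UNIV \<or> (\<exists>n. S = {..<n})"

definition Mod :: "'r language \<Rightarrow> 'r fm set \<Rightarrow> ('r, nat) rstruct set" where
  "Mod L T = {M. is_model L T M \<and> init_seg (carrier M)}"

definition ModB :: "'r language \<Rightarrow> 'r fm set \<Rightarrow> ('r, nat) rstruct measure" where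
  "ModB L T = sigma (Mod L T)
     ({{M \<in> Mod L T. infinite (carrier M) \<or> n \<le> card (carrier M)} | n. True} \<union>
      {{M \<in> Mod L T. a \<in> lists (carrier M) \<and> a \<in> rel M R} | R a. L R = Some (length a)})"

record 'r arrow =
  src :: "('r, nat) rstruct"
  trg :: "('r, nat) rstruct"
  fun_of :: "nat \<Rightarrow> nat"

text \<open>Underlying maps are extensional (\<open>undefined\<close> off the domain), so that equality of
  arrows is the right one.\<close>

definition Arr :: "'r language \<Rightarrow> 'r fm set \<Rightarrow> 'r arrow set" where
  "Arr L T = {f. src f \<in> Mod L T \<and> trg f \<in> Mod L T \<and>
     fun_of f \<in> extensional (carrier (src f)) \<and>
     bij_betw (fun_of f) (carrier (src f)) (carrier (trg f)) \<and>
     (\<forall>R. \<forall>a \<in> lists (carrier (src f)). a \<in> rel (src f) R \<longleftrightarrow> map (fun_of f) a \<in> rel (trg f) R)}"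

definition ArrB :: "'r language \<Rightarrow> 'r fm set \<Rightarrow> 'r arrow measure" where
  "ArrB L T = sigma (Arr L T)
     ({{f \<in> Arr L T. src f \<in> B} | B. B \<in> sets (ModB L T)} \<union>
      {{f \<in> Arr L T. a \<in> carrier (src f) \<and> b \<in> carrier (src f) \<and> fun_of f a = b} | a b. True})"

definition id_arr :: "('r, nat) rstruct \<Rightarrow> 'r arrow" where
  "id_arr M = \<lparr>src = M, trg = M, fun_of = restrict (\<lambda>a. a) (carrier M)\<rparr>"

definition comp_arr :: "'r arrow \<Rightarrow> 'r arrow \<Rightarrow> 'r arrow" where
  "comp_arr h f = \<lparr>src = src f, trg = trg h, fun_of = compose (carrier (src f)) (fun_of h) (fun_of f)\<rparr>"

record ('q, 'r) gfunctor =
  on_obj :: "('q, nat) rstruct \<Rightarrow> ('r, nat) rstruct"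
  on_arr :: "'q arrow \<Rightarrow> 'r arrow"

definition borel_functor ::
  "'q language \<Rightarrow> 'q fm set \<Rightarrow> 'r language \<Rightarrow> 'r fm set \<Rightarrow> ('q, 'r) gfunctor \<Rightarrow> bool" where
  "borel_functor L' T' L T G \<longleftrightarrow>
     on_obj G \<in> ModB L' T' \<rightarrow>\<^sub>M ModB L T \<and>
     on_arr G \<in> ArrB L' T' \<rightarrow>\<^sub>M ArrB L T \<and>
     (\<forall>f\<in>Arr L' T'. src (on_arr G f) = on_obj G (src f) \<and> trg (on_arr G f) = on_obj G (trg f)) \<and>
     (\<forall>M\<in>Mod L' T'. on_arr G (id_arr M) = id_arr (on_obj G M)) \<and>
     (\<forall>f\<in>Arr L' T'. \<forall>h\<in>Arr L' T'. src h = trg f \<longrightarrow>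
        on_arr G (comp_arr h f) = comp_arr (on_arr G h) (on_arr G f))"

text \<open>All arrows are invertible, so every natural transformation is a natural isomorphism.\<close>

definition borel_nat_iso ::
  "'q language \<Rightarrow> 'q fm set \<Rightarrow> 'r language \<Rightarrow> 'r fm set \<Rightarrow>
   ('q, 'r) gfunctor \<Rightarrow> ('q, 'r) gfunctor \<Rightarrow> bool" where
  "borel_nat_iso L' T' L T G H \<longleftrightarrow>
     borel_functor L' T' L T G \<and> borel_functor L' T' L T H \<and>
     (\<exists>\<eta>. \<eta> \<in> ModB L' T' \<rightarrow>\<^sub>M ArrB L T \<and>
        (\<forall>M\<in>Mod L' T'. src (\<eta> M) = on_obj G M \<and> trg (\<eta> M) = on_obj H M) \<and>
        (\<forall>f\<in>Arr L' T'. comp_arr (\<eta> (trg f)) (on_arr G f) = comp_arr (on_arr H f) (\<eta> (src f))))"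


section \<open>Interpretations\<close>

text \<open>
  \<open>isort_of F\<close> is \<open>F(X)\<close> and \<open>rel_of F R\<close> is \<open>F(R)\<close>.  Indexing \<open>F(X)\<close> by natural numbers is
  no restriction, since families are countable.
\<close>

record ('r, 'q) interp =
  isort_of :: "('q, nat) isort"
  rel_of :: "'r \<Rightarrow> nat list \<Rightarrow> 'q fm"

text \<open>
  \<open>interp_fm F \<phi> is\<close> is the member with index \<open>is\<close> of the family \<open>F(\<phi>)\<close>, for \<open>\<phi>\<close> in the context of
  \<open>length is\<close> variables; its own context has \<open>tdim (isort_of F) is\<close> variables.  Equality becomes
  \<open>\<Squnion>\<^sub>i\<^sub>j \<epsilon>\<^sub>i\<^sub>j\<close>, and quantifiers range over all points of \<open>\<Squnion>\<^sub>i \<alpha>\<^sub>i\<close>.  (The free variables are not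
  relativised to the \<open>\<alpha>\<^sub>i\<close>; this plays no role for sentences.)
\<close>

primrec interp_fm :: "('r, 'q) interp \<Rightarrow> 'r fm \<Rightarrow> nat list \<Rightarrow> 'q fm" where
  "interp_fm F (Atom R vs) = (\<lambda>is. sub (rel_of F R (map (\<lambda>v. is ! v) vs))
     (concat (map (block (isort_of F) is) vs)))"
| "interp_fm F (Eq j k) = (\<lambda>is. sub (eqv (isort_of F) (is ! j) (is ! k))
     (block (isort_of F) is j @ block (isort_of F) is k))"
| "interp_fm F (Neg \<phi>) = (\<lambda>is. Neg (interp_fm F \<phi> is))"
| "interp_fm F (Conj I \<phi>) = (\<lambda>is. Conj I (\<lambda>k. interp_fm F (\<phi> k) is))"
| "interp_fm F (Disj I \<phi>) = (\<lambda>is. Disj I (\<lambda>k. interp_fm F (\<phi> k) is))"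
| "interp_fm F (Forall \<phi>) = (\<lambda>is. Conj (idx (isort_of F)) (\<lambda>i.
     Foralls (nvars (isort_of F) i) (Imp
       (fml (isort_of F) i) (interp_fm F \<phi> (i # is)))))"
| "interp_fm F (Exists \<phi>) = (\<lambda>is. Disj (idx (isort_of F)) (\<lambda>i.
     Existss (nvars (isort_of F) i) (And
       (fml (isort_of F) i) (interp_fm F \<phi> (i # is)))))"

definition is_interp ::
  "'r language \<Rightarrow> 'r fm set \<Rightarrow> 'q language \<Rightarrow> 'q fm set \<Rightarrow> ('r, 'q) interp \<Rightarrow> bool" where
  "is_interp L T L' T' F \<longleftrightarrow>
     is_isort L' T' (isort_of F) \<and>
     (\<forall>R n. L R = Some n \<longrightarrow> is_subsort L' T' (isort_power (isort_of F) n) (rel_of F R)) \<and>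
     (\<forall>\<phi>\<in>T. proves L' T' (interp_fm F \<phi> []))"


section \<open>The functor induced by an interpretation\<close>

text \<open>
  The Borel spaces \<open>\<lbrakk>\<Squnion>\<^sub>i \<alpha>\<^sub>i\<rbrakk>\<close> (a disjoint union over all \<open>i\<close> and all tuples of natural numbers) and
  \<open>\<lbrakk>A\<rbrakk>\<close> (its quotient).  The generating families are already \<open>\<sigma>\<close>-algebras.
\<close>

definition pointsB ::
  "'q language \<Rightarrow> 'q fm set \<Rightarrow> ('q, 'i) isort \<Rightarrow> (('q, nat) rstruct \<times> ('i \<times> nat list)) measure" where
  "pointsB L T A = (let \<Omega> = (SIGMA M : Mod L T. points A M) in
     sigma \<Omega> {S. S \<subseteq> \<Omega> \<and> (\<forall>x. {M \<in> Mod L T. (M, x) \<in> S} \<in> sets (ModB L T))})"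

definition isortB ::
  "'q language \<Rightarrow> 'q fm set \<Rightarrow> ('q, 'i) isort \<Rightarrow> (('q, nat) rstruct \<times> ('i \<times> nat list) set) measure" where
  "isortB L T A = (let \<Omega> = (SIGMA M : Mod L T. isort_val A M) in
     sigma \<Omega> {S. S \<subseteq> \<Omega> \<and>
       {(M, x). M \<in> Mod L T \<and> x \<in> points A M \<and> (M, point_class A M x) \<in> S}
         \<in> sets (pointsB L T A)})"

definition is_coding ::
  "'q language \<Rightarrow> 'q fm set \<Rightarrow> ('q, 'i) isort \<Rightarrow>
   (('q, nat) rstruct \<times> ('i \<times> nat list) set \<Rightarrow> nat) \<Rightarrow> bool" where
  "is_coding L T A e \<longleftrightarrow>
     e \<in> isortB L T A \<rightarrow>\<^sub>M count_space UNIV \<and>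
     (\<forall>M\<in>Mod L T. \<exists>S. init_seg S \<and> bij_betw (\<lambda>c. e (M, c)) (isort_val A M) S)"

definition star_obj ::
  "'r language \<Rightarrow> ('r, 'q) interp \<Rightarrow> (('q, nat) rstruct \<times> (nat \<times> nat list) set \<Rightarrow> nat) \<Rightarrow>
   ('q, nat) rstruct \<Rightarrow> ('r, nat) rstruct" where
  "star_obj L F e M = \<lparr>
     carrier = (\<lambda>c. e (M, c)) ` isort_val (isort_of F) M,
     rel = (\<lambda>R. case L R of None \<Rightarrow> {}
       | Some n \<Rightarrow> map (\<lambda>c. e (M, c)) ` power_subsort_val (isort_of F) n (rel_of F R) M) \<rparr>"

text \<open>For an isomorphism \<open>f\<close>, the induced bijection between quotients sends a class \<open>c\<close>
  to its elementwise image, which is again a class.\<close>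

definition star_arr ::
  "'r language \<Rightarrow> ('r, 'q) interp \<Rightarrow> (('q, nat) rstruct \<times> (nat \<times> nat list) set \<Rightarrow> nat) \<Rightarrow>
   'q arrow \<Rightarrow> 'r arrow" where
  "star_arr L F e f = \<lparr>
     src = star_obj L F e (src f),
     trg = star_obj L F e (trg f),
     fun_of = restrict
       (\<lambda>k. e (trg f, (\<lambda>(i, a). (i, map (fun_of f) a)) `
                inv_into (isort_val (isort_of F) (src f)) (\<lambda>c. e (src f, c)) k))
       (carrier (star_obj L F e (src f))) \<rparr>"

definition star_functor ::
  "'r language \<Rightarrow> ('r, 'q) interp \<Rightarrow> (('q, nat) rstruct \<times> (nat \<times> nat list) set \<Rightarrow> nat) \<Rightarrow>
   ('q, 'r) gfunctor" where
  "star_functor L F e = \<lparr>on_obj = star_obj L F e, on_arr = star_arr L F e\<rparr>"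

end

theory Submission
  imports Defs
begin

text \<open>
Let \<open>G\<close> be a Borel functor from the models of \<open>T'\<close> to the models of \<open>T\<close>.  For a model \<open>M\<close> of \<open>T'\<close> and a
permutation \<open>g\<close> of its underlying set there is an isomorphism \<open>g : M \<rightarrow> gM\<close>, hence a bijection
\<open>G(g) : G(M) \<rightarrow> G(gM)\<close> between initial segments of the natural numbers.  Fix \<open>a \<in> G(M)\<close>.  The space of
permutations is the union over \<open>k\<close> of the Borel sets \<open>{g. G(g)(a) = k}\<close>, so by the Baire category
theorem one of them is comeager in some basic open set \<open>[xs \<mapsto> ts] = {g. g(xs) = ts}\<close>.  Say then that
the tuple \<open>xs\<close>, together with the index \<open>(ts, k)\<close>, denotes \<open>a\<close> in \<open>M\<close>.  Every element of \<open>G(M)\<close> is denoted by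
something (\<open>denotes_exists\<close>), and a name denotes at most one element: if it denoted \<open>a\<close> and \<open>b\<close>, then
\<open>G(g)(a) = k = G(g)(b)\<close> for some \<open>g\<close>, and \<open>G(g)\<close> is injective
(\<open>denotes_unique\<close>).  Thus \<open>G(M)\<close> is the quotient of a set of finite
tuples of elements of \<open>M\<close>, indexed by the countably many pairs \<open>(ts, k)\<close>, by the relation of denoting
the same element.

The relation ``\<open>(ts, k; xs)\<close> denotes \<open>a\<close>'' is preserved by isomorphisms of \<open>M\<close>, with \<open>a\<close> moved by \<open>G\<close>, because
\<open>G\<close> is a functor; it is Borel, because \<open>G\<close> is Borel and the quantifier ``for comeagerly many \<open>g\<close>''
preserves Borel sets (\<open>vaught_Borel\<close>).  Hence relations between names such as ``both denote the same
element'' or ``they denote elements related by \<open>R\<close> in \<open>G(M)\<close>'' are Borel and invariant under isomorphism.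
By the theorem of Lopez-Escobar, for relations on tuples (\<open>lopez_escobar\<close>), they are defined by infinitary
formulas; these formulas are the interpretation \<open>F\<close>.  What has to be provable from \<open>T'\<close> holds in all countable
models by construction, so it is provable by the completeness theorem (\<open>completeness\<close>), which is
proved here for the given calculus by a Henkin construction.

Finally, sending \<open>a \<in> G(M)\<close> to the class of its names is a bijection onto the interpreted sort, natural
in \<open>M\<close>.  Whatever coding \<open>e\<close> of the classes by numbers is used to define the functor \<open>F\<^sup>*\<close>, composing with
\<open>e\<close> gives a Borel family of isomorphisms \<open>G(M) \<rightarrow> F\<^sup>*(M)\<close>, and \<open>F\<^sup>*\<close> is the conjugate of \<open>G\<close> by this family,
from which both the Borel measurability of \<open>F\<^sup>*\<close> and the naturality are read off.

Baire category is used only through finite conditions: a set of permutations is comeager in a basic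
open set if it contains every permutation there that meets each of countably many dense sets of finite
partial permutations.  This treats finite and infinite underlying sets alike.
\<close>

section \<open>Renaming, truth and isomorphism\<close>

lemma wff_mono: "wff L \<phi> n \<Longrightarrow> n \<le> m \<Longrightarrow> wff L \<phi> m"
proof (induction \<phi> arbitrary: n m)
  case (Forall \<phi>)
  show ?case using Forall.IH[of "Suc n" "Suc m"] Forall.prems by simp
next
  case (Exists \<phi>)
  show ?case using Exists.IH[of "Suc n" "Suc m"] Exists.prems by simp
next
  case (Conj I \<phi>)
  then show ?case by (metis rangeI wff.simps(4))
next
  case (Disj I \<phi>)
  then show ?case by (metis rangeI wff.simps(5))
next
  case (Neg \<phi>)
  show ?case using Neg.IH[of n m] Neg.prems by simp
qed auto

lemma wff_ren:
  "wff L \<phi> n \<Longrightarrow> (\<And>v. v < n \<Longrightarrow> r v < m) \<Longrightarrow> wff L (ren \<phi> r) m"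
proof (induction \<phi> arbitrary: n m r)
  case (Forall \<phi>)
  show ?case unfolding ren.simps wff.simps
    by (rule Forall.IH[of "Suc n"]) (use Forall.prems in \<open>auto simp: lift_def split: nat.splits\<close>)
next
  case (Exists \<phi>)
  show ?case unfolding ren.simps wff.simps
    by (rule Exists.IH[of "Suc n"]) (use Exists.prems in \<open>auto simp: lift_def split: nat.splits\<close>)
next
  case (Conj I \<phi>)
  then show ?case by simp (metis rangeI)
next
  case (Disj I \<phi>)
  then show ?case by simp (metis rangeI)
next
  case (Neg \<phi>)
  show ?case using Neg.IH[of n r m] Neg.prems by simp
qed (auto simp: subset_iff)

lemma wff_inst: "wff L \<phi> (Suc n) \<Longrightarrow> k < n \<Longrightarrow> wff L (inst \<phi> k) n"
  unfolding inst_def by (erule wff_ren) (auto split: nat.splits)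

lemma wff_sub: "wff L \<phi> (length vs) \<Longrightarrow> set vs \<subseteq> {..<n} \<Longrightarrow> wff L (sub \<phi> vs) n"
  unfolding sub_def by (erule wff_ren) (auto simp: subset_iff)

lemma sat_ren:
  "wff L \<phi> n \<Longrightarrow> (\<And>v. v < n \<Longrightarrow> a' ! v = a ! r v) \<Longrightarrow> sat M (ren \<phi> r) a \<longleftrightarrow> sat M \<phi> a'"
proof (induction \<phi> arbitrary: n a a' r)
  case (Atom R vs)
  then have "map (\<lambda>v. a ! r v) vs = map ((!) a') vs" by (auto simp: subset_iff)
  then have "map ((!) a) (map r vs) = map ((!) a') vs" by (simp add: comp_def)
  then show ?case by (simp only: ren.simps sat.simps)
next
  case (Forall \<phi>)
  have "sat M (ren \<phi> (lift r)) (b # a) \<longleftrightarrow> sat M \<phi> (b # a')" for b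
    by (rule Forall.IH[of "Suc n"]) (use Forall.prems in \<open>auto simp: lift_def split: nat.splits\<close>)
  then show ?case by simp
next
  case (Exists \<phi>)
  have "sat M (ren \<phi> (lift r)) (b # a) \<longleftrightarrow> sat M \<phi> (b # a')" for b
    by (rule Exists.IH[of "Suc n"]) (use Exists.prems in \<open>auto simp: lift_def split: nat.splits\<close>)
  then show ?case by simp
next
  case (Conj I \<phi>)
  then have "sat M (ren (\<phi> i) r) a \<longleftrightarrow> sat M (\<phi> i) a'" if "i \<in> I" for i
    by (metis rangeI that wff.simps(4))
  then show ?case by simp
next
  case (Disj I \<phi>)
  then have "sat M (ren (\<phi> i) r) a \<longleftrightarrow> sat M (\<phi> i) a'" if "i \<in> I" for i
    by (metis rangeI that wff.simps(5))
  then show ?case by simp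
next
  case (Neg \<phi>) 
  have "sat M (ren \<phi> r) a \<longleftrightarrow> sat M \<phi> a'"
    by (rule Neg.IH[of n]) (use Neg.prems in auto)
  then show ?case by simp
qed auto

lemma ren_id: "ren \<phi> (\<lambda>v. v) = \<phi>"
proof (induction \<phi>)
  case (Forall \<phi>)
  have "lift (\<lambda>v. v) = (\<lambda>v. v)" by (auto simp: lift_def fun_eq_iff split: nat.splits)
  with Forall show ?case by simp
next
  case (Exists \<phi>)
  have "lift (\<lambda>v. v) = (\<lambda>v. v)" by (auto simp: lift_def fun_eq_iff split: nat.splits)
  with Exists show ?case by simp
qed auto

lemma ren_ren: "ren (ren \<phi> r) s = ren \<phi> (\<lambda>v. s (r v))"
proof (induction \<phi> arbitrary: r s)
  case (Forall \<phi>)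
  have "(\<lambda>v. lift s (lift r v)) = lift (\<lambda>v. s (r v))" by (auto simp: lift_def fun_eq_iff split: nat.splits)
  then show ?case by (simp add: Forall)
next
  case (Exists \<phi>)
  have "(\<lambda>v. lift s (lift r v)) = lift (\<lambda>v. s (r v))" by (auto simp: lift_def fun_eq_iff split: nat.splits)
  then show ?case by (simp add: Exists)
qed auto

lemma sat_sub:
  "wff L \<phi> (length vs) \<Longrightarrow> sat M (sub \<phi> vs) a \<longleftrightarrow> sat M \<phi> (map ((!) a) vs)"
  unfolding sub_def by (erule sat_ren) auto

lemma sat_inst:
  "wff L \<phi> (Suc n) \<Longrightarrow> sat M (inst \<phi> k) a \<longleftrightarrow> sat M \<phi> (a ! k # a)"
  unfolding inst_def by (erule sat_ren) (auto split: nat.splits)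

lemma wff_And [simp]: "wff L (And \<phi> \<psi>) n \<longleftrightarrow> wff L \<phi> n \<and> wff L \<psi> n"
  by (auto simp: And_def)

lemma wff_Imp [simp]: "wff L (Imp \<phi> \<psi>) n \<longleftrightarrow> wff L \<phi> n \<and> wff L \<psi> n"
  by (auto simp: Imp_def)

lemma sat_And [simp]: "sat M (And \<phi> \<psi>) a \<longleftrightarrow> sat M \<phi> a \<and> sat M \<psi> a"
  by (auto simp: And_def)

lemma sat_Imp [simp]: "sat M (Imp \<phi> \<psi>) a \<longleftrightarrow> (sat M \<phi> a \<longrightarrow> sat M \<psi> a)"
  by (auto simp: Imp_def)

lemma wff_Foralls [simp]: "wff L (Foralls m \<phi>) n \<longleftrightarrow> wff L \<phi> (m + n)"
  unfolding Foralls_def by (induction m arbitrary: n) auto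

lemma wff_Existss [simp]: "wff L (Existss m \<phi>) n \<longleftrightarrow> wff L \<phi> (m + n)"
  unfolding Existss_def by (induction m arbitrary: n) auto

text \<open>
A block of quantifiers puts its values in front one after the other, so the value of the outermost
quantifier ends up last.
\<close>

lemma lists_length_Suc_append:
  "{b \<in> lists C. length b = Suc m} = {b @ [c] | b c. b \<in> lists C \<and> length b = m \<and> c \<in> C}"
  (is "?A = ?B")
proof
  show "?A \<subseteq> ?B"
  proof
    fix b assume "b \<in> ?A"
    then show "b \<in> ?B" by (cases b rule: rev_cases) auto
  qed
qed auto

lemma sat_Foralls [simp]:
  "sat M (Foralls m \<phi>) a \<longleftrightarrow> (\<forall>b\<in>lists (carrier M). length b = m \<longrightarrow> sat M \<phi> (b @ a))"
proof (induction m arbitrary: a)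
  case 0 then show ?case by (simp add: Foralls_def)
next
  case (Suc m)
  have "sat M (Foralls (Suc m) \<phi>) a \<longleftrightarrow> (\<forall>c\<in>carrier M. sat M (Foralls m \<phi>) (c # a))"
    by (simp add: Foralls_def)
  also have "\<dots> \<longleftrightarrow> (\<forall>b\<in>{b \<in> lists (carrier M). length b = Suc m}. sat M \<phi> (b @ a))"
    unfolding lists_length_Suc_append Suc by fastforce
  finally show ?case by blast
qed

lemma sat_Existss [simp]:
  "sat M (Existss m \<phi>) a \<longleftrightarrow> (\<exists>b\<in>lists (carrier M). length b = m \<and> sat M \<phi> (b @ a))"
proof (induction m arbitrary: a)
  case 0 then show ?case by (simp add: Existss_def)
next
  case (Suc m)
  have "sat M (Existss (Suc m) \<phi>) a \<longleftrightarrow> (\<exists>c\<in>carrier M. sat M (Existss m \<phi>) (c # a))"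
    by (simp add: Existss_def)
  also have "\<dots> \<longleftrightarrow> (\<exists>b\<in>{b \<in> lists (carrier M). length b = Suc m}. sat M \<phi> (b @ a))"
    unfolding lists_length_Suc_append Suc by fastforce
  finally show ?case by blast
qed

lemma sat_iso:
  assumes bij: "bij_betw f (carrier M) (carrier N)"
    and rel: "\<And>R a. a \<in> lists (carrier M) \<Longrightarrow> a \<in> rel M R \<longleftrightarrow> map f a \<in> rel N R"
  shows "wff L \<phi> (length a) \<Longrightarrow> a \<in> lists (carrier M) \<Longrightarrow> sat M \<phi> a \<longleftrightarrow> sat N \<phi> (map f a)"
proof (induction \<phi> arbitrary: a)
  case (Atom R vs)
  have *: "a ! v \<in> carrier M" "map f a ! v = f (a ! v)" if "v \<in> set vs" for v
    using Atom that by (auto simp: subset_iff)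
  then have "map ((!) a) vs \<in> lists (carrier M)" by auto
  from rel[OF this, of R] * show ?case by (simp add: comp_def cong: map_cong)
next
  case (Eq j k)
  then have "a ! j \<in> carrier M" "a ! k \<in> carrier M" by auto
  with bij show ?case using Eq by (auto simp: bij_betw_def inj_on_def)
next
  case (Forall \<phi>)
  have "(\<forall>b\<in>carrier M. sat M \<phi> (b # a)) \<longleftrightarrow> (\<forall>b\<in>carrier M. sat N \<phi> (f b # map f a))"
    using Forall by auto
  also have "\<dots> \<longleftrightarrow> (\<forall>b\<in>carrier N. sat N \<phi> (b # map f a))"
    unfolding bij_betw_imp_surj_on[OF bij, symmetric] by blast
  finally show ?case by simp
next
  case (Exists \<phi>)
  have "(\<exists>b\<in>carrier M. sat M \<phi> (b # a)) \<longleftrightarrow> (\<exists>b\<in>carrier M. sat N \<phi> (f b # map f a))"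
    using Exists by auto
  also have "\<dots> \<longleftrightarrow> (\<exists>b\<in>carrier N. sat N \<phi> (b # map f a))"
    unfolding bij_betw_imp_surj_on[OF bij, symmetric] by blast
  finally show ?case by simp
qed auto

section \<open>Transport of structures\<close>

definition push :: "('r, 'a) rstruct \<Rightarrow> ('a \<Rightarrow> 'b) \<Rightarrow> ('r, 'b) rstruct" where
  "push M f = \<lparr>carrier = f ` carrier M, rel = (\<lambda>R. map f ` rel M R)\<rparr>"

lemma carrier_push [simp]: "carrier (push M f) = f ` carrier M"
  by (simp add: push_def)

lemma rel_in_lists: "is_struct L M \<Longrightarrow> a \<in> rel M R \<Longrightarrow> a \<in> lists (carrier M) \<and> L R = Some (length a)"
  unfolding is_struct_def by (cases "L R"; drule spec[of _ R]) (simp, simp, blast)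

lemma is_structI:
  "(\<And>R a. a \<in> rel M R \<Longrightarrow> L R = Some (length a) \<and> a \<in> lists (carrier M)) \<Longrightarrow> is_struct L M"
  unfolding is_struct_def by (fastforce split: option.splits)

lemma rel_push:
  assumes "is_struct L M" "inj_on f (carrier M)" "a \<in> lists (carrier M)"
  shows "map f a \<in> rel (push M f) R \<longleftrightarrow> a \<in> rel M R"
proof
  assume "map f a \<in> rel (push M f) R"
  then obtain b where b: "b \<in> rel M R" "map f a = map f b" by (auto simp: push_def)
  have "b \<in> lists (carrier M)" using rel_in_lists[OF assms(1) b(1)] by simp
  with assms(2,3) b(2) have "a = b" by (meson inj_on_map_lists inj_onD lists_mono subset_refl)
  with b show "a \<in> rel M R" by simp
qed (auto simp: push_def)

lemma is_struct_push: "is_struct L M \<Longrightarrow> is_struct L (push M f)"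
  by (rule is_structI) (auto simp: push_def dest!: rel_in_lists)

lemma is_model_iso:
  assumes "is_theory L T" "is_model L T M" "is_struct L N"
    and "bij_betw f (carrier M) (carrier N)"
    and "\<And>R a. a \<in> lists (carrier M) \<Longrightarrow> a \<in> rel M R \<longleftrightarrow> map f a \<in> rel N R"
  shows "is_model L T N"
proof -
  have "sat N \<phi> []" if "\<phi> \<in> T" for \<phi>
    using sat_iso[OF assms(4,5), of L \<phi> "[]"] that assms(1,2)
    by (simp add: is_theory_def is_model_def)
  with assms(3) show ?thesis by (simp add: is_model_def)
qed

lemma is_model_push:
  assumes "is_theory L T" "is_model L T M" "inj_on f (carrier M)"
  shows "is_model L T (push M f)"
proof -
  have s: "is_struct L M" using assms(2) by (simp add: is_model_def)
  show ?thesis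
  proof (rule is_model_iso[OF assms(1,2)])
    show "bij_betw f (carrier M) (carrier (push M f))" using assms(3) by (simp add: bij_betw_def)
  qed (use rel_push[OF s assms(3)] is_struct_push[OF s] in auto)
qed

section \<open>The completeness theorem\<close>

type_synonym 'r signed = "bool \<times> 'r fm"

text \<open>
A sequent is kept as one list of signed formulas, \<open>True\<close> marking the left side.  It is a list because
the construction below refers to formulas by their positions, which survive when the sequent grows.
\<close>

definition consistent :: "'r language \<Rightarrow> 'r fm set \<Rightarrow> nat \<Rightarrow> 'r signed list \<Rightarrow> bool" where
  "consistent L T n l \<longleftrightarrow> (\<forall>(b, \<psi>)\<in>set l. wff L \<psi> n) \<and>
     \<not> derives L T n {\<psi>. (True, \<psi>) \<in> set l} {\<psi>. (False, \<psi>) \<in> set l}"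

text \<open>
The steps of the Henkin construction.  \<open>Decompose p i\<close> breaks up the formula at position \<open>p\<close>, where \<open>i\<close> selects a
member of a conjunction or disjunction, or the parameter for an instance of a quantifier.  \<open>Assert \<psi>\<close>
adds an axiom, and \<open>Decide \<psi>\<close> puts an atomic formula on one of the two sides.
\<close>

datatype 'r task = Decompose nat nat | Assert "'r fm" | Decide "'r fm"

text \<open>
Parameters are numbered in the order of their introduction.  Unlike de Bruijn indices, these numbers do
not change when the context grows: in a context of \<open>n\<close> variables, parameter \<open>c\<close> is the variable
\<open>n - Suc c\<close>.  \<open>level n \<psi>\<close> is the formula in that context which \<open>\<psi>\<close> becomes when its variables are read as
parameters.
\<close>

definition level :: "nat \<Rightarrow> 'r fm \<Rightarrow> 'r fm" where
  "level n \<psi> = ren \<psi> (\<lambda>c. n - Suc c)"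

text \<open>
In the second case a parameter is added to the context; it is the variable \<open>0\<close>, and all
others are shifted.
\<close>

definition extends :: "nat \<Rightarrow> 'r signed list \<Rightarrow> nat \<Rightarrow> 'r signed list \<Rightarrow> bool" where
  "extends n l n' l' \<longleftrightarrow> (n' = n \<and> (\<exists>s. l' = l @ s)) \<or>
     (n' = Suc n \<and> (\<exists>s. l' = map (map_prod id (\<lambda>\<psi>. ren \<psi> Suc)) l @ s))"

text \<open>
What has become of a formula with sign \<open>b\<close> in context \<open>n\<close> when the next sequent has context \<open>n'\<close> and set of
signed formulas \<open>X\<close>.
\<close>

primrec treats :: "'r fm \<Rightarrow> nat \<Rightarrow> nat \<Rightarrow> bool \<Rightarrow> nat \<Rightarrow> 'r signed set \<Rightarrow> bool" where
  "treats (Atom R vs) = (\<lambda>n i b n' X. True)"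
| "treats (Eq j k) = (\<lambda>n i b n' X. True)"
| "treats (Neg \<phi>) = (\<lambda>n i b n' X. n' = n \<and> (\<not> b, \<phi>) \<in> X)"
| "treats (Conj I \<phi>) = (\<lambda>n i b n' X. n' = n \<and>
     (if b then i \<in> I \<longrightarrow> (True, \<phi> i) \<in> X else (\<exists>j\<in>I. (False, \<phi> j) \<in> X)))"
| "treats (Disj I \<phi>) = (\<lambda>n i b n' X. n' = n \<and>
     (if b then (\<exists>j\<in>I. (True, \<phi> j) \<in> X) else i \<in> I \<longrightarrow> (False, \<phi> i) \<in> X))"
| "treats (Forall \<phi>) = (\<lambda>n i b n' X.
     if b then n' = n \<and> (i < n \<longrightarrow> (True, inst \<phi> (n - Suc i)) \<in> X) else n' = Suc n \<and> (False, \<phi>) \<in> X)"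
| "treats (Exists \<phi>) = (\<lambda>n i b n' X.
     if b then n' = Suc n \<and> (True, \<phi>) \<in> X else n' = n \<and> (i < n \<longrightarrow> (False, inst \<phi> (n - Suc i)) \<in> X))"

primrec performs :: "'r language \<Rightarrow> 'r task \<Rightarrow> nat \<Rightarrow> 'r signed list \<Rightarrow> nat \<Rightarrow> 'r signed list \<Rightarrow> bool" where
  "performs L (Decompose p i) = (\<lambda>n l n' l'.
     p < length l \<longrightarrow> treats (snd (l ! p)) n i (fst (l ! p)) n' (set l'))"
| "performs L (Assert \<psi>) = (\<lambda>n l n' l'. n' = n \<and> (True, \<psi>) \<in> set l')"
| "performs L (Decide \<psi>) = (\<lambda>n l n' l'. wff L \<psi> n \<longrightarrow> n' = n \<and> (\<exists>b. (b, level n \<psi>) \<in> set l'))"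

lemma consistent_wff: "consistent L T n l \<Longrightarrow> (b, \<psi>) \<in> set l \<Longrightarrow> wff L \<psi> n"
  by (auto simp: consistent_def)

lemma consistent_snoc:
  assumes "consistent L T n l" "wff L \<psi> n"
  shows "consistent L T n (l @ [(True, \<psi>)]) \<longleftrightarrow>
     \<not> derives L T n (insert \<psi> {\<psi>. (True, \<psi>) \<in> set l}) {\<psi>. (False, \<psi>) \<in> set l}" (is ?A)
    and "consistent L T n (l @ [(False, \<psi>)]) \<longleftrightarrow>
     \<not> derives L T n {\<psi>. (True, \<psi>) \<in> set l} (insert \<psi> {\<psi>. (False, \<psi>) \<in> set l})" (is ?B)
proof -
  have "{\<theta>. (True, \<theta>) \<in> set (l @ [(True, \<psi>)])} = insert \<psi> {\<psi>. (True, \<psi>) \<in> set l}"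
    "{\<theta>. (False, \<theta>) \<in> set (l @ [(True, \<psi>)])} = {\<psi>. (False, \<psi>) \<in> set l}"
    "{\<theta>. (False, \<theta>) \<in> set (l @ [(False, \<psi>)])} = insert \<psi> {\<psi>. (False, \<psi>) \<in> set l}"
    "{\<theta>. (True, \<theta>) \<in> set (l @ [(False, \<psi>)])} = {\<psi>. (True, \<psi>) \<in> set l}"
    by auto
  with assms show ?A ?B unfolding consistent_def by auto
qed

text \<open>
Each clause is a rule of the calculus read backwards: if the conclusion is not derivable, then neither is
one of the premises, and this premise is the next sequent.  Assertions and decisions use the cut rule.
\<close>

lemma consistent_step:
  assumes c: "consistent L T n l"
    and valid: "\<And>\<psi>. task = Assert \<psi> \<Longrightarrow> \<psi> \<in> T \<and> wff L \<psi> n"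
  shows "\<exists>n' l'. consistent L T n' l' \<and> extends n l n' l' \<and> performs L task n l n' l'"
proof -
  let ?G = "{\<psi>. (True, \<psi>) \<in> set l}" and ?D = "{\<psi>. (False, \<psi>) \<in> set l}"
  have nd: "\<not> derives L T n ?G ?D" using c by (simp add: consistent_def)
  have one: "\<exists>n' l'. consistent L T n' l' \<and> extends n l n' l' \<and> Q n' l'"
    if "consistent L T n (l @ [x])" "Q n (l @ [x])" for Q x
    using that by (intro exI[of _ n] exI[of _ "l @ [x]"]) (auto simp: extends_def)
  have none: "\<exists>n' l'. consistent L T n' l' \<and> extends n l n' l' \<and> Q n' l'" if "Q n l" for Q
    using that c by (intro exI[of _ n] exI[of _ l]) (auto simp: extends_def)
  have cutting: "consistent L T n (l @ [(True, \<psi>)]) \<or> consistent L T n (l @ [(False, \<psi>)])"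
    if "wff L \<psi> n" for \<psi>
    unfolding consistent_snoc[OF c that] using derives.Cut[OF that, where \<Gamma> = ?G and \<Delta> = ?D and T = T] nd by blast
  note snoc = consistent_snoc[OF c]
  show ?thesis
  proof (cases task)
    case (Assert \<psi>)
    then have \<psi>: "\<psi> \<in> T" "wff L \<psi> n" using valid by auto
    have "\<not> consistent L T n (l @ [(False, \<psi>)])"
      unfolding snoc[OF \<psi>(2)] using derives.Axiom[OF \<psi>(1)] by blast
    then show ?thesis using cutting[OF \<psi>(2)] Assert by (intro one[of "(True, \<psi>)"]) auto
  next
    case (Decide \<psi>)
    show ?thesis
    proof (cases "wff L \<psi> n")
      case True
      then have "wff L (level n \<psi>) n" unfolding level_def by (rule wff_ren) simp
      from cutting[OF this] obtain b where "consistent L T n (l @ [(b, level n \<psi>)])" by blast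
      then show ?thesis by (rule one) (auto simp: Decide)
    next
      case False
      then show ?thesis by (intro none) (simp add: Decide)
    qed
  next
    case (Decompose p i)
    show ?thesis
    proof (cases "p < length l")
      case p: True
      obtain b \<theta> where b: "l ! p = (b, \<theta>)" by (cases "l ! p")
      then have mem: "(b, \<theta>) \<in> set l" using p by (metis nth_mem)
      then have wf: "wff L \<theta> n" using consistent_wff[OF c] by blast
      have ins: "insert \<theta> ?G = ?G" if b using mem that by auto
      have ins': "insert \<theta> ?D = ?D" if "\<not> b" using mem that by auto
      have "\<exists>n' l'. consistent L T n' l' \<and> extends n l n' l' \<and> treats \<theta> n i b n' (set l')"
      proof (cases \<theta>)
        case (Neg \<phi>)
        have "consistent L T n (l @ [(\<not> b, \<phi>)])"
        proof (cases b)
          case True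
          then show ?thesis using snoc[of \<phi>] wf Neg ins nd
            derives.NegL[where L = L and T = T and n = n and \<Gamma> = ?G and \<phi> = \<phi> and \<Delta> = ?D] by auto
        next
          case False
          then show ?thesis using snoc[of \<phi>] wf Neg ins' nd
            derives.NegR[where L = L and T = T and n = n and \<Gamma> = ?G and \<phi> = \<phi> and \<Delta> = ?D] by auto
        qed
        then show ?thesis by (rule one) (simp add: Neg)
      next
        case (Conj I \<phi>)
        show ?thesis
        proof (cases b)
          case True
          show ?thesis
          proof (cases "i \<in> I")
            case iI: True
            then have "consistent L T n (l @ [(True, \<phi> i)])"
              using snoc[of "\<phi> i"] wf Conj ins[OF True] nd
              derives.ConjL[where L = L and T = T and n = n and \<Gamma> = ?G and \<phi> = \<phi> and I = I and \<Delta> = ?D] by auto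
            then show ?thesis by (rule one) (simp add: Conj True)
          next
            case iI: False
            then show ?thesis by (intro none) (simp add: Conj True)
          qed
        next
          case False
          have "\<exists>j\<in>I. consistent L T n (l @ [(False, \<phi> j)])"
            using snoc wf Conj ins'[OF False] nd
              derives.ConjR[where L = L and T = T and n = n and \<Gamma> = ?G and \<phi> = \<phi> and I = I and \<Delta> = ?D] by auto
          then obtain j where "j \<in> I" "consistent L T n (l @ [(False, \<phi> j)])" by blast
          then show ?thesis by (intro one[of "(False, \<phi> j)"]) (auto simp: Conj False)
        qed
      next
        case (Disj I \<phi>)
        show ?thesis
        proof (cases b)
          case False
          show ?thesis
          proof (cases "i \<in> I")
            case iI: True
            then have "consistent L T n (l @ [(False, \<phi> i)])"
              using snoc[of "\<phi> i"] wf Disj ins'[OF False] nd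
              derives.DisjR[where L = L and T = T and n = n and \<Gamma> = ?G and \<phi> = \<phi> and I = I and \<Delta> = ?D] by auto
            then show ?thesis by (rule one) (simp add: Disj False)
          next
            case iI: False
            then show ?thesis by (intro none) (simp add: Disj False)
          qed
        next
          case True
          have "\<exists>j\<in>I. consistent L T n (l @ [(True, \<phi> j)])"
            using snoc wf Disj ins[OF True] nd
              derives.DisjL[where L = L and T = T and n = n and \<Gamma> = ?G and \<phi> = \<phi> and I = I and \<Delta> = ?D] by auto
          then obtain j where "j \<in> I" "consistent L T n (l @ [(True, \<phi> j)])" by blast
          then show ?thesis by (intro one[of "(True, \<phi> j)"]) (auto simp: Disj True)
        qed
      next
        case (Forall \<phi>)
        show ?thesis
        proof (cases b)
          case True
          show ?thesis
          proof (cases "i < n")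
            case iI: True
            then have "wff L (inst \<phi> (n - Suc i)) n" using wf Forall by (intro wff_inst) auto
            then have "consistent L T n (l @ [(True, inst \<phi> (n - Suc i))])"
              using snoc[of "inst \<phi> (n - Suc i)"] Forall ins[OF True] nd iI
              derives.ForallL[where L = L and T = T and n = n and \<Gamma> = ?G and \<phi> = \<phi> and k = "n - Suc i" and \<Delta> = ?D] by auto
            then show ?thesis by (rule one) (simp add: Forall True)
          next
            case iI: False
            then show ?thesis by (intro none) (simp add: Forall True)
          qed
        next
          case False
          let ?l = "map (map_prod id (\<lambda>\<psi>. ren \<psi> Suc)) l @ [(False, \<phi>)]"
          have "{\<psi>. (True, \<psi>) \<in> set ?l} = (\<lambda>\<psi>. ren \<psi> Suc) ` ?G"
            "{\<psi>. (False, \<psi>) \<in> set ?l} = insert \<phi> ((\<lambda>\<psi>. ren \<psi> Suc) ` ?D)" by force+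
          moreover have "\<forall>(b, \<psi>)\<in>set ?l. wff L \<psi> (Suc n)"
            using wf Forall consistent_wff[OF c] by (auto intro!: wff_ren[of L _ n])
          ultimately have "consistent L T (Suc n) ?l" unfolding consistent_def
            using Forall ins'[OF False] nd
              derives.ForallR[where L = L and T = T and n = n and \<Gamma> = ?G and \<phi> = \<phi> and \<Delta> = ?D] by auto
          then show ?thesis by (intro exI[of _ "Suc n"] exI[of _ ?l]) (auto simp: Forall False extends_def)
        qed
      next
        case (Exists \<phi>)
        show ?thesis
        proof (cases b)
          case False
          show ?thesis
          proof (cases "i < n")
            case iI: True
            then have "wff L (inst \<phi> (n - Suc i)) n" using wf Exists by (intro wff_inst) auto
            then have "consistent L T n (l @ [(False, inst \<phi> (n - Suc i))])"
              using snoc[of "inst \<phi> (n - Suc i)"] Exists ins'[OF False] nd iI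
              derives.ExistsR[where L = L and T = T and n = n and \<Gamma> = ?G and \<phi> = \<phi> and k = "n - Suc i" and \<Delta> = ?D] by auto
            then show ?thesis by (rule one) (simp add: Exists False)
          next
            case iI: False
            then show ?thesis by (intro none) (simp add: Exists False)
          qed
        next
          case True
          let ?l = "map (map_prod id (\<lambda>\<psi>. ren \<psi> Suc)) l @ [(True, \<phi>)]"
          have "{\<psi>. (True, \<psi>) \<in> set ?l} = insert \<phi> ((\<lambda>\<psi>. ren \<psi> Suc) ` ?G)"
            "{\<psi>. (False, \<psi>) \<in> set ?l} = (\<lambda>\<psi>. ren \<psi> Suc) ` ?D" by force+
          moreover have "\<forall>(b, \<psi>)\<in>set ?l. wff L \<psi> (Suc n)"
            using wf Exists consistent_wff[OF c] by (auto intro!: wff_ren[of L _ n])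
          ultimately have "consistent L T (Suc n) ?l" unfolding consistent_def
            using Exists ins[OF True] nd
              derives.ExistsL[where L = L and T = T and n = n and \<Gamma> = ?G and \<phi> = \<phi> and \<Delta> = ?D] by auto
          then show ?thesis by (intro exI[of _ "Suc n"] exI[of _ ?l]) (auto simp: Exists True extends_def)
        qed
      next
        case (Atom R vs)
        then show ?thesis by (intro none) simp
      next
        case (Eq j k)
        then show ?thesis by (intro none) simp
      qed
      then show ?thesis by (simp add: Decompose b p)
    next
      case False
      then show ?thesis by (intro none) (simp add: Decompose)
    qed
  qed
qed


definition atomic :: "'r fm \<Rightarrow> bool" where
  "atomic \<psi> \<longleftrightarrow> (\<exists>R cs. \<psi> = Atom R cs) \<or> (\<exists>c d. \<psi> = Eq c d)"

text \<open>
This is claimed for atomic formulas only: in a conjunction or disjunction, the members outside the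
index set are renamed as well, and well-formedness says nothing about their variables, so the two
sides could differ there.
\<close>

lemma level_shift:
  assumes "atomic \<psi>" "wff L \<psi> n" "n \<le> m"
  shows "ren (level n \<psi>) (\<lambda>v. v + (m - n)) = level m \<psi>"
proof -
  have "n - Suc c + (m - n) = m - Suc c" if "c < n" for c using that assms(3) by simp
  note * = this
  from assms(1) show ?thesis unfolding atomic_def
  proof (elim disjE exE)
    fix R cs assume "\<psi> = Atom R cs"
    with assms(2) show ?thesis by (auto simp: level_def subset_iff intro!: *)
  qed (use assms(2,3) in \<open>auto simp: level_def\<close>)
qed

text \<open>
An infinite sequence of consistent sequents, each obtained from the previous one by performing a task,
in which every task is repeated infinitely often.  Repetition matters because a task has no effect before the
formula or the parameters that it refers to are present.
\<close>

locale henkin =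
  fixes L :: "'r language" and T :: "'r fm set"
    and ctx :: "nat \<Rightarrow> nat" and sq :: "nat \<Rightarrow> 'r signed list" and tk :: "nat \<Rightarrow> 'r task"
  assumes sentences: "is_theory L T"
    and cons: "consistent L T (ctx t) (sq t)"
    and ext: "extends (ctx t) (sq t) (ctx (Suc t)) (sq (Suc t))"
    and perf: "performs L (tk t) (ctx t) (sq t) (ctx (Suc t)) (sq (Suc t))"
    and tk_Decompose: "\<exists>t\<ge>t0. tk t = Decompose p i"
    and tk_Assert: "\<psi> \<in> T \<Longrightarrow> \<exists>t\<ge>t0. tk t = Assert \<psi>"
    and tk_Decide: "atomic \<psi> \<Longrightarrow> wff L \<psi> n \<Longrightarrow> \<exists>t\<ge>t0. tk t = Decide \<psi>"
begin

lemma wf: "(b, \<psi>) \<in> set (sq t) \<Longrightarrow> wff L \<psi> (ctx t)"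
  using consistent_wff[OF cons] .

lemma ext_nth:
  assumes "p < length (sq t)" "t \<le> t'"
  shows "ctx t \<le> ctx t' \<and> p < length (sq t') \<and>
    sq t' ! p = map_prod id (\<lambda>\<psi>. ren \<psi> (\<lambda>v. v + (ctx t' - ctx t))) (sq t ! p)"
  using assms(2)
proof (induction rule: dec_induct)
  case base
  then show ?case using assms by (cases "sq t ! p") (simp add: ren_id)
next
  case (step m)
  have "(\<lambda>v. Suc (v + (ctx m - ctx t))) = (\<lambda>v. v + (Suc (ctx m) - ctx t))"
    using step.IH by auto
  then show ?case using ext[of m] step.IH unfolding extends_def
    by (cases "sq t ! p") (auto simp: nth_append ren_ren)
qed

lemma ctx_mono: "t \<le> t' \<Longrightarrow> ctx t \<le> ctx t'"
proof (induction rule: dec_induct)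
  case (step m)
  then show ?case using ext[of m] by (auto simp: extends_def)
qed simp

lemma mem_mono:
  assumes "(b, \<psi>) \<in> set (sq t)" "t \<le> t'"
  shows "(b, ren \<psi> (\<lambda>v. v + (ctx t' - ctx t))) \<in> set (sq t')"
proof -
  obtain p where "p < length (sq t)" "sq t ! p = (b, \<psi>)" using assms(1) by (metis in_set_conv_nth)
  with ext_nth[OF this(1) assms(2)] show ?thesis by (auto simp: in_set_conv_nth)
qed

lemma treated:
  assumes "(b, \<psi>) \<in> set (sq t)" "t \<le> t0"
  shows "\<exists>t'\<ge>t0. treats (ren \<psi> (\<lambda>v. v + (ctx t' - ctx t))) (ctx t') i b (ctx (Suc t')) (set (sq (Suc t')))"
proof -
  obtain p where p: "p < length (sq t)" "sq t ! p = (b, \<psi>)" using assms(1) by (metis in_set_conv_nth)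
  obtain t' where t': "t' \<ge> t0" "tk t' = Decompose p i" using tk_Decompose by blast
  with assms(2) have "t \<le> t'" by simp
  from ext_nth[OF p(1) this] p(2) perf[of t'] t' show ?thesis by auto
qed

lemma not_both: "(True, \<psi>) \<in> set (sq t) \<Longrightarrow> (False, \<psi>) \<in> set (sq t) \<Longrightarrow> False"
  using cons[of t] derives.Init[of \<psi> "{\<psi>. (True, \<psi>) \<in> set (sq t)}"] by (auto simp: consistent_def)

definition settled :: "bool \<Rightarrow> 'r fm \<Rightarrow> bool" where
  "settled b \<psi> \<longleftrightarrow> (\<exists>t. wff L \<psi> (ctx t) \<and> (b, level (ctx t) \<psi>) \<in> set (sq t))"

lemma settled_later:
  assumes "atomic \<psi>" "settled b \<psi>"
  shows "\<exists>t. \<forall>t'\<ge>t. wff L \<psi> (ctx t') \<and> (b, level (ctx t') \<psi>) \<in> set (sq t')"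
proof -
  obtain t where t: "wff L \<psi> (ctx t)" "(b, level (ctx t) \<psi>) \<in> set (sq t)" using assms(2) by (auto simp: settled_def)
  have "wff L \<psi> (ctx t') \<and> (b, level (ctx t') \<psi>) \<in> set (sq t')" if "t \<le> t'" for t'
    using mem_mono[OF t(2) that] level_shift[OF assms(1) t(1) ctx_mono[OF that]]
      wff_mono[OF t(1) ctx_mono[OF that]] by simp
  then show ?thesis by blast
qed

text \<open>
Some \<open>Decide\<close> task settles the formula, and it cannot be settled both ways: both signs would meet in one
sequent, which would be an initial sequent.
\<close>

lemma settled_False:
  assumes "atomic \<psi>" "wff L \<psi> (ctx t)"
  shows "settled False \<psi> \<longleftrightarrow> \<not> settled True \<psi>"
proof
  assume F: "settled False \<psi>"
  show "\<not> settled True \<psi>"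
  proof
    assume T: "settled True \<psi>"
    obtain t where t: "\<forall>t'\<ge>t. (True, level (ctx t') \<psi>) \<in> set (sq t')" using settled_later[OF assms(1) T] by blast
    obtain s where s: "\<forall>t'\<ge>s. (False, level (ctx t') \<psi>) \<in> set (sq t')" using settled_later[OF assms(1) F] by blast
    show False using t[rule_format, of "max t s"] s[rule_format, of "max t s"] not_both by simp
  qed
next
  assume *: "\<not> settled True \<psi>"
  obtain t' where t': "t' \<ge> t" "tk t' = Decide \<psi>" using tk_Decide[OF assms] by blast
  have w: "wff L \<psi> (ctx t')" using assms(2) ctx_mono[OF t'(1)] by (rule wff_mono)
  then obtain b where "ctx (Suc t') = ctx t'" "(b, level (ctx t') \<psi>) \<in> set (sq (Suc t'))"
    using perf[of t'] t'(2) by auto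
  with w have "settled b \<psi>" unfolding settled_def by metis
  with * show "settled False \<psi>" by (cases b) auto
qed

definition params :: "nat set" where
  "params = {c. \<exists>t. c < ctx t}"

definition eqc :: "nat \<Rightarrow> nat \<Rightarrow> bool" where
  "eqc c d \<longleftrightarrow> settled True (Eq c d)"

lemma params_fin: "finite C \<Longrightarrow> C \<subseteq> params \<Longrightarrow> \<exists>t. C \<subseteq> {..<ctx t}"
proof (induction rule: finite_induct)
  case (insert c C)
  then obtain t t' where "C \<subseteq> {..<ctx t}" "c < ctx t'" by (auto simp: params_def)
  then have "insert c C \<subseteq> {..<ctx (max t t')}"
    using ctx_mono[of t "max t t'"] ctx_mono[of t' "max t t'"] by fastforce
  then show ?case ..
qed auto

lemma eqc_refl: "c \<in> params \<Longrightarrow> eqc c c"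
proof (rule ccontr)
  assume "c \<in> params" "\<not> eqc c c"
  then have at: "atomic (Eq c c :: 'r fm)" and "settled False (Eq c c)"
    using settled_False[of "Eq c c"] by (auto simp: eqc_def params_def atomic_def)
  then obtain t where t: "c < ctx t" "(False, level (ctx t) (Eq c c)) \<in> set (sq t)"
    by (auto simp: settled_def)
  have "derives L T (ctx t) {\<psi>. (True, \<psi>) \<in> set (sq t)} {\<psi>. (False, \<psi>) \<in> set (sq t)}"
    by (rule derives.EqRefl[of "ctx t - Suc c"]) (use t in \<open>auto simp: level_def\<close>)
  then show False using cons[of t] by (simp add: consistent_def)
qed

text \<open>
Substitution of equals for one parameter in an atomic formula.  If the result were settled false, then at a
late stage a sequent would be an instance of the substitution rule.
\<close>

lemma eqc_subst:
  assumes "eqc c d" "atomic \<psi>" "settled True \<psi>" "atomic \<psi>'" "wff L \<psi>' (ctx s)"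
    and \<phi>: "\<And>t. wff L \<psi> (ctx t) \<Longrightarrow> wff L \<psi>' (ctx t) \<Longrightarrow> c < ctx t \<Longrightarrow> d < ctx t \<Longrightarrow>
      \<exists>\<phi>. wff L \<phi> (Suc (ctx t)) \<and> inst \<phi> (ctx t - Suc c) = level (ctx t) \<psi> \<and>
          inst \<phi> (ctx t - Suc d) = level (ctx t) \<psi>'"
  shows "settled True \<psi>'"
proof (rule ccontr)
  assume "\<not> ?thesis"
  with assms have F: "settled False \<psi>'" using settled_False by blast
  have at: "atomic (Eq c d :: 'r fm)" by (auto simp: atomic_def)
  obtain t1 where t1: "\<forall>t\<ge>t1. wff L (Eq c d :: 'r fm) (ctx t) \<and> (True, level (ctx t) (Eq c d)) \<in> set (sq t)"
    using settled_later[OF at] assms(1) by (auto simp: eqc_def)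
  obtain t2 where t2: "\<forall>t\<ge>t2. wff L \<psi> (ctx t) \<and> (True, level (ctx t) \<psi>) \<in> set (sq t)"
    using settled_later[OF assms(2,3)] by blast
  obtain t3 where t3: "\<forall>t\<ge>t3. wff L \<psi>' (ctx t) \<and> (False, level (ctx t) \<psi>') \<in> set (sq t)"
    using settled_later[OF assms(4) F] by blast
  define t where "t = max t1 (max t2 t3)"
  have ts: "t1 \<le> t" "t2 \<le> t" "t3 \<le> t" by (auto simp: t_def)
  have c: "c < ctx t" "d < ctx t" "(True, Eq (ctx t - Suc c) (ctx t - Suc d)) \<in> set (sq t)"
    using t1 ts by (auto simp: level_def)
  have \<psi>: "wff L \<psi> (ctx t)" "(True, level (ctx t) \<psi>) \<in> set (sq t)" using t2 ts by auto
  have \<psi>': "wff L \<psi>' (ctx t)" "(False, level (ctx t) \<psi>') \<in> set (sq t)" using t3 ts by auto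
  obtain \<phi> where f: "wff L \<phi> (Suc (ctx t))" "inst \<phi> (ctx t - Suc c) = level (ctx t) \<psi>"
     "inst \<phi> (ctx t - Suc d) = level (ctx t) \<psi>'" using \<phi>[OF \<psi>(1) \<psi>'(1) c(1,2)] by blast
  have "derives L T (ctx t) {\<psi>. (True, \<psi>) \<in> set (sq t)} {\<psi>. (False, \<psi>) \<in> set (sq t)}"
    by (rule derives.EqSubst[of "ctx t - Suc c" _ "ctx t - Suc d" L \<phi>]) (use c \<psi> \<psi>' f in auto)
  then show False using cons[of t] by (simp add: consistent_def)
qed

lemma eqc_params: "eqc c d \<Longrightarrow> c \<in> params \<and> d \<in> params"
  by (auto simp: eqc_def settled_def params_def)

lemma eqc_euclid:
  assumes "eqc c d" "eqc c e"
  shows "eqc d e"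
proof -
  have "finite {d, e}" "{d, e} \<subseteq> params" using eqc_params assms by auto
  from params_fin[OF this] obtain s where s: "d < ctx s" "e < ctx s" by auto
  show ?thesis unfolding eqc_def
  proof (rule eqc_subst[OF assms(1)])
    show "settled True (Eq c e)" using assms(2) by (simp add: eqc_def)
    show "wff L (Eq d e) (ctx s)" using s by simp
    show "\<exists>\<phi>. wff L \<phi> (Suc (ctx t)) \<and> inst \<phi> (ctx t - Suc c) = level (ctx t) (Eq c e) \<and>
          inst \<phi> (ctx t - Suc d) = level (ctx t) (Eq d e)"
      if "wff L (Eq c e) (ctx t)" for t
      using that by (intro exI[of _ "Eq 0 (Suc (ctx t - Suc e))"]) (auto simp: inst_def level_def)
  qed (auto simp: atomic_def)
qed

lemma eqc_sym: "eqc c d \<Longrightarrow> eqc d c"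
  using eqc_euclid eqc_refl eqc_params by blast

lemma eqc_trans: "eqc c d \<Longrightarrow> eqc d e \<Longrightarrow> eqc c e"
  using eqc_euclid eqc_sym by blast

definition rep :: "nat \<Rightarrow> nat" where
  "rep c = (LEAST d. eqc c d)"

lemma rep_eq_iff:
  assumes "c \<in> params" "d \<in> params"
  shows "rep c = rep d \<longleftrightarrow> eqc c d"
proof
  assume "eqc c d"
  then have "eqc c = eqc d" using eqc_sym eqc_trans by blast
  then show "rep c = rep d" by (simp add: rep_def)
next
  assume eq: "rep c = rep d"
  have "eqc c (rep c)" "eqc d (rep d)"
    unfolding rep_def using eqc_refl assms by (auto intro: LeastI)
  then show "eqc c d" using eq eqc_sym eqc_trans by metis
qed

lemma settled_Atom_update:
  assumes A: "settled True (Atom R cs)" and i: "i < length cs" "eqc (cs ! i) d"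
  shows "settled True (Atom R (cs[i := d]))"
proof -
  have R: "L R = Some (length cs)" and "set cs \<subseteq> params" using A by (auto simp: settled_def params_def)
  moreover have "set (cs[i := d]) \<subseteq> insert d (set cs)" by (rule set_update_subset_insert)
  ultimately have "set (cs[i := d]) \<subseteq> params" using eqc_params[OF i(2)] by blast
  from params_fin[OF _ this] obtain s where s: "set (cs[i := d]) \<subseteq> {..<ctx s}" by auto
  show ?thesis
  proof (rule eqc_subst[OF i(2)])
    show "settled True (Atom R cs)" by fact
    show "wff L (Atom R (cs[i := d])) (ctx s)" using s R by simp
    fix t
    assume t: "wff L (Atom R cs) (ctx t)"
    let ?vs = "map (\<lambda>c. ctx t - Suc c) cs"
    let ?ws = "(map Suc ?vs)[i := 0]"
    have ws: "map (case_nat k (\<lambda>v. v)) ?ws = ?vs[i := k]" for k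
      by (simp add: map_update comp_def)
    have "wff L (Atom R ?ws) (Suc (ctx t))"
    proof -
      have "set ?ws \<subseteq> insert 0 (set (map Suc ?vs))" by (rule set_update_subset_insert)
      then show ?thesis using R t by fastforce
    qed
    moreover have "inst (Atom R ?ws) (ctx t - Suc (cs ! i)) = level (ctx t) (Atom R cs)"
      unfolding inst_def ren.simps ws level_def using i(1) by (simp add: list_update_same_conv)
    moreover have "inst (Atom R ?ws) (ctx t - Suc d) = level (ctx t) (Atom R (cs[i := d]))"
      unfolding inst_def ren.simps ws level_def by (simp add: map_update)
    ultimately show "\<exists>\<phi>. wff L \<phi> (Suc (ctx t)) \<and> inst \<phi> (ctx t - Suc (cs ! i)) = level (ctx t) (Atom R cs) \<and>
          inst \<phi> (ctx t - Suc d) = level (ctx t) (Atom R (cs[i := d]))" by blast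
  qed (auto simp: atomic_def)
qed

lemma settled_Atom_cong:
  assumes A: "settled True (Atom R cs)" and ds: "map rep cs = map rep ds" "set ds \<subseteq> params"
  shows "settled True (Atom R ds)"
proof -
  have len: "length ds = length cs" using ds(1) by (metis length_map)
  have cs: "set cs \<subseteq> params" using A by (auto simp: settled_def params_def)
  have "settled True (Atom R (take k ds @ drop k cs))" if "k \<le> length cs" for k
    using that
  proof (induction k)
    case (Suc k)
    then have k: "k < length cs" by simp
    have "rep (cs ! k) = rep (ds ! k)" using ds(1) k len by (metis nth_map)
    moreover have "cs ! k \<in> params" "ds ! k \<in> params" using k len cs ds(2) by (auto simp: subset_iff)
    ultimately have "eqc ((take k ds @ drop k cs) ! k) (ds ! k)"
      using rep_eq_iff k len by (simp add: nth_append)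
    from settled_Atom_update[OF _ _ this] Suc k
    have "settled True (Atom R ((take k ds @ drop k cs)[k := ds ! k]))" using len by auto
    moreover have "(take k ds @ drop k cs)[k := ds ! k] = take (Suc k) ds @ drop (Suc k) cs"
      using k len by (intro nth_equalityI) (auto simp: nth_list_update nth_append less_Suc_eq)
    ultimately show ?case by simp
  qed (use A in simp)
  from this[of "length cs"] len show ?thesis by simp
qed

text \<open>
The term model: parameters modulo provable equality.  To have natural numbers as elements, each class is
represented by its least member.
\<close>

definition canon :: "('r, nat) rstruct" where
  "canon = \<lparr>carrier = rep ` params, rel = (\<lambda>R. {map rep cs | cs. settled True (Atom R cs)})\<rparr>"

definition asg :: "nat \<Rightarrow> nat list" where
  "asg t = map rep (rev [0..<ctx t])"

lemma asg_nth: "v < ctx t \<Longrightarrow> asg t ! v = rep (ctx t - Suc v)"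
  by (simp add: asg_def rev_nth)

lemma asg_mono: "t \<le> t' \<Longrightarrow> v < ctx t \<Longrightarrow> asg t' ! (v + (ctx t' - ctx t)) = asg t ! v"
  using ctx_mono[of t t'] by (simp add: asg_nth)

lemma asg_Suc: "ctx (Suc t) = Suc (ctx t) \<Longrightarrow> asg (Suc t) = rep (ctx t) # asg t"
  by (simp add: asg_def)

lemma is_struct_canon: "is_struct L canon"
  by (rule is_structI) (fastforce simp: canon_def settled_def params_def)

lemma sat_shift:
  "wff L \<psi> (ctx t) \<Longrightarrow> t \<le> t' \<Longrightarrow>
     sat canon (ren \<psi> (\<lambda>v. v + (ctx t' - ctx t))) (asg t') \<longleftrightarrow> sat canon \<psi> (asg t)"
  by (rule sat_ren) (auto simp: asg_mono)

lemma sat_shift_lift: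
  "wff L \<psi> (Suc (ctx t)) \<Longrightarrow> t \<le> t' \<Longrightarrow>
     sat canon (ren \<psi> (lift (\<lambda>v. v + (ctx t' - ctx t)))) (c # asg t') \<longleftrightarrow> sat canon \<psi> (c # asg t)"
  by (rule sat_ren) (auto simp: asg_mono lift_def split: nat.splits)

lemma level_level: "wff L \<psi> n \<Longrightarrow> atomic \<psi> \<Longrightarrow> level n (level n \<psi>) = \<psi>"
proof -
  have "n - Suc (n - Suc c) = c" if "c < n" for c using that by simp
  note * = this
  show "wff L \<psi> n \<Longrightarrow> atomic \<psi> \<Longrightarrow> level n (level n \<psi>) = \<psi>"
    by (auto simp: atomic_def level_def subset_iff intro!: map_idI *)
qed

lemma settled_level: 
  assumes "(b, \<psi>) \<in> set (sq t)" "atomic \<psi>"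
  shows "settled b (level (ctx t) \<psi>)"
proof -
  have w: "wff L \<psi> (ctx t)" using wf[OF assms(1)] .
  then have "wff L (level (ctx t) \<psi>) (ctx t)" unfolding level_def by (rule wff_ren) simp
  moreover have "(b, level (ctx t) (level (ctx t) \<psi>)) \<in> set (sq t)"
    using level_level[OF w assms(2)] assms(1) by simp
  ultimately show ?thesis unfolding settled_def by blast
qed

lemma truth_atomic:
  assumes "(b, \<psi>) \<in> set (sq t)" "atomic \<psi>"
  shows "sat canon \<psi> (asg t) \<longleftrightarrow> b"
proof -
  let ?\<psi> = "level (ctx t) \<psi>"
  have w: "wff L \<psi> (ctx t)" using wf[OF assms(1)] .
  have at: "atomic ?\<psi>" using assms(2) by (auto simp: atomic_def level_def)
  have w': "wff L ?\<psi> (ctx t)" using w unfolding level_def by (rule wff_ren) simp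
  have S: "settled True ?\<psi> \<longleftrightarrow> b" using settled_level[OF assms] settled_False[OF at w'] by (cases b) auto
  from assms(2) consider (A) R vs where "\<psi> = Atom R vs" | (E) j k where "\<psi> = Eq j k"
    unfolding atomic_def by blast
  then show ?thesis
  proof cases
    case A
    let ?cs = "map (\<lambda>v. ctx t - Suc v) vs"
    have vs: "map ((!) (asg t)) vs = map rep ?cs" using w A by (auto simp: asg_nth subset_iff)
    have "set ?cs \<subseteq> params" using w' A by (auto simp: level_def params_def)
    moreover have "(\<exists>cs. map rep ?cs = map rep cs \<and> settled True (Atom R cs)) \<longleftrightarrow> settled True (Atom R ?cs)"
      if "set ?cs \<subseteq> params"
      using settled_Atom_cong[OF _ _ that] by metis
    moreover have "sat canon \<psi> (asg t) \<longleftrightarrow>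
        (\<exists>cs. map ((!) (asg t)) vs = map rep cs \<and> settled True (Atom R cs))"
      by (simp add: A canon_def)
    ultimately have "sat canon \<psi> (asg t) \<longleftrightarrow> settled True (Atom R ?cs)"
      unfolding vs by blast
    then show ?thesis using S A by (simp add: level_def)
  next
    case E
    have "ctx t - Suc j \<in> params" "ctx t - Suc k \<in> params" using w' E by (auto simp: level_def params_def)
    then show ?thesis using S E w by (simp add: asg_nth rep_eq_iff eqc_def level_def)
  qed
qed

text \<open>
The renaming \<open>r\<close> is part of the claim because entries reappear shifted at later stages and instances
of quantifiers are renamings: formulas of the form \<open>ren \<psi> r\<close>, for subformulas \<open>\<psi>\<close>, are closed under both.
\<close>

lemma truth:
  "(b, ren \<psi> r) \<in> set (sq t) \<Longrightarrow> sat canon (ren \<psi> r) (asg t) \<longleftrightarrow> b"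
proof (induction \<psi> arbitrary: b r t)
  case (Atom R vs)
  then show ?case by (intro truth_atomic) (auto simp: atomic_def)
next
  case (Eq j k)
  then show ?case by (intro truth_atomic) (auto simp: atomic_def)
next
  case (Neg \<psi>)
  obtain t' where t': "t' \<ge> t" "ctx (Suc t') = ctx t'"
      "(\<not> b, ren \<psi> (\<lambda>v. r v + (ctx t' - ctx t))) \<in> set (sq (Suc t'))"
    using treated[OF Neg.prems order_refl] by (auto simp: ren_ren)
  have "wff L (ren \<psi> r) (ctx t)" using wf[OF Neg.prems] by simp
  from sat_shift[OF this, of "Suc t'"] Neg.IH[OF t'(3)] t'(1,2) show ?case by (cases b) (simp_all add: ren_ren)
next
  case (Conj I \<psi>)
  have w: "wff L (ren (\<psi> i) r) (ctx t)" if "i \<in> I" for i using wf[OF Conj.prems] that by simp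
  have IH: "sat canon (ren (\<psi> i) r) (asg t) \<longleftrightarrow> b'"
    if "i \<in> I" "t \<le> t'" "(b', ren (\<psi> i) (\<lambda>v. r v + (ctx t' - ctx t))) \<in> set (sq t')" for i b' t'
    using sat_shift[OF w, of i t'] that Conj.IH[OF rangeI that(3)] by (simp add: ren_ren)
  show ?case
  proof (cases b)
    case True
    have "sat canon (ren (\<psi> i) r) (asg t)" if iI: "i \<in> I" for i
    proof -
      obtain t' where t': "t' \<ge> t" "ctx (Suc t') = ctx t'"
        "(True, ren (\<psi> i) (\<lambda>v. r v + (ctx t' - ctx t))) \<in> set (sq (Suc t'))"
        using treated[OF Conj.prems order_refl, of i] iI True by (auto simp: ren_ren)
      then show ?thesis using IH[OF iI, of "Suc t'" True] by simp
    qed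
    then show ?thesis using True by simp
  next
    case False
    obtain t' i where t': "t' \<ge> t" "ctx (Suc t') = ctx t'" "i \<in> I"
        "(False, ren (\<psi> i) (\<lambda>v. r v + (ctx t' - ctx t))) \<in> set (sq (Suc t'))"
      using treated[OF Conj.prems order_refl] False by (auto simp: ren_ren)
    then show ?thesis using IH[OF t'(3), of "Suc t'" False] False by auto
  qed
next
  case (Disj I \<psi>)
  have w: "wff L (ren (\<psi> i) r) (ctx t)" if "i \<in> I" for i using wf[OF Disj.prems] that by simp
  have IH: "sat canon (ren (\<psi> i) r) (asg t) \<longleftrightarrow> b'"
    if "i \<in> I" "t \<le> t'" "(b', ren (\<psi> i) (\<lambda>v. r v + (ctx t' - ctx t))) \<in> set (sq t')" for i b' t'
    using sat_shift[OF w, of i t'] that Disj.IH[OF rangeI that(3)] by (simp add: ren_ren)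
  show ?case
  proof (cases b)
    case False
    have "\<not> sat canon (ren (\<psi> i) r) (asg t)" if iI: "i \<in> I" for i
    proof -
      obtain t' where t': "t' \<ge> t" "ctx (Suc t') = ctx t'"
        "(False, ren (\<psi> i) (\<lambda>v. r v + (ctx t' - ctx t))) \<in> set (sq (Suc t'))"
        using treated[OF Disj.prems order_refl, of i] iI False by (auto simp: ren_ren)
      then show ?thesis using IH[OF iI, of "Suc t'" False] by simp
    qed
    then show ?thesis using False by simp
  next
    case True
    obtain t' i where t': "t' \<ge> t" "ctx (Suc t') = ctx t'" "i \<in> I"
        "(True, ren (\<psi> i) (\<lambda>v. r v + (ctx t' - ctx t))) \<in> set (sq (Suc t'))"
      using treated[OF Disj.prems order_refl] True by (auto simp: ren_ren)
    then show ?thesis using IH[OF t'(3), of "Suc t'" True] True by auto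
  qed
next
  case (Forall \<psi>)
  have w: "wff L (ren \<psi> (lift r)) (Suc (ctx t))" using wf[OF Forall.prems] by simp
  have lift_lift: "(\<lambda>v. lift (\<lambda>v. v + d) (lift r v)) = lift (\<lambda>v. r v + d)" for d
    by (auto simp: lift_def fun_eq_iff split: nat.splits)
  show ?case
  proof (cases b)
    case True
    have "sat canon (ren \<psi> (lift r)) (rep c # asg t)" if "c \<in> params" for c
    proof -
      obtain t0 where t0: "c < ctx t0" using \<open>c \<in> params\<close> by (auto simp: params_def)
      obtain t' where t': "t' \<ge> max t t0" and
        tr: "c < ctx t' \<Longrightarrow> ctx (Suc t') = ctx t' \<and>
          (True, inst (ren (ren \<psi> (lift r)) (lift (\<lambda>v. v + (ctx t' - ctx t)))) (ctx t' - Suc c)) \<in> set (sq (Suc t'))"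
        using treated[OF Forall.prems, of "max t t0" c] True by auto
      have c: "c < ctx t'" using t0 ctx_mono[of t0 t'] t' by simp
      let ?\<theta> = "ren (ren \<psi> (lift r)) (lift (\<lambda>v. v + (ctx t' - ctx t)))"
      have "sat canon (inst ?\<theta> (ctx t' - Suc c)) (asg (Suc t'))"
        using tr[OF c] Forall.IH unfolding inst_def ren_ren by blast
      then have "sat canon (inst ?\<theta> (ctx t' - Suc c)) (asg t')"
        using tr[OF c] by (simp add: asg_def)
      moreover have "wff L ?\<theta> (Suc (ctx t'))"
        by (rule wff_ren[OF w]) (use ctx_mono[of t t'] t' in \<open>auto simp: lift_def split: nat.splits\<close>)
      ultimately have "sat canon ?\<theta> (rep c # asg t')"
        using sat_inst[of L ?\<theta> "ctx t'" canon] c by (simp add: asg_nth)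
      then show ?thesis using sat_shift_lift[OF w] t' by simp
    qed
    then show ?thesis using True by (auto simp: canon_def)
  next
    case False
    obtain t' where t': "t' \<ge> t" "ctx (Suc t') = Suc (ctx t')"
        "(False, ren (ren \<psi> (lift r)) (lift (\<lambda>v. v + (ctx t' - ctx t)))) \<in> set (sq (Suc t'))"
      using treated[OF Forall.prems order_refl] False by auto
    have "\<not> sat canon (ren (ren \<psi> (lift r)) (lift (\<lambda>v. v + (ctx t' - ctx t)))) (asg (Suc t'))"
      using t'(3) Forall.IH unfolding ren_ren by blast
    then have "\<not> sat canon (ren \<psi> (lift r)) (rep (ctx t') # asg t)"
      using sat_shift_lift[OF w t'(1)] t'(2) by (simp add: asg_Suc)
    moreover have "ctx t' \<in> params" using t'(2) by (auto simp: params_def intro!: exI[of _ "Suc t'"])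
    ultimately show ?thesis using False by (auto simp: canon_def)
  qed
next
  case (Exists \<psi>)
  have w: "wff L (ren \<psi> (lift r)) (Suc (ctx t))" using wf[OF Exists.prems] by simp
  show ?case
  proof (cases b)
    case False
    have "\<not> sat canon (ren \<psi> (lift r)) (rep c # asg t)" if "c \<in> params" for c
    proof -
      obtain t0 where t0: "c < ctx t0" using \<open>c \<in> params\<close> by (auto simp: params_def)
      obtain t' where t': "t' \<ge> max t t0" and
        tr: "c < ctx t' \<Longrightarrow> ctx (Suc t') = ctx t' \<and>
          (False, inst (ren (ren \<psi> (lift r)) (lift (\<lambda>v. v + (ctx t' - ctx t)))) (ctx t' - Suc c)) \<in> set (sq (Suc t'))"
        using treated[OF Exists.prems, of "max t t0" c] False by auto
      have c: "c < ctx t'" using t0 ctx_mono[of t0 t'] t' by simp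
      let ?\<theta> = "ren (ren \<psi> (lift r)) (lift (\<lambda>v. v + (ctx t' - ctx t)))"
      have "\<not> sat canon (inst ?\<theta> (ctx t' - Suc c)) (asg (Suc t'))"
        using tr[OF c] Exists.IH unfolding inst_def ren_ren by blast
      then have "\<not> sat canon (inst ?\<theta> (ctx t' - Suc c)) (asg t')"
        using tr[OF c] by (simp add: asg_def)
      moreover have "wff L ?\<theta> (Suc (ctx t'))"
        by (rule wff_ren[OF w]) (use ctx_mono[of t t'] t' in \<open>auto simp: lift_def split: nat.splits\<close>)
      ultimately have "\<not> sat canon ?\<theta> (rep c # asg t')"
        using sat_inst[of L ?\<theta> "ctx t'" canon] c by (simp add: asg_nth)
      then show ?thesis using sat_shift_lift[OF w] t' by simp
    qed
    then show ?thesis using False by (auto simp: canon_def)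
  next
    case True
    obtain t' where t': "t' \<ge> t" "ctx (Suc t') = Suc (ctx t')"
        "(True, ren (ren \<psi> (lift r)) (lift (\<lambda>v. v + (ctx t' - ctx t)))) \<in> set (sq (Suc t'))"
      using treated[OF Exists.prems order_refl] True by auto
    have "sat canon (ren (ren \<psi> (lift r)) (lift (\<lambda>v. v + (ctx t' - ctx t)))) (asg (Suc t'))"
      using t'(3) Exists.IH unfolding ren_ren by blast
    then have "sat canon (ren \<psi> (lift r)) (rep (ctx t') # asg t)"
      using sat_shift_lift[OF w t'(1)] t'(2) by (simp add: asg_Suc)
    moreover have "ctx t' \<in> params" using t'(2) by (auto simp: params_def intro!: exI[of _ "Suc t'"])
    ultimately show ?thesis using True by (auto simp: canon_def)
  qed
qed

lemma truth_sentence: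
  assumes "(b, \<psi>) \<in> set (sq t)" "wff L \<psi> 0"
  shows "sat canon \<psi> [] \<longleftrightarrow> b"
proof -
  have "sat canon (ren \<psi> (\<lambda>v. v)) (asg t) \<longleftrightarrow> b" using assms(1) by (intro truth) (simp add: ren_id)
  moreover have "sat canon (ren \<psi> (\<lambda>v. v)) (asg t) \<longleftrightarrow> sat canon \<psi> []"
    using assms(2) by (rule sat_ren) simp
  ultimately show ?thesis by simp
qed

lemma canon_model: "is_model L T canon"
  unfolding is_model_def
proof (intro conjI ballI is_struct_canon)
  fix \<psi> assume \<psi>: "\<psi> \<in> T"
  then obtain t where "tk t = Assert \<psi>" using tk_Assert by blast
  with perf[of t] have "(True, \<psi>) \<in> set (sq (Suc t))" by simp
  from truth_sentence[OF this] \<psi> sentences show "sat canon \<psi> []" by (simp add: is_theory_def)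
qed

end


lemma init_seg_copy:
  fixes C :: "nat set"
  shows "\<exists>f. inj_on f C \<and> init_seg (f ` C)"
proof (cases "finite C")
  case True
  then show ?thesis using to_nat_on_finite[OF True]
    by (intro exI[of _ "to_nat_on C"]) (auto simp: bij_betw_def init_seg_def)
next
  case False
  then show ?thesis using to_nat_on_infinite[OF _ False]
    by (intro exI[of _ "to_nat_on C"]) (auto simp: bij_betw_def init_seg_def)
qed

text \<open>
If \<open>\<phi>\<close> is not provable, then the sequent with empty left side and \<open>\<phi>\<close> on the right is consistent, and a fair
sequence starting with it yields a countable model in which \<open>\<phi>\<close> fails.  Its elements are
then renumbered to form an initial segment.
\<close>

theorem completeness:
  assumes "countable (dom L)" "countable T" "is_theory L T" "wff L \<phi> 0"
    and val: "\<And>M. M \<in> Mod L T \<Longrightarrow> sat M \<phi> []"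
  shows "proves L T \<phi>"
proof (rule ccontr)
  assume "\<not> proves L T \<phi>"
  then have c0: "consistent L T 0 [(False, \<phi>)]" using assms(4) by (simp add: consistent_def proves_def)
  define Tasks where "Tasks = range (\<lambda>(p, i). Decompose p i) \<union> Assert ` T \<union>
     Decide ` ((\<lambda>(R, cs). Atom R cs) ` (dom L \<times> UNIV) \<union> range (\<lambda>(c, d). Eq c d))"
  have ct: "countable Tasks"
    unfolding Tasks_def using assms(1,2) by (intro countable_Un countable_image countable_SIGMA) auto
  have ne: "Tasks \<noteq> {}" by (auto simp: Tasks_def)
  \<comment> \<open>The second component of \<open>prod_decode t\<close> is ignored, so every task recurs.\<close>
  define tk where "tk t = from_nat_into Tasks (fst (prod_decode t))" for t
  have tk_in: "tk t \<in> Tasks" for t unfolding tk_def by (rule from_nat_into[OF ne])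
  have tk: "\<exists>t\<ge>t0. tk t = x" if "x \<in> Tasks" for x t0
    using that ct by (intro exI[of _ "prod_encode (to_nat_on Tasks x, t0)"])
      (simp add: tk_def le_prod_encode_2)
  have "\<exists>f. \<forall>t. (consistent L T (fst (f t)) (snd (f t)) \<and> (t = 0 \<longrightarrow> f t = (0, [(False, \<phi>)]))) \<and>
     (extends (fst (f t)) (snd (f t)) (fst (f (Suc t))) (snd (f (Suc t))) \<and>
      performs L (tk t) (fst (f t)) (snd (f t)) (fst (f (Suc t))) (snd (f (Suc t))))"
  proof (rule dependent_nat_choice)
    show "\<exists>x. consistent L T (fst x) (snd x) \<and> (0 = (0::nat) \<longrightarrow> x = (0, [(False, \<phi>)]))"
      using c0 by auto
  next
    fix x :: "nat \<times> _" and t :: nat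
    assume "consistent L T (fst x) (snd x) \<and> (t = 0 \<longrightarrow> x = (0, [(False, \<phi>)]))"
    then have c: "consistent L T (fst x) (snd x)" ..
    have "\<psi> \<in> T \<and> wff L \<psi> (fst x)" if "tk t = Assert \<psi>" for \<psi>
    proof -
      have "\<psi> \<in> T" using tk_in[of t] that by (auto simp: Tasks_def)
      with assms(3) show ?thesis using wff_mono[of L \<psi> 0 "fst x"] by (auto simp: is_theory_def)
    qed
    from consistent_step[OF c this]
    show "\<exists>y. (consistent L T (fst y) (snd y) \<and> (Suc t = 0 \<longrightarrow> y = (0, [(False, \<phi>)]))) \<and>
      (extends (fst x) (snd x) (fst y) (snd y) \<and> performs L (tk t) (fst x) (snd x) (fst y) (snd y))"
      by auto
  qed
  then obtain f where
    f: "\<And>t. consistent L T (fst (f t)) (snd (f t))" and f0: "f 0 = (0, [(False, \<phi>)])" and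
    fe: "\<And>t. extends (fst (f t)) (snd (f t)) (fst (f (Suc t))) (snd (f (Suc t)))" and
    fp: "\<And>t. performs L (tk t) (fst (f t)) (snd (f t)) (fst (f (Suc t))) (snd (f (Suc t)))"
    by blast
  interpret henkin L T "\<lambda>t. fst (f t)" "\<lambda>t. snd (f t)" tk
  proof
    show "\<exists>t\<ge>t0. tk t = Decompose p i" for t0 p i by (rule tk) (auto simp: Tasks_def)
    show "\<exists>t\<ge>t0. tk t = Assert \<psi>" if "\<psi> \<in> T" for t0 \<psi> by (rule tk) (use that in \<open>auto simp: Tasks_def\<close>)
    show "\<exists>t\<ge>t0. tk t = Decide \<psi>" if "atomic \<psi>" "wff L \<psi> n" for t0 \<psi> n
      by (rule tk) (use that in \<open>fastforce simp: Tasks_def atomic_def\<close>)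
  qed (use assms(3) f fe fp in auto)
  have "\<not> sat canon \<phi> []" using truth_sentence[of False \<phi> 0] f0 assms(4) by simp
  obtain h where h: "inj_on h (carrier canon)" "init_seg (h ` carrier canon)" using init_seg_copy by blast
  have "push canon h \<in> Mod L T"
    using is_model_push[OF assms(3) canon_model h(1)] h(2) by (simp add: Mod_def)
  then have "sat (push canon h) \<phi> []" by (rule val)
  moreover have "sat canon \<phi> [] \<longleftrightarrow> sat (push canon h) \<phi> (map h [])"
    by (rule sat_iso[where L = L]) (use assms(4) h rel_push[OF is_struct_canon h(1)] in \<open>auto simp: bij_betw_def\<close>)
  ultimately show False using \<open>\<not> sat canon \<phi> []\<close> by simp
qed

section \<open>Baire category for permutations\<close>

definition perms :: "nat set \<Rightarrow> (nat \<Rightarrow> nat) set" where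
  "perms S = {g \<in> extensional S. bij_betw g S S}"

text \<open>
Finite partial injections of \<open>S\<close>, as lists of pairs of argument and value.  When \<open>S\<close> is finite or \<open>UNIV\<close> they
are exactly the finite partial maps that extend to permutations of \<open>S\<close>, so they index the basic open sets
of the space of permutations; \<open>q\<close> strengthens \<open>p\<close> if \<open>set p \<subseteq> set q\<close>.
\<close>

definition cond :: "nat set \<Rightarrow> (nat \<times> nat) list \<Rightarrow> bool" where
  "cond S p \<longleftrightarrow> set p \<subseteq> S \<times> S \<and> (\<forall>(x, t)\<in>set p. \<forall>(y, u)\<in>set p. x = y \<longleftrightarrow> t = u)"

definition agrees :: "(nat \<Rightarrow> nat) \<Rightarrow> (nat \<times> nat) list \<Rightarrow> bool" where
  "agrees g p \<longleftrightarrow> (\<forall>(x, t)\<in>set p. g x = t)"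

definition dense_below :: "nat set \<Rightarrow> (nat \<times> nat) list \<Rightarrow> (nat \<times> nat) list set \<Rightarrow> bool" where
  "dense_below S p D \<longleftrightarrow>
     (\<forall>q. cond S q \<longrightarrow> set p \<subseteq> set q \<longrightarrow> (\<exists>r\<in>D. cond S r \<and> set q \<subseteq> set r))"

text \<open>
``For comeagerly many permutations \<open>g\<close> extending \<open>p\<close>, \<open>P g\<close>'': the set \<open>{g. P g}\<close> contains the intersection
of countably many open sets that are dense below \<open>p\<close>, each given by the conditions that force
membership in it.
\<close>

definition generically :: "nat set \<Rightarrow> (nat \<times> nat) list \<Rightarrow> ((nat \<Rightarrow> nat) \<Rightarrow> bool) \<Rightarrow> bool" where
  "generically S p P \<longleftrightarrow> (\<exists>D :: nat \<Rightarrow> (nat \<times> nat) list set. (\<forall>n. dense_below S p (D n)) \<and>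
     (\<forall>g\<in>perms S. agrees g p \<longrightarrow> (\<forall>n. \<exists>r\<in>D n. agrees g r) \<longrightarrow> P g))"

text \<open>
A form of the Baire property: every basic open set has a basic open subset in which \<open>P\<close> or its negation
is comeager.
\<close>

definition decided :: "nat set \<Rightarrow> ((nat \<Rightarrow> nat) \<Rightarrow> bool) \<Rightarrow> bool" where
  "decided S P \<longleftrightarrow> (\<forall>p. cond S p \<longrightarrow>
     (\<exists>q. cond S q \<and> set p \<subseteq> set q \<and> (generically S q P \<or> generically S q (\<lambda>g. \<not> P g))))"

lemma agrees_subset: "agrees g q \<Longrightarrow> set p \<subseteq> set q \<Longrightarrow> agrees g p"
  by (auto simp: agrees_def)

lemma dense_below_subset: "dense_below S p D \<Longrightarrow> set p \<subseteq> set q \<Longrightarrow> dense_below S q D"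
  by (auto simp: dense_below_def)

lemma dense_below_UNIV: "dense_below S p UNIV"
  by (auto simp: dense_below_def)

lemma generically_subset: "generically S p P \<Longrightarrow> set p \<subseteq> set q \<Longrightarrow> generically S q P"
  unfolding generically_def by (metis agrees_subset dense_below_subset)

lemma generically_mono:
  "generically S p P \<Longrightarrow> (\<And>g. g \<in> perms S \<Longrightarrow> agrees g p \<Longrightarrow> P g \<Longrightarrow> Q g) \<Longrightarrow> generically S p Q"
  unfolding generically_def by blast

lemma generically_I:
  assumes "\<And>g. g \<in> perms S \<Longrightarrow> agrees g p \<Longrightarrow> P g"
  shows "generically S p P"
  unfolding generically_def using assms dense_below_UNIV by (intro exI[of _ "\<lambda>_. UNIV"]) auto

lemma generically_cong:
  "(\<And>g. g \<in> perms S \<Longrightarrow> agrees g p \<Longrightarrow> P g \<longleftrightarrow> Q g) \<Longrightarrow> generically S p P \<longleftrightarrow> generically S p Q"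
  using generically_mono by metis

lemma generically_all:
  "generically S p (\<lambda>g. \<forall>n::nat. P n g) \<longleftrightarrow> (\<forall>n. generically S p (P n))"
proof
  assume "\<forall>n. generically S p (P n)"
  then have "\<exists>D. \<forall>n. (\<forall>m::nat. dense_below S p (D n m)) \<and>
     (\<forall>g\<in>perms S. agrees g p \<longrightarrow> (\<forall>m. \<exists>r\<in>D n m. agrees g r) \<longrightarrow> P n g)"
    unfolding generically_def by (rule choice)
  then obtain D where *: "\<forall>n. (\<forall>m::nat. dense_below S p (D n m)) \<and>
     (\<forall>g\<in>perms S. agrees g p \<longrightarrow> (\<forall>m. \<exists>r\<in>D n m. agrees g r) \<longrightarrow> P n g)" ..
  then have D: "\<And>n m. dense_below S p (D n m)"
    and P: "\<And>n g. g \<in> perms S \<Longrightarrow> agrees g p \<Longrightarrow> (\<forall>m. \<exists>r\<in>D n m. agrees g r) \<Longrightarrow> P n g"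
    by simp_all
  \<comment> \<open>One sequence enumerates the dense sets of all the given sequences.\<close>
  define E where "E k = (case prod_decode k of (n, m) \<Rightarrow> D n m)" for k
  have E: "E (prod_encode (n, m)) = D n m" for n m by (simp add: E_def)
  have "\<forall>n. dense_below S p (E n)" by (simp add: E_def D split: prod.split)
  moreover have "P n g" if "g \<in> perms S" "agrees g p" "\<forall>k. \<exists>r\<in>E k. agrees g r" for g n
    using P[OF that(1,2)] that(3) E by metis
  ultimately show "generically S p (\<lambda>g. \<forall>n. P n g)"
    unfolding generically_def by blast
qed (auto elim: generically_mono)

lemma generically_conj:
  assumes "generically S p P" "generically S p Q"
  shows "generically S p (\<lambda>g. P g \<and> Q g)"
proof -
  have "generically S p (\<lambda>g. \<forall>n::nat. if n = 0 then P g else Q g)"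
    unfolding generically_all
  proof
    show "generically S p (\<lambda>g. if n = 0 then P g else Q g)" for n :: nat
      by (cases "n = 0") (simp_all add: assms)
  qed
  then show ?thesis by (rule generically_mono) (metis zero_neq_one)
qed

lemma cond_iff: "cond S p \<longleftrightarrow> (\<forall>x t. (x, t) \<in> set p \<longrightarrow> x \<in> S \<and> t \<in> S) \<and>
    (\<forall>x t y u. (x, t) \<in> set p \<longrightarrow> (y, u) \<in> set p \<longrightarrow> (x = y \<longleftrightarrow> t = u))"
  unfolding cond_def by fast

text \<open>
If \<open>S\<close> is finite, then \<open>p\<close> uses as many values as arguments, so an unused argument leaves an unused value.
\<close>

lemma cond_extend_dom:
  assumes "cond S p" "x \<in> S" "finite S \<or> S = UNIV"
  shows "\<exists>t. cond S ((x, t) # p)"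
proof (cases "x \<in> fst ` set p")
  case True
  then obtain t where "(x, t) \<in> set p" by auto
  with assms(1) have "cond S ((x, t) # p)" by (simp add: cond_def insert_absorb)
  then show ?thesis ..
next
  case False
  have "\<exists>t\<in>S. t \<notin> snd ` set p"
  proof (rule ccontr)
    assume "\<not> ?thesis"
    then have sub: "S \<subseteq> snd ` set p" by auto
    then have fin: "finite S" by (rule finite_subset) simp
    have inj: "inj_on fst (set p)" "inj_on snd (set p)"
      using assms(1) unfolding cond_iff inj_on_def by (metis prod.collapse)+
    have "card S \<le> card (snd ` set p)" using sub by (intro card_mono) auto
    also have "\<dots> = card (fst ` set p)" using inj by (simp add: card_image)
    also have "\<dots> < card S"
      using assms(1,2) False fin by (intro psubset_card_mono) (auto simp: cond_def)
    finally show False by simp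
  qed
  then obtain t where "t \<in> S" "t \<notin> snd ` set p" by auto
  moreover have "x \<noteq> y \<and> t \<noteq> u" if "(y, u) \<in> set p" for y u
    using that False \<open>t \<notin> snd ` set p\<close> by force
  ultimately have "cond S ((x, t) # p)" using assms(1,2) \<open>t \<in> S\<close> unfolding cond_iff set_simps insert_iff prod.inject by metis
  then show ?thesis ..
qed

lemma swap_in_set: "(x, t) \<in> set (map prod.swap p) \<longleftrightarrow> (t, x) \<in> set p"
  by (auto simp: image_iff intro: bexI[of _ "(t, x)"])

lemma cond_swap: "cond S (map prod.swap p) \<longleftrightarrow> cond S p"
proof -
  have *: "cond S (map prod.swap p)" if "cond S p" for p
    using that unfolding cond_iff swap_in_set by blast
  show ?thesis using *[of p] *[of "map prod.swap p"] by auto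
qed

lemma cond_extend_ran:
  assumes "cond S p" "t \<in> S" "finite S \<or> S = UNIV"
  shows "\<exists>x. cond S ((x, t) # p)"
proof -
  from assms have "\<exists>x. cond S ((t, x) # map prod.swap p)"
    by (intro cond_extend_dom) (simp_all add: cond_swap)
  then obtain x where "cond S ((t, x) # map prod.swap p)" ..
  then have "cond S (map prod.swap ((t, x) # map prod.swap p))" unfolding cond_swap .
  then have "cond S ((x, t) # p)" by (simp add: comp_def)
  then show ?thesis ..
qed

lemma cond_subset:
  assumes "cond S q" "set p \<subseteq> set q"
  shows "cond S p"
proof -
  note q = assms(1)[unfolded cond_iff] and p = subsetD[OF assms(2)]
  show ?thesis unfolding cond_iff
  proof (intro conjI allI impI)
    show "x \<in> S" "t \<in> S" if "(x, t) \<in> set p" for x t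
      using q p[OF that] by simp_all
    show "x = y \<longleftrightarrow> t = u" if "(x, t) \<in> set p" "(y, u) \<in> set p" for x t y u
      using conjunct2[OF q, rule_format, OF p[OF that(1)] p[OF that(2)]] .
  qed
qed

lemma agrees_cond:
  assumes "g \<in> perms S" "agrees g p" "fst ` set p \<subseteq> S"
  shows "cond S p"
proof -
  have g: "x \<in> S" "g x = t" "t \<in> S" if "(x, t) \<in> set p" for x t
  proof -
    show "x \<in> S" using subsetD[OF assms(3) imageI[OF that, of fst]] by simp
    show "g x = t" using bspec[OF assms(2)[unfolded agrees_def] that] by simp
    moreover have "bij_betw g S S" using assms(1) by (simp add: perms_def)
    ultimately show "t \<in> S" using bij_betw_apply[OF _ \<open>x \<in> S\<close>, of g S] by simp
  qed
  have inj: "inj_on g S" using assms(1) by (simp add: perms_def bij_betw_def)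
  have eq: "x = y \<longleftrightarrow> t = u" if "(x, t) \<in> set p" "(y, u) \<in> set p" for x t y u
    using inj_on_eq_iff[OF inj g(1)[OF that(1)] g(1)[OF that(2)]] g(2)[OF that(1)] g(2)[OF that(2)]
    by simp
  show ?thesis unfolding cond_iff
    by (intro conjI allI impI) (erule g(1), erule g(3), erule (1) eq)
qed

text \<open>
The Baire category theorem.  A sequence of ever stronger conditions is chosen that meets the \<open>n\<close>-th dense
set at step \<open>n\<close>; including \<open>n\<close> in the domain and the range at the same step makes the union a permutation.
\<close>

lemma generic_exists:
  assumes S: "finite S \<or> S = UNIV" and p: "cond S p" and D: "\<And>n. dense_below S p (D n)"
  shows "\<exists>g\<in>perms S. agrees g p \<and> (\<forall>n::nat. \<exists>r\<in>D n. agrees g r)"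
proof -
  \<comment> \<open>The demands on step \<open>n\<close>.\<close>
  define good where "good n q r \<longleftrightarrow> set q \<subseteq> set r \<and> (\<exists>d\<in>D n. set d \<subseteq> set r) \<and>
    (n \<in> S \<longrightarrow> n \<in> fst ` set r \<and> n \<in> snd ` set r)" for n :: nat and q r :: "(nat \<times> nat) list"
  have step: "\<exists>r. (cond S r \<and> set p \<subseteq> set r) \<and> good n q r"
    if q: "cond S q \<and> set p \<subseteq> set q" for n q
  proof -
    obtain d where d: "d \<in> D n" "cond S d" "set q \<subseteq> set d"
      using D[of n] q unfolding dense_below_def by blast
    show ?thesis
    proof (cases "n \<in> S")
      case True
      obtain t where "cond S ((n, t) # d)" using cond_extend_dom[OF d(2) True S] ..
      then obtain x where "cond S ((x, n) # (n, t) # d)" using cond_extend_ran[OF _ True S] by blast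
      moreover have "good n q ((x, n) # (n, t) # d)"
        unfolding good_def using d by (auto intro!: bexI[of _ d])
      moreover have "set p \<subseteq> set ((x, n) # (n, t) # d)" using d q by auto
      ultimately show ?thesis by blast
    next
      case False
      with d have "good n q d" by (auto simp: good_def)
      then show ?thesis using d q by blast
    qed
  qed
  obtain f where f0: "f 0 = p" and fc: "\<And>n. cond S (f n)"
      and fs: "\<And>n. good n (f n) (f (Suc n))"
  proof -
    have "\<exists>f. \<forall>n. ((cond S (f n) \<and> set p \<subseteq> set (f n)) \<and> (n = 0 \<longrightarrow> f n = p)) \<and> good n (f n) (f (Suc n))"
      by (rule dependent_nat_choice) (use p step in auto)
    with that show ?thesis by blast
  qed
  have mono: "set (f n) \<subseteq> set (f m)" if "n \<le> m" for n m
    using that by (induction rule: dec_induct) (use fs in \<open>auto simp: good_def\<close>)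
  define U where "U = (\<Union>n. set (f n))"
  have US: "U \<subseteq> S \<times> S" using fc by (fastforce simp: U_def cond_def)
  have Uinj: "x = y \<longleftrightarrow> t = u" if "(x, t) \<in> U" "(y, u) \<in> U" for x t y u
  proof -
    obtain n m where "(x, t) \<in> set (f n)" "(y, u) \<in> set (f m)" using \<open>(x, t) \<in> U\<close> \<open>(y, u) \<in> U\<close> by (auto simp: U_def)
    then have "(x, t) \<in> set (f (max n m))" "(y, u) \<in> set (f (max n m))"
      using mono[of n "max n m"] mono[of m "max n m"] by auto
    then show ?thesis using fc[of "max n m"] unfolding cond_def by blast
  qed
  have Utot: "x \<in> fst ` U \<and> x \<in> snd ` U" if "x \<in> S" for x
    using fs[of x] that unfolding good_def U_def by blast
  define g where "g = restrict (\<lambda>x. THE t. (x, t) \<in> U) S"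
  have g: "g x = t" if "(x, t) \<in> U" for x t
  proof -
    have "(THE t. (x, t) \<in> U) = t" using that Uinj by blast
    then show ?thesis using that US by (auto simp: g_def)
  qed
  have "bij_betw g S S"
    unfolding bij_betw_def
  proof
    show "inj_on g S"
    proof (rule inj_onI)
      fix x y assume "x \<in> S" "y \<in> S" "g x = g y"
      moreover obtain t u where "(x, t) \<in> U" "(y, u) \<in> U" 
        using Utot[OF \<open>x \<in> S\<close>] Utot[OF \<open>y \<in> S\<close>] by auto
      ultimately show "x = y" using Uinj g by metis
    qed
    show "g ` S = S"
    proof
      show "g ` S \<subseteq> S"
      proof safe
        fix x assume "x \<in> S"
        then obtain t where "(x, t) \<in> U" using Utot by force
        then show "g x \<in> S" using US g by auto
      qed
      show "S \<subseteq> g ` S"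
      proof
        fix t assume "t \<in> S"
        then obtain x where "(x, t) \<in> U" using Utot by force
        then show "t \<in> g ` S" using US g by force
      qed
    qed
  qed
  then have "g \<in> perms S" by (simp add: perms_def g_def)
  moreover have ag: "agrees g r" if "set r \<subseteq> set (f n)" for r n
    using that g unfolding agrees_def U_def by fastforce
  moreover have "\<exists>r\<in>D n. agrees g r" for n
    using fs[of n] ag unfolding good_def by blast
  ultimately show ?thesis using f0 by blast
qed

lemma generically_ex:
  assumes "finite S \<or> S = UNIV" "cond S p" "generically S p P"
  shows "\<exists>g\<in>perms S. agrees g p \<and> P g"
  using assms generic_exists[of S p] unfolding generically_def by metis

text \<open>
A set that is comeager in densely many basic open sets is comeager.  There are only countably many conditions
\<open>r\<close> to be considered, and a dense family witnessing comeagerness below \<open>r\<close> is made dense below \<open>p\<close> by adding all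
conditions incompatible with \<open>r\<close>.
\<close>

lemma generically_local:
  assumes "\<And>q. cond S q \<Longrightarrow> set p \<subseteq> set q \<Longrightarrow> \<exists>r. cond S r \<and> set q \<subseteq> set r \<and> generically S r P"
  shows "generically S p P"
proof -
  define R where "R = {r. cond S r \<and> generically S r P}"
  have "\<forall>r\<in>R. \<exists>D. (\<forall>n::nat. dense_below S r (D n)) \<and>
      (\<forall>g\<in>perms S. agrees g r \<longrightarrow> (\<forall>n. \<exists>d\<in>D n. agrees g d) \<longrightarrow> P g)"
    unfolding R_def generically_def by auto
  then have "\<exists>D. \<forall>r\<in>R. (\<forall>n::nat. dense_below S r (D r n)) \<and>
      (\<forall>g\<in>perms S. agrees g r \<longrightarrow> (\<forall>n. \<exists>d\<in>D r n. agrees g d) \<longrightarrow> P g)"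
    by (rule bchoice)
  then obtain D where *: "\<forall>r\<in>R. (\<forall>n::nat. dense_below S r (D r n)) \<and>
      (\<forall>g\<in>perms S. agrees g r \<longrightarrow> (\<forall>n. \<exists>d\<in>D r n. agrees g d) \<longrightarrow> P g)" ..
  then have D: "\<And>r n. r \<in> R \<Longrightarrow> dense_below S r (D r (n::nat))"
    and P: "\<And>r g. r \<in> R \<Longrightarrow> g \<in> perms S \<Longrightarrow> agrees g r \<Longrightarrow> (\<forall>n. \<exists>d\<in>D r n. agrees g d) \<Longrightarrow> P g"
    by simp_all
  \<comment> \<open>A permutation extending \<open>r\<close> can meet this set only in its first part.\<close>
  define E where "E r n = {d. set r \<subseteq> set d \<and> (\<exists>d'\<in>D r n. set d' \<subseteq> set d)} \<union> {d. cond S d \<and> \<not> cond S (r @ d)}" for r n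
  have E: "dense_below S p (E r n)" if rR: "r \<in> R" for r n
    unfolding dense_below_def
  proof (intro allI impI)
    fix q assume q: "cond S q" "set p \<subseteq> set q"
    show "\<exists>d\<in>E r n. cond S d \<and> set q \<subseteq> set d"
    proof (cases "cond S (r @ q)")
      case True
      then obtain d where "d \<in> D r n" "cond S d" "set (r @ q) \<subseteq> set d"
        using D[OF rR, of n] unfolding dense_below_def by fastforce
      then show ?thesis unfolding E_def by auto
    qed (use q in \<open>auto simp: E_def\<close>)
  qed
  have "dense_below S p R"
    using assms unfolding dense_below_def R_def by blast
  moreover have "generically S p (\<lambda>g. \<forall>m. \<forall>n. from_nat m \<in> R \<longrightarrow> (\<exists>d\<in>E (from_nat m) n. agrees g d))"
  proof -
    have "generically S p (\<lambda>g. from_nat m \<in> R \<longrightarrow> (\<exists>d\<in>E (from_nat m) n. agrees g d))" for m n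
    proof (cases "from_nat m \<in> R")
      case True
      with E show ?thesis unfolding generically_def by (intro exI[of _ "\<lambda>_. E (from_nat m) n"]) auto
    qed (simp add: generically_I)
    then show ?thesis unfolding generically_all by blast
  qed
  moreover have "generically S p (\<lambda>g. \<exists>r\<in>R. agrees g r)"
    using \<open>dense_below S p R\<close> unfolding generically_def by (intro exI[of _ "\<lambda>_. R"]) auto
  ultimately have "generically S p (\<lambda>g. (\<exists>r\<in>R. agrees g r) \<and> 
      (\<forall>m. \<forall>n. from_nat m \<in> R \<longrightarrow> (\<exists>d\<in>E (from_nat m) n. agrees g d)))"
    by (intro generically_conj)
  then show ?thesis
  proof (rule generically_mono)
    fix g assume g: "g \<in> perms S" and *: "(\<exists>r\<in>R. agrees g r) \<and> 
      (\<forall>m. \<forall>n. from_nat m \<in> R \<longrightarrow> (\<exists>d\<in>E (from_nat m) n. agrees g d))"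
    then obtain r where r: "r \<in> R" "agrees g r" by auto
    have "\<exists>d\<in>D r n. agrees g d" for n
    proof -
      from * r obtain d where d: "d \<in> E r n" "agrees g d" by (metis from_nat_to_nat)
      have "cond S (r @ d)" if "cond S d"
      proof (rule agrees_cond[OF g])
        show "agrees g (r @ d)" using r d by (auto simp: agrees_def)
        show "fst ` set (r @ d) \<subseteq> S" using r(1) that by (auto simp: R_def cond_def)
      qed
      with d show ?thesis unfolding E_def using agrees_subset by blast
    qed
    then show "P g" using P[OF r(1) g r(2)] by blast
  qed
qed

text \<open>
A set with the Baire property is meager in a basic open set if and only if it is comeager in no basic
open subset of it.  The extensions are written as \<open>r @ p\<close>: in the formulas constructed later,
the quantified variables come first.
\<close>

lemma generically_compl:
  assumes S: "finite S \<or> S = UNIV" and dec: "decided S P" and p: "cond S p"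
  shows "generically S p (\<lambda>g. \<not> P g) \<longleftrightarrow> (\<forall>r. cond S (r @ p) \<longrightarrow> \<not> generically S (r @ p) P)"
proof
  assume neg: "generically S p (\<lambda>g. \<not> P g)"
  show "\<forall>r. cond S (r @ p) \<longrightarrow> \<not> generically S (r @ p) P"
  proof (intro allI impI notI)
    fix r assume r: "cond S (r @ p)" "generically S (r @ p) P"
    have "generically S (r @ p) (\<lambda>g. \<not> P g)" using neg by (rule generically_subset) simp
    then have "generically S (r @ p) (\<lambda>g. P g \<and> \<not> P g)" by (intro generically_conj r)
    from generically_ex[OF S r(1) this] show False by blast
  qed
next
  assume *: "\<forall>r. cond S (r @ p) \<longrightarrow> \<not> generically S (r @ p) P"
  show "generically S p (\<lambda>g. \<not> P g)"
  proof (rule generically_local)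
    fix q assume q: "cond S q" "set p \<subseteq> set q"
    then obtain r where r: "cond S r" "set q \<subseteq> set r"
        "generically S r P \<or> generically S r (\<lambda>g. \<not> P g)"
      using dec unfolding decided_def by blast
    have "\<not> generically S r P"
    proof
      assume "generically S r P"
      then have "generically S (r @ p) P" by (rule generically_subset) simp
      moreover have "cond S (r @ p)" using r(1) by (rule cond_subset) (use r q in auto)
      ultimately show False using * by blast
    qed
    with r show "\<exists>r. cond S r \<and> set q \<subseteq> set r \<and> generically S r (\<lambda>g. \<not> P g)" by blast
  qed
qed

lemma decided_compl: "decided S P \<Longrightarrow> decided S (\<lambda>g. \<not> P g)"
  unfolding decided_def by (simp add: disj_commute)

text \<open>
If no \<open>P n\<close> is comeager in any smaller basic open set, then all of them are meager, hence so is their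
countable union.
\<close>

lemma decided_ex:
  assumes S: "finite S \<or> S = UNIV" and dec: "\<And>n::nat. decided S (P n)"
  shows "decided S (\<lambda>g. \<exists>n. P n g)"
  unfolding decided_def
proof (intro allI impI)
  fix p assume p: "cond S p"
  show "\<exists>q. cond S q \<and> set p \<subseteq> set q \<and>
     (generically S q (\<lambda>g. \<exists>n. P n g) \<or> generically S q (\<lambda>g. \<not> (\<exists>n. P n g)))"
  proof (cases "\<exists>r n. cond S (r @ p) \<and> generically S (r @ p) (P n)")
    case True
    then obtain r n where r: "cond S (r @ p)" "generically S (r @ p) (P n)" by blast
    from r(2) have "generically S (r @ p) (\<lambda>g. \<exists>n. P n g)" by (rule generically_mono) blast
    with r(1) show ?thesis by (intro exI[of _ "r @ p"]) simp
  next
    case False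
    then have "generically S p (\<lambda>g. \<forall>n. \<not> P n g)"
      unfolding generically_all using generically_compl[OF S dec p] by blast
    with p show ?thesis by (intro exI[of _ p]) simp
  qed
qed

lemma decided_I:
  assumes "\<And>p. cond S p \<Longrightarrow> \<exists>q. cond S q \<and> set p \<subseteq> set q \<and>
     ((\<forall>g\<in>perms S. agrees g q \<longrightarrow> P g) \<or> (\<forall>g\<in>perms S. agrees g q \<longrightarrow> \<not> P g))"
  shows "decided S P"
  unfolding decided_def
proof (intro allI impI)
  fix p assume "cond S p"
  from assms[OF this] obtain q where q: "cond S q" "set p \<subseteq> set q"
     "(\<forall>g\<in>perms S. agrees g q \<longrightarrow> P g) \<or> (\<forall>g\<in>perms S. agrees g q \<longrightarrow> \<not> P g)" by blast
  then have "generically S q P \<or> generically S q (\<lambda>g. \<not> P g)"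
    by (metis (no_types, lifting) generically_I)
  with q(1,2) show "\<exists>q. cond S q \<and> set p \<subseteq> set q \<and>
     (generically S q P \<or> generically S q (\<lambda>g. \<not> P g))" by blast
qed

text \<open>
A nonempty basic open set is not the union of countably many meager sets.
\<close>

lemma nongeneric_split:
  assumes S: "finite S \<or> S = UNIV" and dec: "\<And>n::nat. decided S (P n)" and p: "cond S p"
    and ex: "generically S p (\<lambda>g. \<exists>n. P n g)"
  shows "\<exists>r n. cond S (r @ p) \<and> generically S (r @ p) (P n)"
proof (rule ccontr)
  assume "\<not> ?thesis"
  then have "generically S p (\<lambda>g. \<forall>n. \<not> P n g)"
    unfolding generically_all using generically_compl[OF S dec p] by blast
  with ex have "generically S p (\<lambda>g. (\<exists>n. P n g) \<and> (\<forall>n. \<not> P n g))" by (rule generically_conj)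
  from generically_ex[OF S p this] show False by blast
qed

definition move :: "(nat \<Rightarrow> nat) \<Rightarrow> (nat \<times> nat) list \<Rightarrow> (nat \<times> nat) list" where
  "move h = map (map_prod h id)"

lemma cond_move:
  assumes "bij_betw h S S" "cond S p"
  shows "cond S (move h p)"
proof -
  note q = assms(2)[unfolded cond_iff]
  have h: "h x = h y \<longleftrightarrow> x = y" if "x \<in> S" "y \<in> S" for x y
    using inj_on_eq_iff[OF bij_betw_imp_inj_on[OF assms(1)] that] .
  have hS: "h x \<in> S" if "x \<in> S" for x
    using assms(1) that by (rule bij_betw_apply)
  have mem: "\<exists>x. (x, t) \<in> set p \<and> y = h x" if "(y, t) \<in> set (move h p)" for y t
    using that by (auto simp: move_def)
  show ?thesis unfolding cond_iff
  proof (intro conjI allI impI)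
    show "x \<in> S" "t \<in> S" if "(x, t) \<in> set (move h p)" for x t
      using mem[OF that] hS q by auto
    show "x = y \<longleftrightarrow> t = u" if xt: "(x, t) \<in> set (move h p)" and yu: "(y, u) \<in> set (move h p)" for x t y u
    proof -
      obtain x' y' where x': "(x', t) \<in> set p" "x = h x'" and y': "(y', u) \<in> set p" "y = h y'"
        using mem[OF xt] mem[OF yu] by blast
      have "x' = y' \<longleftrightarrow> t = u" using conjunct2[OF q, rule_format, OF x'(1) y'(1)] .
      moreover have "h x' = h y' \<longleftrightarrow> x' = y'" using x' y' q h by simp
      ultimately show ?thesis using x'(2) y'(2) by simp
    qed
  qed
qed

lemma move_move:
  assumes "cond S p" "\<And>x. x \<in> S \<Longrightarrow> k (h x) = x"
  shows "move k (move h p) = p"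
proof -
  have "map_prod k id (map_prod h id z) = z" if "z \<in> set p" for z
    using assms that by (cases z) (auto simp: cond_iff)
  then show ?thesis by (simp add: move_def map_idI)
qed

lemma agrees_move:
  assumes "cond S p"
  shows "agrees g (move h p) \<longleftrightarrow> agrees (restrict (g \<circ> h) S) p"
  using assms unfolding agrees_def move_def cond_def by fastforce

text \<open>
Right translation by \<open>h\<close> is a homeomorphism of the space of permutations that maps the basic open set of
\<open>move h p\<close> to that of \<open>p\<close>.
\<close>

lemma generically_move:
  assumes h: "bij_betw h S S" and p: "cond S p" and gen: "generically S p P"
  shows "generically S (move h p) (\<lambda>g. P (restrict (g \<circ> h) S))"
proof -
  obtain D where D: "\<And>n::nat. dense_below S p (D n)"
    and P: "\<And>g. g \<in> perms S \<Longrightarrow> agrees g p \<Longrightarrow> \<forall>n. \<exists>r\<in>D n. agrees g r \<Longrightarrow> P g"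
    using gen unfolding generically_def by blast
  define k where "k = inv_into S h"
  have kh: "k (h x) = x" if "x \<in> S" for x using h that by (simp add: k_def bij_betw_def)
  have hk: "h (k x) = x" if "x \<in> S" for x
    using h that by (simp add: k_def bij_betw_inv_into_right)
  have k: "bij_betw k S S" using h unfolding k_def by (rule bij_betw_inv_into)
  define E where "E n = move h ` {d \<in> D n. cond S d}" for n
  have "dense_below S (move h p) (E n)" for n
    unfolding dense_below_def
  proof (intro allI impI)
    fix q assume q: "cond S q" "set (move h p) \<subseteq> set q"
    have "set (move k (move h p)) \<subseteq> set (move k q)" using q(2) by (auto simp: move_def)
    then have "set p \<subseteq> set (move k q)" using move_move[OF p, of k h, OF kh] by simp
    then obtain r where r: "r \<in> D n" "cond S r" "set (move k q) \<subseteq> set r"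
      using D[of n] cond_move[OF k q(1)] unfolding dense_below_def by blast
    have "set (move h (move k q)) \<subseteq> set (move h r)" using r(3) by (auto simp: move_def)
    then have "set q \<subseteq> set (move h r)" using move_move[OF q(1), of h k, OF hk] by simp
    then show "\<exists>r\<in>E n. cond S r \<and> set q \<subseteq> set r"
      using r cond_move[OF h r(2)] unfolding E_def by blast
  qed
  moreover have "P (restrict (g \<circ> h) S)"
    if g: "g \<in> perms S" and ag: "agrees g (move h p)" and meet: "\<forall>n. \<exists>r\<in>E n. agrees g r" for g
  proof (rule P)
    have "bij_betw (g \<circ> h) S S" using h g by (auto simp: perms_def intro: bij_betw_trans)
    moreover have "bij_betw (restrict (g \<circ> h) S) S S \<longleftrightarrow> bij_betw (g \<circ> h) S S"
      by (rule bij_betw_cong) simp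
    ultimately show "restrict (g \<circ> h) S \<in> perms S" unfolding perms_def by simp
    show "agrees (restrict (g \<circ> h) S) p" using ag agrees_move[OF p] by blast
    show "\<forall>n. \<exists>r\<in>D n. agrees (restrict (g \<circ> h) S) r"
    proof
      fix n
      obtain d where "d \<in> D n" "cond S d" "agrees g (move h d)" using meet unfolding E_def by blast
      then show "\<exists>r\<in>D n. agrees (restrict (g \<circ> h) S) r" using agrees_move by blast
    qed
  qed
  ultimately show ?thesis unfolding generically_def by blast
qed

lemma decided_cong:
  assumes "\<And>g. g \<in> perms S \<Longrightarrow> P g \<longleftrightarrow> Q g"
  shows "decided S P \<longleftrightarrow> decided S Q"
proof -
  have "generically S q P \<longleftrightarrow> generically S q Q" "generically S q (\<lambda>g. \<not> P g) \<longleftrightarrow> generically S q (\<lambda>g. \<not> Q g)" for q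
    using assms by (auto intro!: generically_cong)
  then show ?thesis by (simp add: decided_def)
qed

lemma decided_const: "decided S (\<lambda>g. c)"
  by (rule decided_I) auto

lemma generically_const:
  assumes "finite S \<or> S = UNIV" "cond S p"
  shows "generically S p (\<lambda>g. c) \<longleftrightarrow> c"
  using generically_ex[OF assms, of "\<lambda>g. c"] generically_I[of S p "\<lambda>g. c"] by blast

lemma init_seg_cases: "init_seg S \<Longrightarrow> finite S \<or> S = UNIV"
  by (auto simp: init_seg_def)

lemma init_seg_bij_eq:
  assumes "init_seg S" "init_seg S'" "bij_betw f S S'"
  shows "S = S'"
proof -
  have fin: "finite S \<longleftrightarrow> finite S'" and card: "card S = card S'"
    using bij_betw_finite[OF assms(3)] bij_betw_same_card[OF assms(3)] by blast+
  from assms(1) consider "S = UNIV" | n where "S = {..<n}" unfolding init_seg_def by blast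
  then show ?thesis
  proof cases
    case 1
    with fin assms(2) show ?thesis unfolding init_seg_def by auto
  next
    case 2
    with fin assms(2) obtain m where "S' = {..<m}" unfolding init_seg_def by auto
    with 2 card show ?thesis by simp
  qed
qed

lemma init_seg_downward: "init_seg S \<Longrightarrow> a \<in> S \<Longrightarrow> b \<le> a \<Longrightarrow> b \<in> S"
  by (auto simp: init_seg_def)

lemma init_seg_card: "init_seg S \<Longrightarrow> {..<n} \<subseteq> S \<longleftrightarrow> infinite S \<or> n \<le> card S"
  by (auto simp: init_seg_def)

lemma permsD: 
  assumes "g \<in> perms S"
  shows "bij_betw g S S" "g ` S = S" "inj_on g S" "g \<in> extensional S" "x \<in> S \<Longrightarrow> g x \<in> S"
  using assms by (auto simp: perms_def bij_betw_def)

lemma agrees_zip: 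
  "length xs = length ts \<Longrightarrow> agrees g (zip xs ts) \<longleftrightarrow> map g xs = ts"
  by (induction xs ts rule: list_induct2) (auto simp: agrees_def)

lemma agrees_append: "agrees g (p @ q) \<longleftrightarrow> agrees g p \<and> agrees g q"
  by (simp add: agrees_def ball_Un)

lemma in_lists_nth: "xs \<in> lists A \<longleftrightarrow> (\<forall>i<length xs. xs ! i \<in> A)"
  by (simp add: in_lists_conv_set all_set_conv_all_nth)

lemma cond_lists:
  assumes "length xs = length ts" "cond S (zip xs ts)"
  shows "xs \<in> lists S \<and> ts \<in> lists S"
proof -
  have sub: "set (zip xs ts) \<subseteq> S \<times> S" using assms(2) by (simp add: cond_def)
  have "set (map fst (zip xs ts)) \<subseteq> S" "set (map snd (zip xs ts)) \<subseteq> S" using sub by auto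
  then show ?thesis using assms(1) by (simp add: lists_eq_set)
qed

lemma cond_iff_UNIV: "cond S p \<longleftrightarrow> set p \<subseteq> S \<times> S \<and> cond UNIV p"
  by (simp add: cond_def)

lemma subset_Times_iff: "A \<subseteq> S \<times> S' \<longleftrightarrow> (\<forall>z\<in>A. fst z \<in> S) \<and> (\<forall>z\<in>A. snd z \<in> S')"
  by (auto simp: mem_Times_iff)

lemma cond_fst: "cond S p \<Longrightarrow> fst ` set p \<subseteq> S"
  unfolding cond_iff_UNIV[of S] subset_Times_iff by blast

lemma extend_ran_list:
  assumes "finite S \<or> S = UNIV" "cond S p" "a \<in> lists S"
  shows "\<exists>r. length r = length a \<and> cond S (zip r a @ p)"
  using assms(3)
proof (induction a)
  case (Cons t a)
  then obtain r where r: "length r = length a" "cond S (zip r a @ p)" by auto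
  obtain x where "cond S ((x, t) # zip r a @ p)"
    using cond_extend_ran[OF r(2) _ assms(1)] Cons.hyps by blast
  with r show ?case by (intro exI[of _ "x # r"]) simp
qed (use assms in auto)

section \<open>Finite partial permutations described by formulas\<close>

definition at_least :: "nat \<Rightarrow> 'r fm" where
  "at_least k = Existss k (Conj {m. case prod_decode m of (i, j) \<Rightarrow> i < j \<and> j < k}
     (\<lambda>m. case prod_decode m of (i, j) \<Rightarrow> Neg (Eq i j)))"

lemma wff_at_least: "wff L (at_least k) n"
  by (auto simp: at_least_def split: prod.splits)

lemma Ball_decode: "(\<forall>m\<in>{m. case prod_decode m of (i, j) \<Rightarrow> P i j}. Q (prod_decode m)) \<longleftrightarrow> (\<forall>i j. P i j \<longrightarrow> Q (i, j))"
  by (auto split: prod.splits) (metis case_prod_conv prod_encode_inverse)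

lemma sat_at_least:
  assumes "init_seg (carrier M)"
  shows "sat M (at_least k) a \<longleftrightarrow> {..<k} \<subseteq> carrier M"
proof -
  have D: "(\<forall>m\<in>{m. case prod_decode m of (i, j) \<Rightarrow> i < j \<and> j < k}.
       sat M (case prod_decode m of (i, j) \<Rightarrow> Neg (Eq i j)) (b @ a)) \<longleftrightarrow> distinct b"
    if "length b = k" for b
  proof -
    have "(\<forall>m\<in>{m. case prod_decode m of (i, j) \<Rightarrow> i < j \<and> j < k}.
       sat M (case prod_decode m of (i, j) \<Rightarrow> Neg (Eq i j)) (b @ a)) \<longleftrightarrow>
       (\<forall>i j. i < j \<and> j < k \<longrightarrow> (b @ a) ! i \<noteq> (b @ a) ! j)"
      by (subst Ball_decode) simp
    also have "\<dots> \<longleftrightarrow> (\<forall>i j. i < j \<and> j < k \<longrightarrow> b ! i \<noteq> b ! j)"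
      using that by (auto simp: nth_append)
    also have "\<dots> \<longleftrightarrow> distinct b"
    proof
      assume H: "\<forall>i j. i < j \<and> j < k \<longrightarrow> b ! i \<noteq> b ! j"
      show "distinct b" unfolding distinct_conv_nth
      proof (intro allI impI)
        fix i j assume "i < length b" "j < length b" "i \<noteq> j"
        then show "b ! i \<noteq> b ! j" using H[rule_format, of i j] H[rule_format, of j i] that
          by (cases "i < j") auto
      qed
    next
      assume "distinct b"
      then show "\<forall>i j. i < j \<and> j < k \<longrightarrow> b ! i \<noteq> b ! j" using that by (simp add: nth_eq_iff_index_eq)
    qed
    finally show ?thesis .
  qed
  have "sat M (at_least k) a \<longleftrightarrow> (\<exists>b\<in>lists (carrier M). length b = k \<and> distinct b)"
    unfolding at_least_def sat_Existss sat.simps by (intro bex_cong refl conj_cong) (rule D)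
  also have "\<dots> \<longleftrightarrow> {..<k} \<subseteq> carrier M"
  proof
    assume "\<exists>b\<in>lists (carrier M). length b = k \<and> distinct b"
    then obtain b where b: "set b \<subseteq> carrier M" "length b = k" "distinct b" by auto
    then have "infinite (carrier M) \<or> k \<le> card (carrier M)"
      using card_mono[of "carrier M" "set b"] distinct_card[of b] by auto
    then show "{..<k} \<subseteq> carrier M" using init_seg_card[OF assms] by blast
  next
    assume "{..<k} \<subseteq> carrier M"
    then show "\<exists>b\<in>lists (carrier M). length b = k \<and> distinct b"
      by (intro bexI[of _ "[0..<k]"]) auto
  qed
  finally show ?thesis .
qed

text \<open>
As underlying sets are initial segments, \<open>t\<close> belongs to one if and only if it has at least \<open>t + 1\<close> elements.
So membership of a natural number is expressed by a sentence.
\<close>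

definition contains :: "nat list \<Rightarrow> 'r fm" where
  "contains ts = Conj {..<length ts} (\<lambda>i. at_least (Suc (ts ! i)))"

lemma wff_contains: "wff L (contains ts) n"
  by (simp add: contains_def wff_at_least)

lemma sat_contains:
  assumes "init_seg (carrier M)"
  shows "sat M (contains ts) a \<longleftrightarrow> ts \<in> lists (carrier M)"
proof -
  have "{..<Suc t} \<subseteq> carrier M \<longleftrightarrow> t \<in> carrier M" for t
    using init_seg_downward[OF assms] by auto
  then show ?thesis by (simp add: contains_def sat_at_least[OF assms] in_lists_nth Ball_def del: in_lists_conv_set)
qed

text \<open>
\<open>ts\<close> is a tuple of natural numbers, not of variables: the formula says of the tuple of its variables that
sending it to \<open>ts\<close> is a finite partial permutation of the underlying set.
\<close>

definition matches :: "nat list \<Rightarrow> 'r fm" where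
  "matches ts = And (contains ts)
     (Conj {m. case prod_decode m of (i, j) \<Rightarrow> i < length ts \<and> j < length ts}
       (\<lambda>m. case prod_decode m of (i, j) \<Rightarrow> if ts ! i = ts ! j then Eq i j else Neg (Eq i j)))"

lemma wff_matches: "length ts \<le> n \<Longrightarrow> wff L (matches ts) n"
  by (auto simp: matches_def wff_contains split: prod.splits)

lemma sat_matches:
  assumes "init_seg (carrier M)" "length xs = length ts" "xs \<in> lists (carrier M)"
  shows "sat M (matches ts) xs \<longleftrightarrow> cond (carrier M) (zip xs ts)"
proof -
  have "sat M (matches ts) xs \<longleftrightarrow> ts \<in> lists (carrier M) \<and>
     (\<forall>i j. i < length ts \<and> j < length ts \<longrightarrow>
       sat M (if ts ! i = ts ! j then Eq i j else Neg (Eq i j)) xs)"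
    unfolding matches_def sat_And sat_contains[OF assms(1)] sat.simps
    using Ball_decode[of "\<lambda>i j. i < length ts \<and> j < length ts" "\<lambda>z. sat M (case z of (i, j) \<Rightarrow> if ts ! i = ts ! j then Eq i j else Neg (Eq i j)) xs"]
    by simp
  also have "\<dots> \<longleftrightarrow> ts \<in> lists (carrier M) \<and>
     (\<forall>i j. i < length ts \<and> j < length ts \<longrightarrow> (xs ! i = xs ! j \<longleftrightarrow> ts ! i = ts ! j))"
    by auto
  also have "\<dots> \<longleftrightarrow> cond (carrier M) (zip xs ts)"
  proof
    assume *: "ts \<in> lists (carrier M) \<and>
     (\<forall>i j. i < length ts \<and> j < length ts \<longrightarrow> (xs ! i = xs ! j \<longleftrightarrow> ts ! i = ts ! j))"
    then show "cond (carrier M) (zip xs ts)"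
      using assms(2,3) unfolding cond_iff set_zip in_lists_nth by auto
  next
    assume c: "cond (carrier M) (zip xs ts)"
    have mem: "(xs ! i, ts ! i) \<in> set (zip xs ts)" if "i < length ts" for i
      using that assms(2) by (auto simp: set_zip)
    show "ts \<in> lists (carrier M) \<and>
     (\<forall>i j. i < length ts \<and> j < length ts \<longrightarrow> (xs ! i = xs ! j \<longleftrightarrow> ts ! i = ts ! j))"
    proof (intro conjI allI impI)
      show "ts \<in> lists (carrier M)" using cond_lists[OF assms(2) c] by simp
      show "xs ! i = xs ! j \<longleftrightarrow> ts ! i = ts ! j" if "i < length ts \<and> j < length ts" for i j
        using conjunct2[OF c[unfolded cond_iff], rule_format, OF mem mem] that by blast
    qed
  qed
  finally show ?thesis .
qed

section \<open>Models and their isomorphisms as Borel spaces\<close>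

definition arrow :: "('r, nat) rstruct \<Rightarrow> (nat \<Rightarrow> nat) \<Rightarrow> 'r arrow" where
  "arrow M g = \<lparr>src = M, trg = push M g, fun_of = g\<rparr>"

lemma arrow_simps [simp]: "src (arrow M g) = M" "trg (arrow M g) = push M g" "fun_of (arrow M g) = g"
  by (simp_all add: arrow_def)

lemma space_ModB [simp]: "space (ModB L T) = Mod L T"
  unfolding ModB_def by (rule space_measure_of) auto

lemma space_ArrB [simp]: "space (ArrB L T) = Arr L T"
  unfolding ArrB_def by (rule space_measure_of) auto

lemma sets_ModB: "sets (ModB L T) = sigma_sets (Mod L T)
     ({{M \<in> Mod L T. infinite (carrier M) \<or> n \<le> card (carrier M)} | n. True} \<union>
      {{M \<in> Mod L T. a \<in> lists (carrier M) \<and> a \<in> rel M R} | R a. L R = Some (length a)})"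
  unfolding ModB_def by (rule sets_measure_of) auto

lemma sets_ArrB: "sets (ArrB L T) = sigma_sets (Arr L T)
     ({{f \<in> Arr L T. src f \<in> B} | B. B \<in> sets (ModB L T)} \<union>
      {{f \<in> Arr L T. a \<in> carrier (src f) \<and> b \<in> carrier (src f) \<and> fun_of f a = b} | a b. True})"
  unfolding ArrB_def by (rule sets_measure_of) auto

locale models =
  fixes L :: "'q language" and T :: "'q fm set"
  assumes sentences: "is_theory L T"
begin

abbreviation "Md \<equiv> Mod L T"
abbreviation "MdB \<equiv> ModB L T"

lemma MdD:
  assumes "M \<in> Md"
  shows "init_seg (carrier M)" "finite (carrier M) \<or> carrier M = UNIV" "is_struct L M" "is_model L T M"
  using assms by (auto simp: Mod_def is_model_def init_seg_cases)

lemma push_perm: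
  assumes "M \<in> Md" "g \<in> perms (carrier M)"
  shows "push M g \<in> Md" "carrier (push M g) = carrier M"
  using assms is_model_push[OF sentences MdD(4)] permsD[OF assms(2)] by (auto simp: Mod_def)

lemma arrow_in_Arr:
  assumes "M \<in> Md" "g \<in> perms (carrier M)"
  shows "arrow M g \<in> Arr L T"
proof -
  have "a \<in> rel M R \<longleftrightarrow> map g a \<in> rel (push M g) R" if "a \<in> lists (carrier M)" for a R
    using rel_push[OF MdD(3)[OF assms(1)] permsD(3)[OF assms(2)] that] by blast
  then show ?thesis unfolding Arr_def
    using assms push_perm[OF assms] permsD(1,4)[OF assms(2)] by simp
qed

lemma ArrD:
  assumes "f \<in> Arr L T"
  shows "src f \<in> Md" "trg f \<in> Md" "carrier (trg f) = carrier (src f)"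
    "fun_of f \<in> perms (carrier (src f))" "f = arrow (src f) (fun_of f)"
    "a \<in> lists (carrier (src f)) \<Longrightarrow> a \<in> rel (src f) R \<longleftrightarrow> map (fun_of f) a \<in> rel (trg f) R"
proof -
  have f: "src f \<in> Md" "trg f \<in> Md" "bij_betw (fun_of f) (carrier (src f)) (carrier (trg f))"
    "fun_of f \<in> extensional (carrier (src f))"
    "\<And>R a. a \<in> lists (carrier (src f)) \<Longrightarrow> a \<in> rel (src f) R \<longleftrightarrow> map (fun_of f) a \<in> rel (trg f) R"
    using assms by (auto simp: Arr_def)
  show "src f \<in> Md" "trg f \<in> Md" by fact+
  show c: "carrier (trg f) = carrier (src f)"
    using init_seg_bij_eq[OF MdD(1)[OF f(1)] MdD(1)[OF f(2)] f(3)] by simp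
  show "fun_of f \<in> perms (carrier (src f))" using f c by (simp add: perms_def)
  show "a \<in> lists (carrier (src f)) \<Longrightarrow> a \<in> rel (src f) R \<longleftrightarrow> map (fun_of f) a \<in> rel (trg f) R"
    by (rule f(5))
  have surj: "fun_of f ` carrier (src f) = carrier (trg f)" using f(3) by (simp add: bij_betw_def)
  have "rel (trg f) R = map (fun_of f) ` rel (src f) R" for R
  proof
    show "map (fun_of f) ` rel (src f) R \<subseteq> rel (trg f) R"
      using f(5) rel_in_lists[OF MdD(3)[OF f(1)]] by blast
    show "rel (trg f) R \<subseteq> map (fun_of f) ` rel (src f) R"
    proof
      fix a assume a: "a \<in> rel (trg f) R"
      then have "a \<in> lists (fun_of f ` carrier (src f))"
        using rel_in_lists[OF MdD(3)[OF f(2)]] surj by simp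
      then obtain b where "b \<in> lists (carrier (src f))" "a = map (fun_of f) b"
        unfolding lists_image by blast
      with a f(5) show "a \<in> map (fun_of f) ` rel (src f) R" by blast
    qed
  qed
  then have "trg f = push (src f) (fun_of f)" using surj by (auto simp: push_def intro!: rstruct.equality)
  then show "f = arrow (src f) (fun_of f)" by (simp add: arrow_def)
qed

lemma relD: "M \<in> Md \<Longrightarrow> a \<in> rel M R \<Longrightarrow> a \<in> lists (carrier M) \<and> L R = Some (length a)"
  using rel_in_lists[OF MdD(3)] .

lemma carrier_sets: "{M \<in> Md. a \<in> carrier M} \<in> sets MdB"
proof -
  have "a \<in> carrier M \<longleftrightarrow> infinite (carrier M) \<or> Suc a \<le> card (carrier M)" if "M \<in> Md" for M
  proof -
    have "a \<in> carrier M \<longleftrightarrow> {..<Suc a} \<subseteq> carrier M"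
      using init_seg_downward[OF MdD(1)[OF that]] by auto
    then show ?thesis using init_seg_card[OF MdD(1)[OF that]] by simp
  qed
  then have "{M \<in> Md. a \<in> carrier M} = {M \<in> Md. infinite (carrier M) \<or> Suc a \<le> card (carrier M)}"
    by (intro Collect_cong conj_cong refl)
  then show ?thesis unfolding sets_ModB by (intro sigma_sets.Basic) blast
qed

lemma lists_sets: "{M \<in> Md. a \<in> lists (carrier M)} \<in> sets MdB"
proof -
  have "{M \<in> Md. a \<in> lists (carrier M)} = {M \<in> space MdB. \<forall>x\<in>set a. x \<in> carrier M}" by auto
  also have "\<dots> \<in> sets MdB" by (rule sets.sets_Collect_finite_All) (use carrier_sets in auto)
  finally show ?thesis .
qed

lemma rel_sets: "{M \<in> Md. a \<in> rel M R} \<in> sets MdB"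
proof (cases "L R = Some (length a)")
  case True
  have "{M \<in> Md. a \<in> rel M R} = {M \<in> Md. a \<in> lists (carrier M) \<and> a \<in> rel M R}"
    using relD by (intro Collect_cong conj_cong refl) blast
  then show ?thesis unfolding sets_ModB using True by (intro sigma_sets.Basic) blast
next
  case False
  then have "{M \<in> Md. a \<in> rel M R} = {}" using relD[of _ a R] by auto
  then show ?thesis by (simp only: sets.empty_sets)
qed

lemma cond_sets: "{M \<in> Md. cond (carrier M) p} \<in> sets MdB"
proof -
  have "{M \<in> Md. cond (carrier M) p} = (if cond UNIV p then
      {M \<in> space MdB. \<forall>z\<in>set p. fst z \<in> carrier M} \<inter> {M \<in> space MdB. \<forall>z\<in>set p. snd z \<in> carrier M} else {})"
    unfolding cond_iff_UNIV[of "carrier _"] subset_Times_iff by auto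
  also have "\<dots> \<in> sets MdB"
  proof (cases "cond UNIV p")
    case True
    have "{M \<in> space MdB. \<forall>z\<in>set p. fst z \<in> carrier M} \<in> sets MdB"
      "{M \<in> space MdB. \<forall>z\<in>set p. snd z \<in> carrier M} \<in> sets MdB"
      by (rule sets.sets_Collect_finite_All; use carrier_sets in simp)+
    with True show ?thesis by simp
  qed simp
  finally show ?thesis .
qed

section \<open>Vaught transforms and the theorem of Lopez-Escobar\<close>

text \<open>
The transform of \<open>X\<close> is the relation ``\<open>act M g \<in> X\<close> for comeagerly many \<open>g\<close> extending \<open>p\<close>'' between \<open>M\<close> and \<open>p\<close>.
If a class \<open>K\<close> of such relations is closed under countable conjunctions and under the operation that
corresponds to complements, and contains the transforms of the generators, then it contains the
transforms of the whole \<open>\<sigma>\<close>-algebra.  The Baire property has to be carried along for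
\<open>generically_compl\<close> to be applicable.
\<close>

lemma vaught_induction:
  fixes act :: "('q, nat) rstruct \<Rightarrow> (nat \<Rightarrow> nat) \<Rightarrow> 'x"
    and K :: "(('q, nat) rstruct \<Rightarrow> (nat \<times> nat) list \<Rightarrow> bool) \<Rightarrow> bool"
  assumes act: "\<And>M g. M \<in> Md \<Longrightarrow> g \<in> perms (carrier M) \<Longrightarrow> act M g \<in> \<Omega>"
    and base: "\<And>X. X \<in> Gen \<Longrightarrow> (\<forall>M\<in>Md. decided (carrier M) (\<lambda>g. act M g \<in> X)) \<and>
        K (\<lambda>M p. generically (carrier M) p (\<lambda>g. act M g \<in> X))"
    and K_False: "K (\<lambda>M p. False)"
    and K_all: "\<And>Q. (\<And>n::nat. K (Q n)) \<Longrightarrow> K (\<lambda>M p. \<forall>n. Q n M p)"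
    and K_neg: "\<And>Q. K Q \<Longrightarrow> K (\<lambda>M p. \<forall>r. cond (carrier M) (r @ p) \<longrightarrow> \<not> Q M (r @ p))"
    and K_cong: "\<And>Q Q'. K Q \<Longrightarrow> (\<And>M p. M \<in> Md \<Longrightarrow> cond (carrier M) p \<Longrightarrow> Q M p \<longleftrightarrow> Q' M p) \<Longrightarrow> K Q'"
    and X: "X \<in> sigma_sets \<Omega> Gen"
  shows "(\<forall>M\<in>Md. decided (carrier M) (\<lambda>g. act M g \<in> X)) \<and>
        K (\<lambda>M p. generically (carrier M) p (\<lambda>g. act M g \<in> X))"
  using X
proof induction
  case (Basic X)
  then show ?case by (rule base)
next
  case Empty
  have "K (\<lambda>M p. generically (carrier M) p (\<lambda>g. False))"
    by (rule K_cong[OF K_False]) (simp add: generically_const MdD(2))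
  then show ?case by (simp add: decided_const)
next
  case (Compl X)
  have eq: "act M g \<in> \<Omega> - X \<longleftrightarrow> \<not> act M g \<in> X" if "M \<in> Md" "g \<in> perms (carrier M)" for M g
    using act[OF that] by simp
  have "decided (carrier M) (\<lambda>g. act M g \<in> \<Omega> - X)" if "M \<in> Md" for M
    by (rule iffD2[OF decided_cong[OF eq[OF that]]], assumption, rule decided_compl) (use Compl that in blast)
  moreover have "K (\<lambda>M p. generically (carrier M) p (\<lambda>g. act M g \<in> \<Omega> - X))"
  proof (rule K_cong[OF K_neg[OF conjunct2[OF Compl.IH]]])
    fix M p assume M: "M \<in> Md" and p: "cond (carrier M) p"
    have "generically (carrier M) p (\<lambda>g. act M g \<in> \<Omega> - X) \<longleftrightarrow> generically (carrier M) p (\<lambda>g. \<not> act M g \<in> X)"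
      by (rule generically_cong) (rule eq[OF M])
    also have "\<dots> \<longleftrightarrow> (\<forall>r. cond (carrier M) (r @ p) \<longrightarrow> \<not> generically (carrier M) (r @ p) (\<lambda>g. act M g \<in> X))"
      by (rule generically_compl[OF MdD(2)[OF M] _ p]) (use Compl M in blast)
    finally show "(\<forall>r. cond (carrier M) (r @ p) \<longrightarrow> \<not> generically (carrier M) (r @ p) (\<lambda>g. act M g \<in> X)) \<longleftrightarrow>
      generically (carrier M) p (\<lambda>g. act M g \<in> \<Omega> - X)" by simp
  qed
  ultimately show ?case by blast
next
  case (Union X)
  have dec: "decided (carrier M) (\<lambda>g. act M g \<in> X n)" if "M \<in> Md" for M n using Union that by blast
  have "decided (carrier M) (\<lambda>g. act M g \<in> \<Union> (range X))" if "M \<in> Md" for M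
    using decided_ex[OF MdD(2)[OF that] dec[OF that]] by simp
  moreover have "K (\<lambda>M p. generically (carrier M) p (\<lambda>g. act M g \<in> \<Union> (range X)))"
  proof (rule K_cong)
    show "K (\<lambda>M p. \<forall>r. cond (carrier M) (r @ p) \<longrightarrow> \<not> (\<forall>n. \<forall>s. cond (carrier M) (s @ r @ p) \<longrightarrow>
       \<not> generically (carrier M) (s @ r @ p) (\<lambda>g. act M g \<in> X n)))"
      by (rule K_neg[OF K_all[OF K_neg[OF conjunct2[OF Union.IH]]]])
    fix M p assume M: "M \<in> Md" and p: "cond (carrier M) p"
    note S = MdD(2)[OF M]
    have neg: "(\<forall>s. cond (carrier M) (s @ q) \<longrightarrow> \<not> generically (carrier M) (s @ q) (\<lambda>g. act M g \<in> X n))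
       \<longleftrightarrow> generically (carrier M) q (\<lambda>g. \<not> act M g \<in> X n)" if "cond (carrier M) q" for q n
      using generically_compl[OF S dec[OF M] that] by blast
    have d2: "decided (carrier M) (\<lambda>g. \<forall>n. \<not> act M g \<in> X n)"
      using decided_compl[OF decided_ex[OF S dec[OF M]]] by simp
    have "(\<forall>r. cond (carrier M) (r @ p) \<longrightarrow> \<not> (\<forall>n. \<forall>s. cond (carrier M) (s @ r @ p) \<longrightarrow>
       \<not> generically (carrier M) (s @ r @ p) (\<lambda>g. act M g \<in> X n))) \<longleftrightarrow>
      (\<forall>r. cond (carrier M) (r @ p) \<longrightarrow> \<not> generically (carrier M) (r @ p) (\<lambda>g. \<forall>n. \<not> act M g \<in> X n))"
      using neg by (simp add: generically_all)
    also have "\<dots> \<longleftrightarrow> generically (carrier M) p (\<lambda>g. \<not> (\<forall>n. \<not> act M g \<in> X n))"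
      using generically_compl[OF S d2 p] by blast
    also have "\<dots> \<longleftrightarrow> generically (carrier M) p (\<lambda>g. act M g \<in> \<Union> (range X))" by simp
    finally show "(\<forall>r. cond (carrier M) (r @ p) \<longrightarrow> \<not> (\<forall>n. \<forall>s. cond (carrier M) (s @ r @ p) \<longrightarrow>
       \<not> generically (carrier M) (s @ r @ p) (\<lambda>g. act M g \<in> X n))) \<longleftrightarrow>
       generically (carrier M) p (\<lambda>g. act M g \<in> \<Union> (range X))" .
  qed
  ultimately show ?case by blast
qed

text \<open>
The category quantifier preserves Borel sets: here \<open>K\<close> consists of the relations whose sections at every
\<open>p\<close> are Borel.
\<close>

theorem vaught_Borel:
  assumes "X \<in> sets (ArrB L T)"
  shows "(\<forall>M\<in>Md. decided (carrier M) (\<lambda>g. arrow M g \<in> X)) \<and>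
    (\<forall>p. {M \<in> Md. cond (carrier M) p \<and> generically (carrier M) p (\<lambda>g. arrow M g \<in> X)} \<in> sets MdB)"
proof (rule vaught_induction[where K = "\<lambda>Q. \<forall>p. {M \<in> Md. cond (carrier M) p \<and> Q M p} \<in> sets MdB"])
  show "arrow M g \<in> Arr L T" if "M \<in> Md" "g \<in> perms (carrier M)" for M g
    using arrow_in_Arr that by blast
  show "X \<in> sigma_sets (Arr L T)
     ({{f \<in> Arr L T. src f \<in> B} | B. B \<in> sets (ModB L T)} \<union>
      {{f \<in> Arr L T. a \<in> carrier (src f) \<and> b \<in> carrier (src f) \<and> fun_of f a = b} | a b. True})"
    using assms by (simp add: sets_ArrB)
  show "\<forall>p. {M \<in> Md. cond (carrier M) p \<and> False} \<in> sets MdB" by simp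
next
  fix Q :: "nat \<Rightarrow> ('q, nat) rstruct \<Rightarrow> (nat \<times> nat) list \<Rightarrow> bool"
  assume Q: "\<And>n. \<forall>p. {M \<in> Md. cond (carrier M) p \<and> Q n M p} \<in> sets MdB"
  show "\<forall>p. {M \<in> Md. cond (carrier M) p \<and> (\<forall>n. Q n M p)} \<in> sets MdB"
  proof
    fix p
    have "{M \<in> Md. cond (carrier M) p \<and> (\<forall>n. Q n M p)} = {M \<in> space MdB. \<forall>n. cond (carrier M) p \<and> Q n M p}" by auto
    also have "\<dots> \<in> sets MdB" by (rule sets.sets_Collect_countable_All) (use Q in auto)
    finally show "{M \<in> Md. cond (carrier M) p \<and> (\<forall>n. Q n M p)} \<in> sets MdB" .
  qed
next
  fix Q :: "('q, nat) rstruct \<Rightarrow> (nat \<times> nat) list \<Rightarrow> bool"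
  assume Q: "\<forall>p. {M \<in> Md. cond (carrier M) p \<and> Q M p} \<in> sets MdB"
  show "\<forall>p. {M \<in> Md. cond (carrier M) p \<and> (\<forall>r. cond (carrier M) (r @ p) \<longrightarrow> \<not> Q M (r @ p))} \<in> sets MdB"
  proof
    fix p
    have "{M \<in> Md. cond (carrier M) p \<and> (\<forall>r. cond (carrier M) (r @ p) \<longrightarrow> \<not> Q M (r @ p))} =
      {M \<in> Md. cond (carrier M) p} \<inter> {M \<in> space MdB. \<forall>r. \<not> (cond (carrier M) (r @ p) \<and> Q M (r @ p))}" by auto
    also have "\<dots> \<in> sets MdB"
      by (intro sets.Int cond_sets sets.sets_Collect_countable_All sets.sets_Collect_neg) (use Q in auto)
    finally show "{M \<in> Md. cond (carrier M) p \<and> (\<forall>r. cond (carrier M) (r @ p) \<longrightarrow> \<not> Q M (r @ p))} \<in> sets MdB" .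
  qed
next
  fix Q Q' :: "('q, nat) rstruct \<Rightarrow> (nat \<times> nat) list \<Rightarrow> bool"
  assume Q: "\<forall>p. {M \<in> Md. cond (carrier M) p \<and> Q M p} \<in> sets MdB"
    and eq: "\<And>M p. M \<in> Md \<Longrightarrow> cond (carrier M) p \<Longrightarrow> Q M p \<longleftrightarrow> Q' M p"
  have "{M \<in> Md. cond (carrier M) p \<and> Q' M p} = {M \<in> Md. cond (carrier M) p \<and> Q M p}" for p
    using eq by auto
  with Q show "\<forall>p. {M \<in> Md. cond (carrier M) p \<and> Q' M p} \<in> sets MdB" by simp
next
  fix X :: "'q arrow set"
  assume "X \<in> {{f \<in> Arr L T. src f \<in> B} | B. B \<in> sets (ModB L T)} \<union>
      {{f \<in> Arr L T. a \<in> carrier (src f) \<and> b \<in> carrier (src f) \<and> fun_of f a = b} | a b. True}"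
  then consider (S) B where "B \<in> sets MdB" "X = {f \<in> Arr L T. src f \<in> B}"
    | (F) a b where "X = {f \<in> Arr L T. a \<in> carrier (src f) \<and> b \<in> carrier (src f) \<and> fun_of f a = b}"
    by blast
  then show "(\<forall>M\<in>Md. decided (carrier M) (\<lambda>g. arrow M g \<in> X)) \<and>
    (\<forall>p. {M \<in> Md. cond (carrier M) p \<and> generically (carrier M) p (\<lambda>g. arrow M g \<in> X)} \<in> sets MdB)"
  proof cases
    case S
    have eq: "arrow M g \<in> X \<longleftrightarrow> M \<in> B" if "M \<in> Md" "g \<in> perms (carrier M)" for M g
      using S arrow_in_Arr[OF that] by simp
    have "decided (carrier M) (\<lambda>g. arrow M g \<in> X)" if "M \<in> Md" for M
      by (rule iffD2[OF decided_cong[OF eq[OF that]]], assumption, rule decided_const)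
    moreover have "{M \<in> Md. cond (carrier M) p \<and> generically (carrier M) p (\<lambda>g. arrow M g \<in> X)} =
      {M \<in> Md. cond (carrier M) p} \<inter> B" for p
    proof -
      have "generically (carrier M) p (\<lambda>g. arrow M g \<in> X) \<longleftrightarrow> M \<in> B"
        if M: "M \<in> Md" and p: "cond (carrier M) p" for M
      proof -
        have "generically (carrier M) p (\<lambda>g. arrow M g \<in> X) \<longleftrightarrow> generically (carrier M) p (\<lambda>g. M \<in> B)"
          by (rule generically_cong) (rule eq[OF M])
        then show ?thesis using generically_const[OF MdD(2)[OF M] p] by simp
      qed
      then show ?thesis using sets.sets_into_space[OF S(1)] by auto
    qed
    ultimately show ?thesis using S cond_sets by auto
  next
    case F
    have eq: "arrow M g \<in> X \<longleftrightarrow> a \<in> carrier M \<and> b \<in> carrier M \<and> g a = b" if "M \<in> Md" "g \<in> perms (carrier M)" for M g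
      using F arrow_in_Arr[OF that] by simp
    have dec: "decided (carrier M) (\<lambda>g. a \<in> carrier M \<and> b \<in> carrier M \<and> g a = b)" if M: "M \<in> Md" for M
    proof (rule decided_I)
      fix p assume p: "cond (carrier M) p"
      show "\<exists>q. cond (carrier M) q \<and> set p \<subseteq> set q \<and>
        ((\<forall>g\<in>perms (carrier M). agrees g q \<longrightarrow> a \<in> carrier M \<and> b \<in> carrier M \<and> g a = b) \<or>
         (\<forall>g\<in>perms (carrier M). agrees g q \<longrightarrow> \<not> (a \<in> carrier M \<and> b \<in> carrier M \<and> g a = b)))"
      proof (cases "a \<in> carrier M \<and> b \<in> carrier M")
        case True
        then obtain t where "cond (carrier M) ((a, t) # p)"
          using cond_extend_dom[OF p _ MdD(2)[OF M]] by blast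
        with True show ?thesis by (intro exI[of _ "(a, t) # p"]) (auto simp: agrees_def)
      next
        case False
        then have "\<not> (a \<in> carrier M \<and> b \<in> carrier M \<and> g a = b)" for g :: "nat \<Rightarrow> nat" by blast
        with p show ?thesis by blast
      qed
    qed
    have "decided (carrier M) (\<lambda>g. arrow M g \<in> X)" if M: "M \<in> Md" for M
    proof -
      have "decided (carrier M) (\<lambda>g. arrow M g \<in> X) \<longleftrightarrow>
          decided (carrier M) (\<lambda>g. a \<in> carrier M \<and> b \<in> carrier M \<and> g a = b)"
        by (rule decided_cong) (rule eq[OF M])
      with dec[OF M] show ?thesis by simp
    qed
    moreover have "{M \<in> Md. cond (carrier M) p \<and> generically (carrier M) p (\<lambda>g. arrow M g \<in> X)} \<in> sets MdB" for p
    proof -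
      have gen: "generically (carrier M) p (\<lambda>g. arrow M g \<in> X) \<longleftrightarrow>
          a \<in> carrier M \<and> b \<in> carrier M \<and> (\<forall>t\<in>-{b}. \<not> cond (carrier M) ((a, t) # p))"
        if M: "M \<in> Md" and p: "cond (carrier M) p" for M
      proof -
        have "generically (carrier M) p (\<lambda>g. arrow M g \<in> X) \<longleftrightarrow>
            generically (carrier M) p (\<lambda>g. a \<in> carrier M \<and> b \<in> carrier M \<and> g a = b)"
          by (rule generically_cong) (rule eq[OF M])
        also have "\<dots> \<longleftrightarrow> a \<in> carrier M \<and> b \<in> carrier M \<and> (\<forall>t\<in>-{b}. \<not> cond (carrier M) ((a, t) # p))"
        proof
          assume g: "generically (carrier M) p (\<lambda>g. a \<in> carrier M \<and> b \<in> carrier M \<and> g a = b)"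
          have "\<not> cond (carrier M) ((a, t) # p)" if t: "t \<in> -{b}" for t
          proof
            assume c: "cond (carrier M) ((a, t) # p)"
            have "generically (carrier M) ((a, t) # p) (\<lambda>g. a \<in> carrier M \<and> b \<in> carrier M \<and> g a = b)"
              using g by (rule generically_subset) auto
            from generically_ex[OF MdD(2)[OF M] c this] t show False by (auto simp: agrees_def)
          qed
          moreover have "a \<in> carrier M \<and> b \<in> carrier M" using generically_ex[OF MdD(2)[OF M] p g] by blast
          ultimately show "a \<in> carrier M \<and> b \<in> carrier M \<and> (\<forall>t\<in>-{b}. \<not> cond (carrier M) ((a, t) # p))"
            by blast
        next
          assume *: "a \<in> carrier M \<and> b \<in> carrier M \<and> (\<forall>t\<in>-{b}. \<not> cond (carrier M) ((a, t) # p))"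
          show "generically (carrier M) p (\<lambda>g. a \<in> carrier M \<and> b \<in> carrier M \<and> g a = b)"
          proof (rule generically_I)
            fix g assume g: "g \<in> perms (carrier M)" "agrees g p"
            have "agrees g ((a, g a) # p)" using g(2) by (simp add: agrees_def)
            moreover have "fst ` set ((a, g a) # p) \<subseteq> carrier M" using cond_fst[OF p] * by simp
            ultimately have "cond (carrier M) ((a, g a) # p)" by (rule agrees_cond[OF g(1)])
            then have "g a \<notin> -{b}" using * by blast
            then show "a \<in> carrier M \<and> b \<in> carrier M \<and> g a = b" using * by simp
          qed
        qed
        finally show ?thesis .
      qed
      have "{M \<in> Md. cond (carrier M) p \<and> generically (carrier M) p (\<lambda>g. arrow M g \<in> X)} =
        {M \<in> Md. cond (carrier M) p} \<inter> {M \<in> Md. a \<in> carrier M} \<inter> {M \<in> Md. b \<in> carrier M} \<inter>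
        {M \<in> space MdB. \<forall>t\<in>-{b}. \<not> cond (carrier M) ((a, t) # p)}" (is "?A = ?B")
      proof (rule set_eqI)
        fix M
        show "M \<in> ?A \<longleftrightarrow> M \<in> ?B"
        proof (cases "M \<in> Md \<and> cond (carrier M) p")
          case True
          then have M: "M \<in> Md" and p: "cond (carrier M) p" by blast+
          show ?thesis unfolding Int_iff mem_Collect_eq space_ModB gen[OF M p] using M p by blast
        next
          case False
          then show ?thesis unfolding Int_iff mem_Collect_eq by blast
        qed
      qed
      also have "\<dots> \<in> sets MdB"
      proof (intro sets.Int cond_sets carrier_sets)
        show "{M \<in> space MdB. \<forall>t\<in>-{b}. \<not> cond (carrier M) ((a, t) # p)} \<in> sets MdB"
          by (intro sets.sets_Collect_countable_Ball sets.sets_Collect_neg) (simp add: cond_sets)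
      qed
      finally show ?thesis .
    qed
    ultimately show ?thesis by blast
  qed
qed

text \<open>
The Vaught transform of a Borel set of models is definable: here \<open>K\<close> consists of the relations that, for
each fixed tuple of values \<open>ts\<close>, are defined by a formula in the arguments \<open>xs\<close>.  The complement turns
into a conjunction over all further values, with the further arguments quantified universally.
\<close>

theorem vaught_formula:
  assumes "B \<in> sets MdB"
  shows "\<exists>\<phi>. wff L \<phi> (length ts) \<and> (\<forall>M\<in>Md. \<forall>xs\<in>lists (carrier M). length xs = length ts \<longrightarrow>
    cond (carrier M) (zip xs ts) \<longrightarrow>
    (generically (carrier M) (zip xs ts) (\<lambda>g. push M g \<in> B) \<longleftrightarrow> sat M \<phi> xs))"
proof -
  define K where "K Q \<longleftrightarrow> (\<forall>ts. \<exists>\<phi>. wff L \<phi> (length ts) \<and> (\<forall>M\<in>Md. \<forall>xs\<in>lists (carrier M).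
    length xs = length ts \<longrightarrow> cond (carrier M) (zip xs ts) \<longrightarrow> (Q M (zip xs ts) \<longleftrightarrow> sat M \<phi> xs)))"
    for Q :: "('q, nat) rstruct \<Rightarrow> (nat \<times> nat) list \<Rightarrow> bool"
  have KI: "K Q" if "\<And>ts. wff L (\<phi> ts) (length ts)"
    "\<And>ts M xs. M \<in> Md \<Longrightarrow> xs \<in> lists (carrier M) \<Longrightarrow> length xs = length ts \<Longrightarrow>
       cond (carrier M) (zip xs ts) \<Longrightarrow> Q M (zip xs ts) \<longleftrightarrow> sat M (\<phi> ts) xs" for Q \<phi>
    unfolding K_def using that by (intro allI exI conjI ballI impI)
  have KE: "\<exists>\<phi>. (\<forall>ts. wff L (\<phi> ts) (length ts)) \<and>
    (\<forall>ts M xs. M \<in> Md \<longrightarrow> xs \<in> lists (carrier M) \<longrightarrow> length xs = length ts \<longrightarrow>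
       cond (carrier M) (zip xs ts) \<longrightarrow> (Q M (zip xs ts) \<longleftrightarrow> sat M (\<phi> ts) xs))" if "K Q" for Q
    using choice[OF that[unfolded K_def]] by (elim exE) (intro exI conjI allI impI; blast)
  have "(\<forall>M\<in>Md. decided (carrier M) (\<lambda>g. push M g \<in> B)) \<and>
    K (\<lambda>M p. generically (carrier M) p (\<lambda>g. push M g \<in> B))"
  proof (rule vaught_induction[where K = K])
    show "push M g \<in> Md" if "M \<in> Md" "g \<in> perms (carrier M)" for M g
      using push_perm that by blast
    show "B \<in> sigma_sets Md ({{M \<in> Mod L T. infinite (carrier M) \<or> n \<le> card (carrier M)} | n. True} \<union>
      {{M \<in> Mod L T. a \<in> lists (carrier M) \<and> a \<in> rel M R} | R a. L R = Some (length a)})"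
      using assms by (simp add: sets_ModB)
    show "K (\<lambda>M p. False)"
      by (rule KI[of "\<lambda>_. Disj {} (\<lambda>_. Eq 0 0)"]) simp_all
  next
    fix Q :: "nat \<Rightarrow> ('q, nat) rstruct \<Rightarrow> (nat \<times> nat) list \<Rightarrow> bool"
    assume "\<And>n. K (Q n)"
    then have "\<forall>n. \<exists>\<phi>. (\<forall>ts. wff L (\<phi> ts) (length ts)) \<and>
    (\<forall>ts M xs. M \<in> Md \<longrightarrow> xs \<in> lists (carrier M) \<longrightarrow> length xs = length ts \<longrightarrow>
       cond (carrier M) (zip xs ts) \<longrightarrow> (Q n M (zip xs ts) \<longleftrightarrow> sat M (\<phi> ts) xs))" using KE by blast
    from choice[OF this] obtain \<phi> where \<phi>: "\<forall>n. (\<forall>ts. wff L (\<phi> n ts) (length ts)) \<and>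
    (\<forall>ts M xs. M \<in> Md \<longrightarrow> xs \<in> lists (carrier M) \<longrightarrow> length xs = length ts \<longrightarrow>
       cond (carrier M) (zip xs ts) \<longrightarrow> (Q n M (zip xs ts) \<longleftrightarrow> sat M (\<phi> n ts) xs))" ..
    show "K (\<lambda>M p. \<forall>n. Q n M p)"
      by (rule KI[of "\<lambda>ts. Conj UNIV (\<lambda>n. \<phi> n ts)"]) (use \<phi> in simp_all)
  next
    fix Q :: "('q, nat) rstruct \<Rightarrow> (nat \<times> nat) list \<Rightarrow> bool"
    assume "K Q"
    from KE[OF this] obtain \<phi> where wf: "\<And>ts. wff L (\<phi> ts) (length ts)" and
      \<phi>: "\<And>ts M xs. M \<in> Md \<Longrightarrow> xs \<in> lists (carrier M) \<Longrightarrow> length xs = length ts \<Longrightarrow>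
         cond (carrier M) (zip xs ts) \<Longrightarrow> Q M (zip xs ts) \<longleftrightarrow> sat M (\<phi> ts) xs" by blast
    define \<theta> where "\<theta> ts = Conj UNIV (\<lambda>m. let us = from_nat m in
       Foralls (length us) (Imp (matches (us @ ts)) (Neg (\<phi> (us @ ts)))))" for ts
    show "K (\<lambda>M p. \<forall>r. cond (carrier M) (r @ p) \<longrightarrow> \<not> Q M (r @ p))"
    proof (rule KI[of \<theta>])
      show "wff L (\<theta> ts) (length ts)" for ts
        using wf[of "_ @ ts"] by (simp add: \<theta>_def Let_def wff_matches)
      fix ts M xs
      assume M: "M \<in> Md" and xs: "xs \<in> lists (carrier M)" "length xs = length ts"
        and c: "cond (carrier M) (zip xs ts)"
      have "sat M (\<theta> ts) xs \<longleftrightarrow> (\<forall>us. \<forall>ys\<in>lists (carrier M). length ys = length us \<longrightarrow>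
         sat M (matches (us @ ts)) (ys @ xs) \<longrightarrow> \<not> sat M (\<phi> (us @ ts)) (ys @ xs))"
        by (simp add: \<theta>_def Let_def) (metis from_nat_to_nat)
      also have "\<dots> \<longleftrightarrow> (\<forall>us. \<forall>ys\<in>lists (carrier M). length ys = length us \<longrightarrow>
         cond (carrier M) (zip ys us @ zip xs ts) \<longrightarrow> \<not> Q M (zip ys us @ zip xs ts))"
      proof -
        have "(sat M (matches (us @ ts)) (ys @ xs) \<longrightarrow> \<not> sat M (\<phi> (us @ ts)) (ys @ xs)) \<longleftrightarrow>
          (cond (carrier M) (zip ys us @ zip xs ts) \<longrightarrow> \<not> Q M (zip ys us @ zip xs ts))"
          if "ys \<in> lists (carrier M)" "length ys = length us" for us ys
          using sat_matches[OF MdD(1)[OF M], of "ys @ xs" "us @ ts"] \<phi>[OF M, of "ys @ xs" "us @ ts"] that xs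
          by simp
        then show ?thesis by blast
      qed
      also have "\<dots> \<longleftrightarrow> (\<forall>r. cond (carrier M) (r @ zip xs ts) \<longrightarrow> \<not> Q M (r @ zip xs ts))"
      proof (intro iffI allI impI ballI)
        fix r assume *: "\<forall>us. \<forall>ys\<in>lists (carrier M). length ys = length us \<longrightarrow>
         cond (carrier M) (zip ys us @ zip xs ts) \<longrightarrow> \<not> Q M (zip ys us @ zip xs ts)"
          and r: "cond (carrier M) (r @ zip xs ts)"
        have z: "r = zip (map fst r) (map snd r)" by (simp add: zip_map_fst_snd)
        have "cond (carrier M) r" using r by (rule cond_subset) simp
        then have "map fst r \<in> lists (carrier M)" using cond_lists[of "map fst r" "map snd r"] z by simp
        from *[rule_format, OF this, of "map snd r"] r show "\<not> Q M (r @ zip xs ts)" using z by simp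
      qed simp
      finally show "(\<forall>r. cond (carrier M) (r @ zip xs ts) \<longrightarrow> \<not> Q M (r @ zip xs ts)) \<longleftrightarrow> sat M (\<theta> ts) xs" by simp
    qed
  next
    fix Q Q' :: "('q, nat) rstruct \<Rightarrow> (nat \<times> nat) list \<Rightarrow> bool"
    assume "K Q" and eq: "\<And>M p. M \<in> Md \<Longrightarrow> cond (carrier M) p \<Longrightarrow> Q M p \<longleftrightarrow> Q' M p"
    from KE[OF this(1)] obtain \<phi> where wf: "\<And>ts. wff L (\<phi> ts) (length ts)" and
      \<phi>: "\<And>ts M xs. M \<in> Md \<Longrightarrow> xs \<in> lists (carrier M) \<Longrightarrow> length xs = length ts \<Longrightarrow>
         cond (carrier M) (zip xs ts) \<Longrightarrow> Q M (zip xs ts) \<longleftrightarrow> sat M (\<phi> ts) xs" by blast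
    show "K Q'" by (rule KI[of \<phi>, OF wf]) (simp add: eq[symmetric] \<phi>)
  next
    fix X
    assume "X \<in> {{M \<in> Mod L T. infinite (carrier M) \<or> n \<le> card (carrier M)} | n. True} \<union>
      {{M \<in> Mod L T. a \<in> lists (carrier M) \<and> a \<in> rel M R} | R a. L R = Some (length a)}"
    then consider (C) n where "X = {M \<in> Mod L T. infinite (carrier M) \<or> n \<le> card (carrier M)}"
      | (R) a R where "L R = Some (length a)" "X = {M \<in> Mod L T. a \<in> lists (carrier M) \<and> a \<in> rel M R}"
      by blast
    then show "(\<forall>M\<in>Md. decided (carrier M) (\<lambda>g. push M g \<in> X)) \<and>
      K (\<lambda>M p. generically (carrier M) p (\<lambda>g. push M g \<in> X))"
    proof cases
      case C
      have eq: "push M g \<in> X \<longleftrightarrow> {..<n} \<subseteq> carrier M" if "M \<in> Md" "g \<in> perms (carrier M)" for M g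
        using init_seg_card[OF MdD(1)[OF that(1)]] push_perm[OF that] C by (simp del: carrier_push)
      have "decided (carrier M) (\<lambda>g. push M g \<in> X)" if "M \<in> Md" for M
        by (rule iffD2[OF decided_cong[OF eq[OF that]]], assumption, rule decided_const)
      moreover have "K (\<lambda>M p. generically (carrier M) p (\<lambda>g. push M g \<in> X))"
      proof (rule KI[of "\<lambda>_. at_least n"])
        show "wff L (at_least n) (length ts)" for ts :: "nat list" by (rule wff_at_least)
        fix ts M xs
        assume M: "M \<in> Md" and c: "cond (carrier M) (zip xs ts)"
        have "generically (carrier M) (zip xs ts) (\<lambda>g. push M g \<in> X) \<longleftrightarrow>
           generically (carrier M) (zip xs ts) (\<lambda>g. {..<n} \<subseteq> carrier M)"
          by (rule generically_cong) (rule eq[OF M])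
        then show "generically (carrier M) (zip xs ts) (\<lambda>g. push M g \<in> X) \<longleftrightarrow> sat M (at_least n) xs"
          using generically_const[OF MdD(2)[OF M] c] sat_at_least[OF MdD(1)[OF M]] by simp
      qed
      ultimately show ?thesis by blast
    next
      case R
      have eq: "push M g \<in> X \<longleftrightarrow> a \<in> lists (carrier M) \<and> a \<in> rel (push M g) R"
        if "M \<in> Md" "g \<in> perms (carrier M)" for M g
        using push_perm[OF that] R by (simp del: carrier_push)
      have pushR: "a \<in> rel (push M g) R \<longleftrightarrow> r \<in> rel M R"
        if "M \<in> Md" "g \<in> perms (carrier M)" "r \<in> lists (carrier M)" "map g r = a" for M g r
        using rel_push[OF MdD(3)[OF that(1)] permsD(3)[OF that(2)] that(3), of R] that(4) by simp
      have dec: "decided (carrier M) (\<lambda>g. a \<in> lists (carrier M) \<and> a \<in> rel (push M g) R)" if M: "M \<in> Md" for M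
      proof (rule decided_I)
        fix p assume p: "cond (carrier M) p"
        show "\<exists>q. cond (carrier M) q \<and> set p \<subseteq> set q \<and>
          ((\<forall>g\<in>perms (carrier M). agrees g q \<longrightarrow> a \<in> lists (carrier M) \<and> a \<in> rel (push M g) R) \<or>
           (\<forall>g\<in>perms (carrier M). agrees g q \<longrightarrow> \<not> (a \<in> lists (carrier M) \<and> a \<in> rel (push M g) R)))"
        proof (cases "a \<in> lists (carrier M)")
          case True
          obtain r where r: "length r = length a" "cond (carrier M) (zip r a @ p)"
            using extend_ran_list[OF MdD(2)[OF M] p True] by blast
          have "cond (carrier M) (zip r a)" using r(2) by (rule cond_subset) simp
          then have rl: "r \<in> lists (carrier M)" using cond_lists[OF r(1)] by blast
          have "a \<in> rel (push M g) R \<longleftrightarrow> r \<in> rel M R"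
            if "g \<in> perms (carrier M)" "agrees g (zip r a @ p)" for g
            using pushR[OF M that(1) rl] that(2) agrees_zip[OF r(1)] by (simp add: agrees_append)
          with r(2) True show ?thesis by (intro exI[of _ "zip r a @ p"]) auto
        next
          case False
          with p show ?thesis by blast
        qed
      qed
      have "decided (carrier M) (\<lambda>g. push M g \<in> X)" if M: "M \<in> Md" for M
        by (rule iffD2[OF decided_cong[OF eq[OF M]]], assumption, rule dec[OF M])
      moreover have "K (\<lambda>M p. generically (carrier M) p (\<lambda>g. push M g \<in> X))"
      proof (rule KI[of "\<lambda>ts. And (contains a)
          (Foralls (length a) (Imp (matches (a @ ts)) (Atom R [0..<length a])))"])
        show "wff L (And (contains a)
          (Foralls (length a) (Imp (matches (a @ ts)) (Atom R [0..<length a])))) (length ts)" for ts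
          using R(1) by (simp add: wff_contains wff_matches subset_iff)
        fix ts M xs
        assume M: "M \<in> Md" and xs: "xs \<in> lists (carrier M)" "length xs = length ts"
          and c: "cond (carrier M) (zip xs ts)"
        note S = MdD(2)[OF M]
        have "sat M (And (contains a)
          (Foralls (length a) (Imp (matches (a @ ts)) (Atom R [0..<length a])))) xs \<longleftrightarrow>
          a \<in> lists (carrier M) \<and> (\<forall>ys\<in>lists (carrier M). length ys = length a \<longrightarrow>
            cond (carrier M) (zip ys a @ zip xs ts) \<longrightarrow> ys \<in> rel M R)"
        proof -
          have "sat M (Imp (matches (a @ ts)) (Atom R [0..<length a])) (ys @ xs) \<longleftrightarrow>
              (cond (carrier M) (zip ys a @ zip xs ts) \<longrightarrow> ys \<in> rel M R)"
            if ys: "ys \<in> lists (carrier M)" "length ys = length a" for ys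
          proof -
            have "map ((!) (ys @ xs)) [0..<length a] = ys"
              using ys(2) by (intro nth_equalityI) (auto simp: nth_append)
            moreover have "sat M (matches (a @ ts)) (ys @ xs) \<longleftrightarrow> cond (carrier M) (zip ys a @ zip xs ts)"
              using sat_matches[OF MdD(1)[OF M], of "ys @ xs" "a @ ts"] ys xs by simp
            ultimately show ?thesis by simp
          qed
          then show ?thesis unfolding sat_And sat_contains[OF MdD(1)[OF M]] sat_Foralls by blast
        qed
        also have "\<dots> \<longleftrightarrow> generically (carrier M) (zip xs ts)
            (\<lambda>g. a \<in> lists (carrier M) \<and> a \<in> rel (push M g) R)"
        proof
          assume *: "a \<in> lists (carrier M) \<and> (\<forall>ys\<in>lists (carrier M). length ys = length a \<longrightarrow>
            cond (carrier M) (zip ys a @ zip xs ts) \<longrightarrow> ys \<in> rel M R)"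
          show "generically (carrier M) (zip xs ts)
            (\<lambda>g. a \<in> lists (carrier M) \<and> a \<in> rel (push M g) R)"
          proof (rule generically_I)
            fix g assume g: "g \<in> perms (carrier M)" "agrees g (zip xs ts)"
            have "a \<in> lists (g ` carrier M)" using * permsD(2)[OF g(1)] by simp
            then obtain ys where ys: "ys \<in> lists (carrier M)" "a = map g ys" unfolding lists_image by blast
            have len: "length ys = length a" using ys by simp
            have ag: "agrees g (zip ys a @ zip xs ts)"
              using g(2) agrees_zip[OF len, of g] ys by (simp add: agrees_append)
            have "set ys \<subseteq> carrier M" "set xs \<subseteq> carrier M" using ys xs by (auto simp: lists_eq_set)
            then have "fst ` set (zip ys a @ zip xs ts) \<subseteq> carrier M"
              by (auto dest: set_zip_leftD)
            with ag have "cond (carrier M) (zip ys a @ zip xs ts)" by (intro agrees_cond[OF g(1)])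
            then have "ys \<in> rel M R" using * ys(1) len by blast
            then show "a \<in> lists (carrier M) \<and> a \<in> rel (push M g) R"
              using * pushR[OF M g(1) ys(1) ys(2)[symmetric]] by blast
          qed
        next
          assume g: "generically (carrier M) (zip xs ts)
            (\<lambda>g. a \<in> lists (carrier M) \<and> a \<in> rel (push M g) R)"
          have "ys \<in> rel M R" if ys: "ys \<in> lists (carrier M)" "length ys = length a"
            and c: "cond (carrier M) (zip ys a @ zip xs ts)" for ys
          proof -
            have "generically (carrier M) (zip ys a @ zip xs ts)
                (\<lambda>g. a \<in> lists (carrier M) \<and> a \<in> rel (push M g) R)"
              using g by (rule generically_subset) simp
            from generically_ex[OF S c this] obtain g where g: "g \<in> perms (carrier M)"
              "agrees g (zip ys a @ zip xs ts)" "a \<in> rel (push M g) R" by blast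
            have "map g ys = a" using g(2) agrees_zip[OF ys(2)] by (simp add: agrees_append)
            from pushR[OF M g(1) ys(1) this] g(3) show ?thesis by blast
          qed
          with generically_ex[OF S c g]
          show "a \<in> lists (carrier M) \<and> (\<forall>ys\<in>lists (carrier M). length ys = length a \<longrightarrow>
            cond (carrier M) (zip ys a @ zip xs ts) \<longrightarrow> ys \<in> rel M R)" by blast
        qed
        also have "\<dots> \<longleftrightarrow> generically (carrier M) (zip xs ts) (\<lambda>g. push M g \<in> X)"
          by (rule generically_cong) (rule eq[OF M, symmetric])
        finally show "generically (carrier M) (zip xs ts) (\<lambda>g. push M g \<in> X) \<longleftrightarrow>
          sat M (And (contains a) (Foralls (length a) (Imp (matches (a @ ts)) (Atom R [0..<length a])))) xs"
          by simp
      qed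
      ultimately show ?thesis by blast
    qed
  qed
  then show ?thesis unfolding K_def by blast
qed

text \<open>
If \<open>Q\<close> is invariant, then moving \<open>xs\<close> to \<open>ts\<close> by a permutation turns \<open>Q M xs\<close> into membership of the permuted
model in the Borel set of those \<open>N\<close> with \<open>Q N ts\<close>, whichever permutation is chosen.  So \<open>Q M xs\<close> holds if and only
if, for some \<open>ts\<close>, this happens for comeagerly many permutations.
\<close>

theorem lopez_escobar:
  assumes Borel: "\<And>xs. length xs = n \<Longrightarrow> {M \<in> Md. xs \<in> lists (carrier M) \<and> Q M xs} \<in> sets MdB"
    and inv: "\<And>f xs. f \<in> Arr L T \<Longrightarrow> xs \<in> lists (carrier (src f)) \<Longrightarrow> length xs = n \<Longrightarrow>
       Q (src f) xs \<longleftrightarrow> Q (trg f) (map (fun_of f) xs)"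
  shows "\<exists>\<phi>. wff L \<phi> n \<and> (\<forall>M\<in>Md. \<forall>xs\<in>lists (carrier M). length xs = n \<longrightarrow> (sat M \<phi> xs \<longleftrightarrow> Q M xs))"
proof -
  define B where "B ts = {M \<in> Md. ts \<in> lists (carrier M) \<and> Q M ts}" for ts
  have "\<forall>ts. \<exists>\<phi>. length ts = n \<longrightarrow> wff L \<phi> (length ts) \<and> (\<forall>M\<in>Md. \<forall>xs\<in>lists (carrier M). length xs = length ts \<longrightarrow>
    cond (carrier M) (zip xs ts) \<longrightarrow>
    (generically (carrier M) (zip xs ts) (\<lambda>g. push M g \<in> B ts) \<longleftrightarrow> sat M \<phi> xs))"
    using vaught_formula[OF Borel] unfolding B_def by blast
  from choice[OF this] obtain \<phi> where \<phi>: "\<forall>ts. length ts = n \<longrightarrow> wff L (\<phi> ts) (length ts) \<and>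
    (\<forall>M\<in>Md. \<forall>xs\<in>lists (carrier M). length xs = length ts \<longrightarrow>
    cond (carrier M) (zip xs ts) \<longrightarrow>
    (generically (carrier M) (zip xs ts) (\<lambda>g. push M g \<in> B ts) \<longleftrightarrow> sat M (\<phi> ts) xs))" ..
  define \<theta> where "\<theta> = Disj {m. length (from_nat m :: nat list) = n}
    (\<lambda>m. And (matches (from_nat m)) (\<phi> (from_nat m)))"
  have "wff L \<theta> n" using \<phi> by (auto simp: \<theta>_def wff_matches)
  moreover have "sat M \<theta> xs \<longleftrightarrow> Q M xs" if M: "M \<in> Md" and xs: "xs \<in> lists (carrier M)" "length xs = n" for M xs
  proof -
    \<comment> \<open>For fixed \<open>xs\<close> and \<open>ts\<close>, the answer does not depend on the permutation.\<close>
    have pushQ: "push M g \<in> B ts \<longleftrightarrow> Q M xs" if g: "g \<in> perms (carrier M)" "agrees g (zip xs ts)" "length ts = n" for g ts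
    proof -
      have m: "map g xs = ts" using g(2,3) xs agrees_zip by metis
      have "ts \<in> lists (carrier M)" unfolding m[symmetric] using xs(1) permsD(5)[OF g(1)] by auto
      then show ?thesis
        using inv[OF arrow_in_Arr[OF M g(1)], of xs] xs push_perm[OF M g(1)] m
        by (simp add: B_def del: carrier_push)
    qed
    have "sat M \<theta> xs \<longleftrightarrow> (\<exists>ts. length ts = n \<and> sat M (matches ts) xs \<and> sat M (\<phi> ts) xs)"
      by (simp add: \<theta>_def) (metis from_nat_to_nat)
    also have "\<dots> \<longleftrightarrow> (\<exists>ts. length ts = n \<and> cond (carrier M) (zip xs ts) \<and>
        generically (carrier M) (zip xs ts) (\<lambda>g. push M g \<in> B ts))"
      using \<phi> M xs sat_matches[OF MdD(1)[OF M] _ xs(1)] by metis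
    also have "\<dots> \<longleftrightarrow> Q M xs"
    proof
      assume "\<exists>ts. length ts = n \<and> cond (carrier M) (zip xs ts) \<and>
        generically (carrier M) (zip xs ts) (\<lambda>g. push M g \<in> B ts)"
      then obtain ts where ts: "length ts = n" "cond (carrier M) (zip xs ts)"
        "generically (carrier M) (zip xs ts) (\<lambda>g. push M g \<in> B ts)" by blast
      from generically_ex[OF MdD(2)[OF M] ts(2,3)] pushQ ts(1) show "Q M xs" by blast
    next
      assume Q: "Q M xs"
      \<comment> \<open>The tuple of values can be chosen as \<open>xs\<close> itself.\<close>
      have "cond (carrier M) (zip xs xs)" using xs(1) by (auto simp: cond_def zip_same lists_eq_set)
      moreover have "generically (carrier M) (zip xs xs) (\<lambda>g. push M g \<in> B xs)"
        by (rule generically_I) (use pushQ Q xs in blast)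
      ultimately show "\<exists>ts. length ts = n \<and> cond (carrier M) (zip xs ts) \<and>
        generically (carrier M) (zip xs ts) (\<lambda>g. push M g \<in> B ts)" using xs(2) by blast
    qed
    finally show ?thesis .
  qed
  ultimately show ?thesis by blast
qed

end

section \<open>The groupoid of models\<close>

text \<open>
The source and the target of an isomorphism between models on initial segments have the same underlying
set, whence the domain of the inverse.
\<close>

definition inv_arr :: "'r arrow \<Rightarrow> 'r arrow" where
  "inv_arr f = \<lparr>src = trg f, trg = src f,
     fun_of = restrict (inv_into (carrier (src f)) (fun_of f)) (carrier (src f))\<rparr>"

lemma comp_arr_simps [simp]: "src (comp_arr h f) = src f" "trg (comp_arr h f) = trg h"
  "fun_of (comp_arr h f) = compose (carrier (src f)) (fun_of h) (fun_of f)"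
  by (simp_all add: comp_arr_def)

lemma id_arr_simps [simp]: "src (id_arr M) = M" "trg (id_arr M) = M"
  "fun_of (id_arr M) = restrict (\<lambda>a. a) (carrier M)"
  by (simp_all add: id_arr_def)

lemma inv_arr_ends [simp]: "src (inv_arr f) = trg f" "trg (inv_arr f) = src f"
  by (simp_all add: inv_arr_def)

context models
begin

lemma fun_of_in: "f \<in> Arr L T \<Longrightarrow> a \<in> carrier (src f) \<Longrightarrow> fun_of f a \<in> carrier (src f)"
  using permsD(5)[OF ArrD(4)] .

lemma fun_of_eq_iff:
  "f \<in> Arr L T \<Longrightarrow> a \<in> carrier (src f) \<Longrightarrow> b \<in> carrier (src f) \<Longrightarrow> fun_of f a = fun_of f b \<longleftrightarrow> a = b"
  using inj_on_eq_iff[OF permsD(3)[OF ArrD(4)]] .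

lemma arrow_eqI:
  assumes "f \<in> Arr L T" "h \<in> Arr L T" "src f = src h" "trg f = trg h"
    "\<And>a. a \<in> carrier (src f) \<Longrightarrow> fun_of f a = fun_of h a"
  shows "f = h"
proof (rule arrow.equality)
  show "fun_of f = fun_of h"
    using permsD(4)[OF ArrD(4)[OF assms(1)]] permsD(4)[OF ArrD(4)[OF assms(2)]] assms(3,5)
    by (intro extensionalityI[of _ "carrier (src f)"]) simp_all
qed (use assms in simp_all)

lemma id_in_Arr: "M \<in> Md \<Longrightarrow> id_arr M \<in> Arr L T"
  by (auto simp: Arr_def map_idI lists_eq_set subset_iff bij_betw_def inj_on_def)

lemma comp_in_Arr:
  assumes f: "f \<in> Arr L T" and h: "h \<in> Arr L T" and e: "src h = trg f"
  shows "comp_arr h f \<in> Arr L T"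
proof -
  let ?S = "carrier (src f)"
  have S: "carrier (src h) = ?S" "carrier (trg h) = ?S" using ArrD(3)[OF f] ArrD(3)[OF h] e by simp_all
  have b: "bij_betw (fun_of f) ?S ?S" "bij_betw (fun_of h) ?S ?S"
    using permsD(1)[OF ArrD(4)[OF f]] permsD(1)[OF ArrD(4)[OF h]] S by simp_all
  have "bij_betw (compose ?S (fun_of h) (fun_of f)) ?S ?S"
    using b by (rule bij_betw_compose)
  moreover have "a \<in> rel (src f) R \<longleftrightarrow> map (compose ?S (fun_of h) (fun_of f)) a \<in> rel (trg h) R"
    if a: "a \<in> lists ?S" for a R
  proof -
    have l: "map (fun_of f) a \<in> lists ?S" using a fun_of_in[OF f] by auto
    have m: "map (compose ?S (fun_of h) (fun_of f)) a = map (fun_of h) (map (fun_of f) a)"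
      using a by (auto simp: compose_def)
    have "map (fun_of f) a \<in> rel (src h) R \<longleftrightarrow> map (fun_of h) (map (fun_of f) a) \<in> rel (trg h) R"
      by (rule ArrD(6)[OF h]) (use l S in simp)
    then show ?thesis unfolding m using ArrD(6)[OF f a, of R] e by simp
  qed
  ultimately show ?thesis
    using ArrD(1)[OF f] ArrD(2)[OF h] S by (simp add: Arr_def)
qed

lemma inv_in_Arr:
  assumes f: "f \<in> Arr L T"
  shows "inv_arr f \<in> Arr L T"
proof -
  let ?S = "carrier (src f)" and ?g = "inv_into (carrier (src f)) (fun_of f)"
  have S: "carrier (trg f) = ?S" using ArrD(3)[OF f] .
  have b: "bij_betw (fun_of f) ?S ?S" using permsD(1)[OF ArrD(4)[OF f]] .
  have g: "bij_betw ?g ?S ?S" using b by (rule bij_betw_inv_into)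
  have "bij_betw (restrict ?g ?S) ?S ?S \<longleftrightarrow> bij_betw ?g ?S ?S" by (rule bij_betw_cong) simp
  moreover have "a \<in> rel (trg f) R \<longleftrightarrow> map (restrict ?g ?S) a \<in> rel (src f) R" if a: "a \<in> lists ?S" for a R
  proof -
    have l: "map ?g a \<in> lists ?S" using a bij_betw_apply[OF g] by auto
    have m: "map (fun_of f) (map ?g a) = a"
      using a bij_betw_inv_into_right[OF b] by (auto intro!: map_idI)
    have m': "map (restrict ?g ?S) a = map ?g a" using a by auto
    show ?thesis unfolding m' using ArrD(6)[OF f l, of R, unfolded m] by simp
  qed
  ultimately show ?thesis using ArrD(1,2)[OF f] S g by (simp add: Arr_def inv_arr_def)
qed

lemma inv_arr_apply:
  assumes f: "f \<in> Arr L T" and a: "a \<in> carrier (src f)" and b: "b \<in> carrier (src f)"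
  shows "fun_of (inv_arr f) b = a \<longleftrightarrow> fun_of f a = b"
  using bij_betw_inv_into_left[OF permsD(1)[OF ArrD(4)[OF f]] a]
    bij_betw_inv_into_right[OF permsD(1)[OF ArrD(4)[OF f]] b] b by (auto simp: inv_arr_def)

lemma map_inv_arr:
  assumes f: "f \<in> Arr L T" and xs: "xs \<in> lists (carrier (src f))"
  shows "map (fun_of (inv_arr f)) (map (fun_of f) xs) = xs"
proof -
  have "fun_of (inv_arr f) (fun_of f x) = x" if "x \<in> carrier (src f)" for x
    using inv_arr_apply[OF f that fun_of_in[OF f that]] by simp
  then show ?thesis using xs by (auto intro!: map_idI)
qed

lemma comp_inv_left: 
  assumes f: "f \<in> Arr L T"
  shows "comp_arr (inv_arr f) f = id_arr (src f)"
proof (rule arrow_eqI)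
  fix a assume "a \<in> carrier (src (comp_arr (inv_arr f) f))"
  then have a: "a \<in> carrier (src f)" by simp
  have "fun_of (inv_arr f) (fun_of f a) = a" using inv_arr_apply[OF f a fun_of_in[OF f a]] by simp
  with a show "fun_of (comp_arr (inv_arr f) f) a = fun_of (id_arr (src f)) a" by (simp add: compose_def)
qed (use f comp_in_Arr inv_in_Arr id_in_Arr ArrD in auto)

lemma comp_arrow:
  assumes f: "f \<in> Arr L T" and g: "g \<in> perms (carrier (src f))"
  shows "comp_arr (arrow (trg f) g) f = arrow (src f) (restrict (g \<circ> fun_of f) (carrier (src f)))"
proof -
  have "arrow (trg f) g \<in> Arr L T" using arrow_in_Arr[OF ArrD(2)[OF f]] g ArrD(3)[OF f] by simp
  from ArrD(5)[OF comp_in_Arr[OF f this]]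
  show ?thesis by (simp add: compose_def comp_def)
qed

section \<open>Measurability of the groupoid operations\<close>

lemma fun_sets: "{f \<in> Arr L T. a \<in> carrier (src f) \<and> fun_of f a = b} \<in> sets (ArrB L T)"
proof -
  have "{f \<in> Arr L T. a \<in> carrier (src f) \<and> fun_of f a = b} =
    {f \<in> Arr L T. a \<in> carrier (src f) \<and> b \<in> carrier (src f) \<and> fun_of f a = b}"
    using fun_of_in by blast
  then show ?thesis unfolding sets_ArrB by (intro sigma_sets.Basic) blast
qed

lemma src_measurable: "src \<in> ArrB L T \<rightarrow>\<^sub>M MdB"
proof (rule measurableI)
  fix B assume "B \<in> sets MdB"
  then have "{f \<in> Arr L T. src f \<in> B} \<in> sets (ArrB L T)"
    unfolding sets_ArrB by (intro sigma_sets.Basic) blast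
  then show "src -` B \<inter> space (ArrB L T) \<in> sets (ArrB L T)" by (simp add: vimage_def Int_def conj_commute)
qed (simp add: ArrD)

lemma measurable_ModB_I:
  assumes "\<And>x. x \<in> space X \<Longrightarrow> f x \<in> Md"
    and "\<And>a. {x \<in> space X. a \<in> carrier (f x)} \<in> sets X"
    and "\<And>R a. {x \<in> space X. a \<in> rel (f x) R} \<in> sets X"
  shows "f \<in> X \<rightarrow>\<^sub>M MdB"
proof (rule measurable_sigma_sets[OF sets_ModB])
  show "f \<in> space X \<rightarrow> Md" using assms(1) by auto
  fix B assume "B \<in> {{M \<in> Mod L T. infinite (carrier M) \<or> n \<le> card (carrier M)} | n. True} \<union>
      {{M \<in> Mod L T. a \<in> lists (carrier M) \<and> a \<in> rel M R} | R a. L R = Some (length a)}"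
  then consider (C) n where "B = {M \<in> Mod L T. infinite (carrier M) \<or> n \<le> card (carrier M)}"
      | (R) a R where "B = {M \<in> Mod L T. a \<in> lists (carrier M) \<and> a \<in> rel M R}"
    by blast
  then show "f -` B \<inter> space X \<in> sets X"
  proof cases
    case C
    have "f x \<in> B \<longleftrightarrow> (\<forall>a\<in>{..<n}. a \<in> carrier (f x))" if "x \<in> space X" for x
      using init_seg_card[OF MdD(1)[OF assms(1)[OF that]]] assms(1)[OF that] C by auto
    then have "f -` B \<inter> space X = {x \<in> space X. \<forall>a\<in>{..<n}. a \<in> carrier (f x)}" by auto
    also have "\<dots> \<in> sets X" by (intro sets.sets_Collect_finite_All assms) simp
    finally show ?thesis .
  next
    case R
    have "f x \<in> B \<longleftrightarrow> a \<in> rel (f x) R" if "x \<in> space X" for x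
      using relD[OF assms(1)[OF that]] assms(1)[OF that] R by blast
    then have "f -` B \<inter> space X = {x \<in> space X. a \<in> rel (f x) R}" by auto
    then show ?thesis using assms(3) by simp
  qed
qed (auto)

lemma measurable_ArrB_I:
  assumes "\<And>x. x \<in> space X \<Longrightarrow> f x \<in> Arr L T"
    and "(\<lambda>x. src (f x)) \<in> X \<rightarrow>\<^sub>M MdB"
    and "\<And>a b. {x \<in> space X. a \<in> carrier (src (f x)) \<and> fun_of (f x) a = b} \<in> sets X"
  shows "f \<in> X \<rightarrow>\<^sub>M ArrB L T"
proof (rule measurable_sigma_sets[OF sets_ArrB])
  show "f \<in> space X \<rightarrow> Arr L T" using assms(1) by auto
  fix B assume "B \<in> {{f \<in> Arr L T. src f \<in> B} | B. B \<in> sets (ModB L T)} \<union>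
      {{f \<in> Arr L T. a \<in> carrier (src f) \<and> b \<in> carrier (src f) \<and> fun_of f a = b} | a b. True}"
  then consider (S) C where "C \<in> sets MdB" "B = {f \<in> Arr L T. src f \<in> C}"
    | (F) a b where "B = {f \<in> Arr L T. a \<in> carrier (src f) \<and> b \<in> carrier (src f) \<and> fun_of f a = b}"
    by blast
  then show "f -` B \<inter> space X \<in> sets X"
  proof cases
    case S
    have "f -` B \<inter> space X = (\<lambda>x. src (f x)) -` C \<inter> space X" using S(2) assms(1) by auto
    then show ?thesis using measurable_sets[OF assms(2) S(1)] by simp
  next
    case F
    have "f x \<in> B \<longleftrightarrow> a \<in> carrier (src (f x)) \<and> fun_of (f x) a = b" if "x \<in> space X" for x
      using fun_of_in[OF assms(1)[OF that]] assms(1)[OF that] F by blast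
    then have "f -` B \<inter> space X = {x \<in> space X. a \<in> carrier (src (f x)) \<and> fun_of (f x) a = b}" by blast
    then show ?thesis using assms(3) by simp
  qed
qed auto

lemma trg_measurable: "trg \<in> ArrB L T \<rightarrow>\<^sub>M MdB"
proof (rule measurable_ModB_I)
  show "trg f \<in> Md" if "f \<in> space (ArrB L T)" for f using ArrD(2) that by simp
  have car: "{f \<in> space (ArrB L T). a \<in> carrier (src f)} \<in> sets (ArrB L T)" for a
    using measurable_sets[OF src_measurable carrier_sets[of a]] ArrD(1)
    by (simp add: vimage_def Int_def) (metis (no_types, lifting) Collect_cong)
  show "{f \<in> space (ArrB L T). a \<in> carrier (trg f)} \<in> sets (ArrB L T)" for a
  proof -
    have "{f \<in> space (ArrB L T). a \<in> carrier (trg f)} = {f \<in> space (ArrB L T). a \<in> carrier (src f)}"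
      using ArrD(3) by auto
    with car show ?thesis by simp
  qed
  show "{f \<in> space (ArrB L T). a \<in> rel (trg f) R} \<in> sets (ArrB L T)" for a R
  proof -
    have eq: "a \<in> rel (trg f) R \<longleftrightarrow> (\<exists>b. b \<in> rel (src f) R \<and> length b = length a \<and>
       (\<forall>i\<in>{..<length a}. b ! i \<in> carrier (src f) \<and> fun_of f (b ! i) = a ! i))" if f: "f \<in> Arr L T" for f
    proof
      assume a: "a \<in> rel (trg f) R"
      have "a \<in> lists (fun_of f ` carrier (src f))"
        using relD[OF ArrD(2)[OF f] a] ArrD(3)[OF f] permsD(2)[OF ArrD(4)[OF f]] by simp
      then obtain b where b: "b \<in> lists (carrier (src f))" "a = map (fun_of f) b" unfolding lists_image by blast
      then have "b \<in> rel (src f) R" using ArrD(6)[OF f b(1)] a by simp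
      with b show "\<exists>b. b \<in> rel (src f) R \<and> length b = length a \<and>
       (\<forall>i\<in>{..<length a}. b ! i \<in> carrier (src f) \<and> fun_of f (b ! i) = a ! i)"
        by (intro exI[of _ b]) (simp add: in_lists_nth del: in_lists_conv_set)
    next
      assume "\<exists>b. b \<in> rel (src f) R \<and> length b = length a \<and>
       (\<forall>i\<in>{..<length a}. b ! i \<in> carrier (src f) \<and> fun_of f (b ! i) = a ! i)"
      then obtain b where b: "b \<in> rel (src f) R" "length b = length a"
        "\<forall>i\<in>{..<length a}. b ! i \<in> carrier (src f) \<and> fun_of f (b ! i) = a ! i" by blast
      have "map (fun_of f) b = a" using b(2,3) by (intro nth_equalityI) auto
      with ArrD(6)[OF f conjunct1[OF relD[OF ArrD(1)[OF f] b(1)]]] b(1)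
      show "a \<in> rel (trg f) R" by simp
    qed
    have "{f \<in> space (ArrB L T). a \<in> rel (trg f) R} = {f \<in> space (ArrB L T). \<exists>b. b \<in> rel (src f) R \<and> length b = length a \<and>
       (\<forall>i\<in>{..<length a}. b ! i \<in> carrier (src f) \<and> fun_of f (b ! i) = a ! i)}"
      by (intro Collect_cong conj_cong refl) (simp only: space_ArrB eq)
    also have "\<dots> \<in> sets (ArrB L T)"
    proof (rule sets.sets_Collect_countable_Ex)
      fix b
      have "{f \<in> space (ArrB L T). b \<in> rel (src f) R} = src -` {M \<in> Md. b \<in> rel M R} \<inter> space (ArrB L T)"
        using ArrD(1) by auto
      then have 1: "{f \<in> space (ArrB L T). b \<in> rel (src f) R} \<in> sets (ArrB L T)"
        using measurable_sets[OF src_measurable rel_sets[of b R]] by simp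
      have 2: "{f \<in> space (ArrB L T). \<forall>i\<in>{..<length a}. b ! i \<in> carrier (src f) \<and> fun_of f (b ! i) = a ! i} \<in> sets (ArrB L T)"
        by (rule sets.sets_Collect_finite_All) (use fun_sets in simp_all)
      show "{f \<in> space (ArrB L T). b \<in> rel (src f) R \<and> length b = length a \<and>
         (\<forall>i\<in>{..<length a}. b ! i \<in> carrier (src f) \<and> fun_of f (b ! i) = a ! i)} \<in> sets (ArrB L T)"
        by (intro sets.sets_Collect_conj 1 2 sets.sets_Collect_const)
    qed
    finally show ?thesis .
  qed
qed

lemma inv_arr_measurable: "inv_arr \<in> ArrB L T \<rightarrow>\<^sub>M ArrB L T"
proof (rule measurable_ArrB_I)
  show "inv_arr f \<in> Arr L T" if "f \<in> space (ArrB L T)" for f using inv_in_Arr that by simp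
  show "(\<lambda>f. src (inv_arr f)) \<in> ArrB L T \<rightarrow>\<^sub>M MdB" using trg_measurable by simp
  fix a b
  have eq: "a \<in> carrier (src (inv_arr f)) \<and> fun_of (inv_arr f) a = b \<longleftrightarrow>
    b \<in> carrier (src f) \<and> fun_of f b = a" if "f \<in> Arr L T" for f
    using inv_arr_apply[OF that, of b a] fun_of_in[OF that, of b] ArrD(3)[OF that]
      fun_of_in[OF inv_in_Arr[OF that], of a] by auto
  have "{f \<in> space (ArrB L T). a \<in> carrier (src (inv_arr f)) \<and> fun_of (inv_arr f) a = b} =
    {f \<in> Arr L T. b \<in> carrier (src f) \<and> fun_of f b = a}"
    unfolding space_ArrB by (rule Collect_cong, rule conj_cong[OF refl], rule eq)
  then show "{f \<in> space (ArrB L T). a \<in> carrier (src (inv_arr f)) \<and> fun_of (inv_arr f) a = b} \<in> sets (ArrB L T)"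
    using fun_sets by simp
qed

lemma measurable_fun_sets:
  assumes "f \<in> X \<rightarrow>\<^sub>M ArrB L T"
  shows "{x \<in> space X. a \<in> carrier (src (f x)) \<and> fun_of (f x) a = b} \<in> sets X"
proof -
  have "{x \<in> space X. a \<in> carrier (src (f x)) \<and> fun_of (f x) a = b} =
    f -` {f \<in> Arr L T. a \<in> carrier (src f) \<and> fun_of f a = b} \<inter> space X"
    using measurable_space[OF assms] by auto
  then show ?thesis using measurable_sets[OF assms fun_sets] by simp
qed

lemma comp_arr_measurable:
  assumes f: "f \<in> X \<rightarrow>\<^sub>M ArrB L T" and h: "h \<in> X \<rightarrow>\<^sub>M ArrB L T"
    and e: "\<And>x. x \<in> space X \<Longrightarrow> src (h x) = trg (f x)"
  shows "(\<lambda>x. comp_arr (h x) (f x)) \<in> X \<rightarrow>\<^sub>M ArrB L T"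
proof (rule measurable_ArrB_I)
  have fA: "f x \<in> Arr L T" and hA: "h x \<in> Arr L T" if "x \<in> space X" for x
    using measurable_space[OF f that] measurable_space[OF h that] by simp_all
  show "comp_arr (h x) (f x) \<in> Arr L T" if "x \<in> space X" for x
    using comp_in_Arr fA hA e that by blast
  show "(\<lambda>x. src (comp_arr (h x) (f x))) \<in> X \<rightarrow>\<^sub>M MdB"
    using measurable_compose[OF f src_measurable] by simp
  fix a b
  have eq: "a \<in> carrier (src (comp_arr (h x) (f x))) \<and> fun_of (comp_arr (h x) (f x)) a = b \<longleftrightarrow>
    (\<exists>c. (a \<in> carrier (src (f x)) \<and> fun_of (f x) a = c) \<and> (c \<in> carrier (src (h x)) \<and> fun_of (h x) c = b))"
    if "x \<in> space X" for x
    using fun_of_in[OF fA[OF that], of a] ArrD(3)[OF fA[OF that]] e[OF that] by (auto simp: compose_def)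
  have "{x \<in> space X. a \<in> carrier (src (comp_arr (h x) (f x))) \<and> fun_of (comp_arr (h x) (f x)) a = b} =
    {x \<in> space X. \<exists>c. (a \<in> carrier (src (f x)) \<and> fun_of (f x) a = c) \<and> (c \<in> carrier (src (h x)) \<and> fun_of (h x) c = b)}"
    by (intro Collect_cong conj_cong refl eq)
  also have "\<dots> \<in> sets X"
    by (intro sets.sets_Collect_countable_Ex sets.sets_Collect_conj[OF measurable_fun_sets measurable_fun_sets] f h)
  finally show "{x \<in> space X. a \<in> carrier (src (comp_arr (h x) (f x))) \<and> fun_of (comp_arr (h x) (f x)) a = b} \<in> sets X" .
qed

end

section \<open>Names for the elements of the values of a Borel functor\<close>

lemma concat_map_unique:
  assumes "concat xss = concat yss" "map length xss = map length yss"
  shows "xss = yss"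
  using assms
proof (induction xss arbitrary: yss)
  case (Cons xs xss)
  then obtain ys yss' where y: "yss = ys # yss'" "length xs = length ys" "map length xss = map length yss'" by auto
  with Cons.prems(1) have "xs = ys" "concat xss = concat yss'" by auto
  with Cons.IH y show ?case by auto
qed simp

locale functor_setting = Q: models L' T' + R: models L T
  for L' :: "'q language" and T' :: "'q fm set" and L :: "'r language" and T :: "'r fm set" +
  fixes G :: "('q, 'r) gfunctor"
  assumes G_functor: "borel_functor L' T' L T G"
begin

abbreviation "Ob \<equiv> on_obj G"

definition arr_map :: "'q arrow \<Rightarrow> nat \<Rightarrow> nat" where
  "arr_map f = fun_of (on_arr G f)"

lemma Ob_measurable: "Ob \<in> ModB L' T' \<rightarrow>\<^sub>M ModB L T"
  using G_functor by (simp add: borel_functor_def)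

lemma on_arr_measurable: "on_arr G \<in> ArrB L' T' \<rightarrow>\<^sub>M ArrB L T"
  using G_functor by (simp add: borel_functor_def)

lemma Ob_in: "M \<in> Mod L' T' \<Longrightarrow> Ob M \<in> Mod L T"
  using measurable_space[OF Ob_measurable] by simp

lemma on_arr_in: "f \<in> Arr L' T' \<Longrightarrow> on_arr G f \<in> Arr L T"
  using measurable_space[OF on_arr_measurable] by simp

lemma on_arr_ends: "f \<in> Arr L' T' \<Longrightarrow> src (on_arr G f) = Ob (src f)" "f \<in> Arr L' T' \<Longrightarrow> trg (on_arr G f) = Ob (trg f)"
  using G_functor by (auto simp: borel_functor_def)

lemma Ob_carrier: "f \<in> Arr L' T' \<Longrightarrow> carrier (Ob (trg f)) = carrier (Ob (src f))"
  using R.ArrD(3)[OF on_arr_in] by (simp add: on_arr_ends)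

lemma arr_map_in: "f \<in> Arr L' T' \<Longrightarrow> a \<in> carrier (Ob (src f)) \<Longrightarrow> arr_map f a \<in> carrier (Ob (src f))"
  using R.fun_of_in[OF on_arr_in] by (simp add: on_arr_ends arr_map_def)

lemma arr_map_eq_iff: "f \<in> Arr L' T' \<Longrightarrow> a \<in> carrier (Ob (src f)) \<Longrightarrow> b \<in> carrier (Ob (src f)) \<Longrightarrow> arr_map f a = arr_map f b \<longleftrightarrow> a = b"
  using R.fun_of_eq_iff[OF on_arr_in] by (simp add: on_arr_ends arr_map_def)

lemma arr_map_id: "M \<in> Mod L' T' \<Longrightarrow> a \<in> carrier (Ob M) \<Longrightarrow> arr_map (id_arr M) a = a"
  using G_functor by (simp add: borel_functor_def arr_map_def)

lemma arr_map_comp: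
  "f \<in> Arr L' T' \<Longrightarrow> h \<in> Arr L' T' \<Longrightarrow> src h = trg f \<Longrightarrow> a \<in> carrier (Ob (src f)) \<Longrightarrow>
     arr_map (comp_arr h f) a = arr_map h (arr_map f a)"
  using G_functor by (simp add: borel_functor_def arr_map_def compose_def on_arr_ends)

lemma arr_map_inv: "f \<in> Arr L' T' \<Longrightarrow> a \<in> carrier (Ob (src f)) \<Longrightarrow> arr_map (inv_arr f) (arr_map f a) = a"
  using arr_map_comp[OF _ Q.inv_in_Arr, of f f a] Q.comp_inv_left[of f] arr_map_id[of "src f" a] Q.ArrD(1)
  by simp

text \<open>
A natural number \<open>i\<close> codes the pair of a tuple \<open>targets i\<close> and a number \<open>label i\<close>; it serves as an index of
the imaginary sort.
\<close>

definition targets :: "nat \<Rightarrow> nat list" where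
  "targets i = fst (from_nat i :: nat list \<times> nat)"

definition label :: "nat \<Rightarrow> nat" where
  "label i = snd (from_nat i :: nat list \<times> nat)"

text \<open>
The tuple \<open>snd pt\<close> with the index \<open>fst pt\<close> names \<open>a\<close> if comeagerly many permutations that send this tuple
to \<open>targets (fst pt)\<close> send, through the functor, \<open>a\<close> to \<open>label (fst pt)\<close>.
\<close>

definition denotes :: "('q, nat) rstruct \<Rightarrow> nat \<times> nat list \<Rightarrow> nat \<Rightarrow> bool" where
  "denotes M pt a \<longleftrightarrow> a \<in> carrier (Ob M) \<and> length (snd pt) = length (targets (fst pt)) \<and>
     cond (carrier M) (zip (snd pt) (targets (fst pt))) \<and>
     generically (carrier M) (zip (snd pt) (targets (fst pt))) (\<lambda>g. arr_map (arrow M g) a = label (fst pt))"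

lemma denotes_lists: "denotes M pt a \<Longrightarrow> snd pt \<in> lists (carrier M)"
  using cond_lists[of "snd pt" "targets (fst pt)" "carrier M"] by (simp add: denotes_def)

lemma denotes_unique:
  assumes M: "M \<in> Mod L' T'" and "denotes M pt a" "denotes M pt b"
  shows "a = b"
proof -
  let ?p = "zip (snd pt) (targets (fst pt))"
  have "generically (carrier M) ?p (\<lambda>g. arr_map (arrow M g) a = label (fst pt) \<and> arr_map (arrow M g) b = label (fst pt))"
    using assms by (intro generically_conj) (simp_all add: denotes_def)
  moreover have "cond (carrier M) ?p" using assms by (simp add: denotes_def)
  ultimately obtain g where g: "g \<in> perms (carrier M)" "arr_map (arrow M g) a = arr_map (arrow M g) b"
    using generically_ex[OF Q.MdD(2)[OF M], of ?p] by force
  have "arrow M g \<in> Arr L' T'" using Q.arrow_in_Arr[OF M g(1)] .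
  from arr_map_eq_iff[OF this] g(2) assms(2,3) show ?thesis by (simp add: denotes_def)
qed

definition graph :: "nat \<Rightarrow> nat \<Rightarrow> 'q arrow set" where
  "graph a k = {f \<in> Arr L' T'. a \<in> carrier (Ob (src f)) \<and> arr_map f a = k}"

lemma graph_sets: "graph a k \<in> sets (ArrB L' T')"
  using R.measurable_fun_sets[OF on_arr_measurable, of a k]
  by (simp add: graph_def arr_map_def on_arr_ends cong: conj_cong)

lemma graph_arrow:
  "M \<in> Mod L' T' \<Longrightarrow> a \<in> carrier (Ob M) \<Longrightarrow> g \<in> perms (carrier M) \<Longrightarrow> arrow M g \<in> graph a k \<longleftrightarrow> arr_map (arrow M g) a = k"
  using Q.arrow_in_Arr by (simp add: graph_def)

lemma decided_arr_map:
  assumes "M \<in> Mod L' T'" "a \<in> carrier (Ob M)"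
  shows "decided (carrier M) (\<lambda>g. arr_map (arrow M g) a = k)"
proof -
  have "decided (carrier M) (\<lambda>g. arrow M g \<in> graph a k) \<longleftrightarrow> decided (carrier M) (\<lambda>g. arr_map (arrow M g) a = k)"
    by (rule decided_cong) (rule graph_arrow[OF assms])
  then show ?thesis using Q.vaught_Borel[OF graph_sets[of a k]] assms(1) by blast
qed

text \<open>
The values \<open>k = G(g)(a)\<close> split the permutations into countably many sets with the Baire property, one of which
is comeager in some basic open set.
\<close>

lemma denotes_exists:
  assumes M: "M \<in> Mod L' T'" and a: "a \<in> carrier (Ob M)"
  shows "\<exists>pt. denotes M pt a"
proof -
  have nil: "cond (carrier M) []" by (simp add: cond_def)
  have "generically (carrier M) [] (\<lambda>g. \<exists>k. arr_map (arrow M g) a = k)" by (rule generically_I) simp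
  from nongeneric_split[OF Q.MdD(2)[OF M] decided_arr_map[OF M a] nil this]
  obtain r k where r: "cond (carrier M) r" "generically (carrier M) r (\<lambda>g. arr_map (arrow M g) a = k)" by auto
  \<comment> \<open>A condition \<open>r\<close> is split into the tuple of its arguments, which belongs to the name, and its values.\<close>
  define i where "i = to_nat (map snd r, k)"
  have "targets i = map snd r" "label i = k" by (simp_all add: targets_def label_def i_def)
  then have "denotes M (i, map fst r) a" using r a by (simp add: denotes_def zip_map_fst_snd)
  then show ?thesis ..
qed

lemma Ob_carrier_sets: "{M \<in> Mod L' T'. a \<in> carrier (Ob M)} \<in> sets (ModB L' T')"
proof -
  have "{M \<in> Mod L' T'. a \<in> carrier (Ob M)} = Ob -` {N \<in> Mod L T. a \<in> carrier N} \<inter> space (ModB L' T')"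
    using Ob_in by auto
  then show ?thesis using measurable_sets[OF Ob_measurable R.carrier_sets] by simp
qed

lemma denotes_sets: "{M \<in> Mod L' T'. denotes M pt a} \<in> sets (ModB L' T')"
proof (cases "length (snd pt) = length (targets (fst pt))")
  case True
  let ?p = "zip (snd pt) (targets (fst pt))"
  have eq: "denotes M pt a \<longleftrightarrow> a \<in> carrier (Ob M) \<and> cond (carrier M) ?p \<and> generically (carrier M) ?p (\<lambda>g. arrow M g \<in> graph a (label (fst pt)))"
    if M: "M \<in> Mod L' T'" for M
  proof (cases "a \<in> carrier (Ob M)")
    case a: True
    have "generically (carrier M) ?p (\<lambda>g. arrow M g \<in> graph a (label (fst pt))) \<longleftrightarrow>
        generically (carrier M) ?p (\<lambda>g. arr_map (arrow M g) a = label (fst pt))"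
      by (rule generically_cong) (rule graph_arrow[OF M a])
    then show ?thesis using True a by (simp add: denotes_def)
  qed (simp add: denotes_def)
  have "{M \<in> Mod L' T'. denotes M pt a} = {M \<in> Mod L' T'. a \<in> carrier (Ob M)} \<inter>
     {M \<in> Mod L' T'. cond (carrier M) ?p \<and> generically (carrier M) ?p (\<lambda>g. arrow M g \<in> graph a (label (fst pt)))}"
    using eq by blast
  then show ?thesis using Ob_carrier_sets Q.vaught_Borel[OF graph_sets[of a "label (fst pt)"]] by auto
qed (simp add: denotes_def)

text \<open>
For \<open>f : M \<rightarrow> N\<close> and a permutation \<open>g\<close> of \<open>N\<close>, functoriality gives \<open>G(g)(G(f)(a)) = G(gf)(a)\<close>, and \<open>gf\<close> sends
\<open>xs\<close> to the same tuple as \<open>g\<close> sends the image of \<open>xs\<close> under \<open>f\<close>.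
\<close>

lemma denotes_transport:
  assumes f: "f \<in> Arr L' T'" and v: "denotes (src f) (i, xs) a"
  shows "denotes (trg f) (i, map (fun_of f) xs) (arr_map f a)"
proof -
  let ?S = "carrier (src f)" and ?p = "zip xs (targets i)"
  have S: "carrier (trg f) = ?S" using Q.ArrD(3)[OF f] .
  have v': "a \<in> carrier (Ob (src f))" "length xs = length (targets i)" "cond ?S ?p"
     "generically ?S ?p (\<lambda>g. arr_map (arrow (src f) g) a = label i)" using v by (simp_all add: denotes_def)
  have b: "bij_betw (fun_of f) ?S ?S" using permsD(1)[OF Q.ArrD(4)[OF f]] .
  have m: "move (fun_of f) ?p = zip (map (fun_of f) xs) (targets i)"
    by (simp add: move_def map_prod_def zip_map1 id_def)
  have "cond ?S (move (fun_of f) ?p)" by (rule cond_move[OF b v'(3)])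
  moreover have "generically ?S (move (fun_of f) ?p) (\<lambda>g. arr_map (arrow (trg f) g) (arr_map f a) = label i)"
  proof (rule generically_mono[OF generically_move[OF b v'(3,4)]])
    fix g assume g: "g \<in> perms ?S"
      and e: "arr_map (arrow (src f) (restrict (g \<circ> fun_of f) ?S)) a = label i"
    have "arrow (trg f) g \<in> Arr L' T'" using Q.arrow_in_Arr[OF Q.ArrD(2)[OF f]] g S by simp
    from arr_map_comp[OF f this _ v'(1)] e show "arr_map (arrow (trg f) g) (arr_map f a) = label i"
      unfolding Q.comp_arrow[OF f g] by simp
  qed
  moreover have "arr_map f a \<in> carrier (Ob (trg f))" using arr_map_in[OF f v'(1)] Ob_carrier[OF f] by simp
  ultimately show ?thesis using v'(2) S m by (simp add: denotes_def)
qed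

lemma denotes_invariant:
  assumes f: "f \<in> Arr L' T'" and xs: "xs \<in> lists (carrier (src f))" and a: "a \<in> carrier (Ob (src f))"
  shows "denotes (trg f) (i, map (fun_of f) xs) (arr_map f a) \<longleftrightarrow> denotes (src f) (i, xs) a"
proof
  assume "denotes (trg f) (i, map (fun_of f) xs) (arr_map f a)"
  then have "denotes (src f) (i, map (fun_of (inv_arr f)) (map (fun_of f) xs)) (arr_map (inv_arr f) (arr_map f a))"
    using denotes_transport[OF Q.inv_in_Arr[OF f], of i "map (fun_of f) xs" "arr_map f a"] unfolding inv_arr_ends by blast
  then show "denotes (src f) (i, xs) a" unfolding Q.map_inv_arr[OF f xs] arr_map_inv[OF f a] .
qed (rule denotes_transport[OF f])

definition realizes :: "('q, nat) rstruct \<Rightarrow> (('r, nat) rstruct \<Rightarrow> nat list set) \<Rightarrow> (nat \<times> nat list) list \<Rightarrow> bool" where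
  "realizes M E pts \<longleftrightarrow> (\<exists>as. list_all2 (denotes M) pts as \<and> as \<in> E (Ob M))"

definition borel_invariant :: "(('r, nat) rstruct \<Rightarrow> nat list set) \<Rightarrow> bool" where
  "borel_invariant E \<longleftrightarrow> (\<forall>as. {N \<in> Mod L T. as \<in> lists (carrier N) \<and> as \<in> E N} \<in> sets (ModB L T)) \<and>
     (\<forall>f\<in>Arr L T. \<forall>as\<in>lists (carrier (src f)). as \<in> E (src f) \<longleftrightarrow> map (fun_of f) as \<in> E (trg f))"

definition wf_points :: "('q, nat) rstruct \<Rightarrow> (nat \<times> nat list) list \<Rightarrow> bool" where
  "wf_points M pts \<longleftrightarrow> (\<forall>pt\<in>set pts. snd pt \<in> lists (carrier M) \<and> length (snd pt) = length (targets (fst pt)))"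

lemma list_all2_denotes_lists: "list_all2 (denotes M) pts as \<Longrightarrow> as \<in> lists (carrier (Ob M))"
  by (induction rule: list_all2_induct) (simp_all add: denotes_def)

lemma list_all2_denotes_wf: "list_all2 (denotes M) pts as \<Longrightarrow> wf_points M pts"
  by (induction rule: list_all2_induct) (auto simp: wf_points_def denotes_def dest: denotes_lists[unfolded denotes_def] cond_lists)

lemma list_all2_denotes_unique:
  "M \<in> Mod L' T' \<Longrightarrow> list_all2 (denotes M) pts as \<Longrightarrow> list_all2 (denotes M) pts bs \<Longrightarrow> as = bs"
proof (induction pts arbitrary: as bs)
  case (Cons pt pts)
  then obtain a as' b bs' where "as = a # as'" "bs = b # bs'" "denotes M pt a" "denotes M pt b"
    "list_all2 (denotes M) pts as'" "list_all2 (denotes M) pts bs'" by (auto simp: list_all2_Cons1)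
  with Cons denotes_unique show ?case by blast
qed simp

lemma list_all2_denotes_exists:
  "M \<in> Mod L' T' \<Longrightarrow> as \<in> lists (carrier (Ob M)) \<Longrightarrow> \<exists>pts. list_all2 (denotes M) pts as"
proof (induction as)
  case (Cons a as)
  then obtain pts where "list_all2 (denotes M) pts as" by auto
  moreover obtain pt where "denotes M pt a" using denotes_exists[OF Cons.prems(1), of a] Cons.prems(2) by auto
  ultimately have "list_all2 (denotes M) (pt # pts) (a # as)" by simp
  then show ?case by blast
qed simp

text \<open>
A tuple of names of given indices is just one long tuple of elements, and that the elements named satisfy a Borel
invariant relation \<open>E\<close> is itself a Borel invariant property of it.
\<close>

lemma definable:
  assumes E: "borel_invariant E"
  shows "\<exists>\<phi>. wff L' \<phi> (sum_list (map (\<lambda>i. length (targets i)) is)) \<and>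
     (\<forall>M\<in>Mod L' T'. \<forall>pts. wf_points M pts \<longrightarrow> map fst pts = is \<longrightarrow>
       (sat M \<phi> (concat (map snd pts)) \<longleftrightarrow> realizes M E pts))"
proof -
  let ?n = "sum_list (map (\<lambda>i. length (targets i)) is)"
  define holds_at where "holds_at M z \<longleftrightarrow> (\<exists>pts as. (map fst pts = is \<and> concat (map snd pts) = z \<and> length pts = length as) \<and>
     (\<forall>j\<in>{..<length pts}. denotes M (pts ! j) (as ! j)) \<and> (as \<in> lists (carrier (Ob M)) \<and> as \<in> E (Ob M)))" for M z
  have holds_at: "holds_at M z \<longleftrightarrow> (\<exists>pts. map fst pts = is \<and> concat (map snd pts) = z \<and> realizes M E pts)" for M z
  proof -
    have l: "list_all2 (denotes M) pts as \<longleftrightarrow> (length pts = length as \<and> (\<forall>j\<in>{..<length pts}. denotes M (pts ! j) (as ! j)))"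
      for pts as by (auto simp: list_all2_conv_all_nth)
    have "holds_at M z \<longleftrightarrow> (\<exists>pts as. map fst pts = is \<and> concat (map snd pts) = z \<and> list_all2 (denotes M) pts as \<and>
        as \<in> lists (carrier (Ob M)) \<and> as \<in> E (Ob M))"
      unfolding holds_at_def l by (simp only: conj_assoc)
    also have "\<dots> \<longleftrightarrow> (\<exists>pts. map fst pts = is \<and> concat (map snd pts) = z \<and> realizes M E pts)"
      unfolding realizes_def using list_all2_denotes_lists by blast
    finally show ?thesis .
  qed
  have "\<exists>\<phi>. wff L' \<phi> ?n \<and> (\<forall>M\<in>Mod L' T'. \<forall>xs\<in>lists (carrier M). length xs = ?n \<longrightarrow> (sat M \<phi> xs \<longleftrightarrow> holds_at M xs))"
  proof (rule Q.lopez_escobar)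
    fix z
    have "{M \<in> space (ModB L' T'). holds_at M z} \<in> sets (ModB L' T')"
      unfolding holds_at_def
    proof (intro sets.sets_Collect_countable_Ex)
      fix pts :: "(nat \<times> nat list) list" and as :: "nat list"
      have 1: "{M \<in> space (ModB L' T'). map fst pts = is \<and> concat (map snd pts) = z \<and> length pts = length as} \<in> sets (ModB L' T')"
        by (rule sets.sets_Collect_const)
      have 2: "{M \<in> space (ModB L' T'). \<forall>j\<in>{..<length pts}. denotes M (pts ! j) (as ! j)} \<in> sets (ModB L' T')"
        by (rule sets.sets_Collect_finite_All) (use denotes_sets in simp_all)
      have eq: "{M \<in> space (ModB L' T'). as \<in> lists (carrier (Ob M)) \<and> as \<in> E (Ob M)} =
         Ob -` {N \<in> Mod L T. as \<in> lists (carrier N) \<and> as \<in> E N} \<inter> space (ModB L' T')"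
        using Ob_in by auto
      have "{N \<in> Mod L T. as \<in> lists (carrier N) \<and> as \<in> E N} \<in> sets (ModB L T)"
        using E by (simp add: borel_invariant_def)
      then have 3: "{M \<in> space (ModB L' T'). as \<in> lists (carrier (Ob M)) \<and> as \<in> E (Ob M)} \<in> sets (ModB L' T')"
        unfolding eq by (rule measurable_sets[OF Ob_measurable])
      show "{M \<in> space (ModB L' T'). (map fst pts = is \<and> concat (map snd pts) = z \<and> length pts = length as) \<and>
         (\<forall>j\<in>{..<length pts}. denotes M (pts ! j) (as ! j)) \<and> as \<in> lists (carrier (Ob M)) \<and> as \<in> E (Ob M)} \<in> sets (ModB L' T')"
        by (rule sets.sets_Collect_conj[OF sets.sets_Collect_conj[OF 3 2] 1])
    qed
    then have "{M \<in> Mod L' T'. z \<in> lists (carrier M)} \<inter> {M \<in> space (ModB L' T'). holds_at M z} \<in> sets (ModB L' T')"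
      by (rule sets.Int[OF Q.lists_sets])
    moreover have "{M \<in> Mod L' T'. z \<in> lists (carrier M)} \<inter> {M \<in> space (ModB L' T'). holds_at M z} =
        {M \<in> Mod L' T'. z \<in> lists (carrier M) \<and> holds_at M z}"
      unfolding space_ModB by blast
    ultimately show "{M \<in> Mod L' T'. z \<in> lists (carrier M) \<and> holds_at M z} \<in> sets (ModB L' T')" by (simp only:)
  next
    have fwd: "holds_at (src f) xs \<Longrightarrow> holds_at (trg f) (map (fun_of f) xs)" if f: "f \<in> Arr L' T'" for f xs
    proof -
      assume "holds_at (src f) xs"
      then obtain pts as where p: "map fst pts = is" "concat (map snd pts) = xs" "list_all2 (denotes (src f)) pts as"
        "as \<in> E (Ob (src f))" unfolding holds_at realizes_def by blast
      let ?pts = "map (\<lambda>(i, x). (i, map (fun_of f) x)) pts"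
      have "list_all2 (denotes (trg f)) ?pts (map (arr_map f) as)"
        unfolding list_all2_map1 list_all2_map2 using p(3)
        by (rule list_all2_mono) (auto intro: denotes_transport[OF f])
      moreover have "map (arr_map f) as \<in> E (Ob (trg f))"
      proof -
        have "as \<in> lists (carrier (src (on_arr G f)))"
          unfolding on_arr_ends(1)[OF f] by (rule list_all2_denotes_lists[OF p(3)])
        from bspec[OF bspec[OF conjunct2[OF E[unfolded borel_invariant_def]] on_arr_in[OF f]] this]
        show ?thesis using p(4) unfolding on_arr_ends[OF f] arr_map_def by blast
      qed
      moreover have "map fst ?pts = is" using p(1) by (auto simp: split_beta comp_def)
      moreover have "concat (map snd ?pts) = map (fun_of f) xs"
        unfolding p(2)[symmetric] map_concat by (simp add: split_beta comp_def)
      ultimately show ?thesis unfolding holds_at realizes_def by blast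
    qed
    fix f xs assume f: "f \<in> Arr L' T'" and xs: "xs \<in> lists (carrier (src f))"
    show "holds_at (src f) xs \<longleftrightarrow> holds_at (trg f) (map (fun_of f) xs)"
    proof
      assume "holds_at (trg f) (map (fun_of f) xs)"
      then have "holds_at (src f) (map (fun_of (inv_arr f)) (map (fun_of f) xs))"
        using fwd[OF Q.inv_in_Arr[OF f], of "map (fun_of f) xs"] unfolding inv_arr_ends by blast
      then show "holds_at (src f) xs" unfolding Q.map_inv_arr[OF f xs] .
    qed (rule fwd[OF f])
  qed
  then obtain \<phi> where \<phi>: "wff L' \<phi> ?n"
    "\<And>M xs. M \<in> Mod L' T' \<Longrightarrow> xs \<in> lists (carrier M) \<Longrightarrow> length xs = ?n \<Longrightarrow> sat M \<phi> xs \<longleftrightarrow> holds_at M xs" by blast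
  have "sat M \<phi> (concat (map snd pts)) \<longleftrightarrow> realizes M E pts"
    if M: "M \<in> Mod L' T'" and w: "wf_points M pts" and i: "map fst pts = is" for M pts
  proof -
    have l: "concat (map snd pts) \<in> lists (carrier M)"
    proof (unfold in_lists_conv_set, rule ballI)
      fix x assume "x \<in> set (concat (map snd pts))"
      then obtain pt where pt: "pt \<in> set pts" "x \<in> set (snd pt)" by auto
      have "snd pt \<in> lists (carrier M)" using bspec[OF w[unfolded wf_points_def] pt(1)] ..
      with pt(2) show "x \<in> carrier M" by (simp add: in_lists_conv_set)
    qed
    have len: "map length (map snd pts) = map (\<lambda>i. length (targets i)) is"
      unfolding i[symmetric] using w by (auto simp: wf_points_def)
    then have "length (concat (map snd pts)) = ?n" by (simp add: length_concat)
    from \<phi>(2)[OF M l this] have "sat M \<phi> (concat (map snd pts)) \<longleftrightarrow> holds_at M (concat (map snd pts))" .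
    also have "\<dots> \<longleftrightarrow> realizes M E pts"
    proof
      assume "holds_at M (concat (map snd pts))"
      then obtain qts where q: "map fst qts = is" "concat (map snd qts) = concat (map snd pts)" "realizes M E qts"
        unfolding holds_at by blast
      then have "wf_points M qts" using list_all2_denotes_wf unfolding realizes_def by blast
      then have "map length (map snd qts) = map (\<lambda>i. length (targets i)) is"
        unfolding q(1)[symmetric] by (auto simp: wf_points_def)
      with len have "map snd qts = map snd pts" by (intro concat_map_unique[OF q(2)]) simp
      moreover have "map fst qts = map fst pts" using q(1) i by (simp only:)
      ultimately have "zip (map fst qts) (map snd qts) = zip (map fst pts) (map snd pts)" by (simp only:)
      then have "qts = pts" by (simp only: zip_map_fst_snd)
      with q(3) show "realizes M E pts" by (simp only:)
    next
      assume "realizes M E pts"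
      with i show "holds_at M (concat (map snd pts))" unfolding holds_at by (intro exI[of _ pts] conjI refl)
    qed
    finally show ?thesis .
  qed
  with \<phi>(1) show ?thesis by (intro exI[of _ \<phi>] conjI ballI allI impI)
qed

end

section \<open>The interpretation\<close>

lemma split_list_length: "length b = m + n \<Longrightarrow> \<exists>xs ys. b = xs @ ys \<and> length xs = m \<and> length ys = n"
  by (rule exI[of _ "take m b"], rule exI[of _ "drop m b"]) simp

text \<open>
All substitutions occurring in imaginary sorts select consecutive segments of a tuple.
\<close>

lemma map_nth_mid:
  "length xs = m \<Longrightarrow> m + length ys = n \<Longrightarrow> map ((!) (xs @ ys @ zs)) [m..<n] = ys"
  by (rule nth_equalityI) (auto simp: nth_append)

lemma length_block [simp]: "length (block A is k) = nvars A (is ! k)"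
  by (simp add: block_def)

lemma tdim_Nil [simp]: "tdim A [] = 0" and tdim_Cons [simp]: "tdim A (i # is) = nvars A i + tdim A is"
  by (simp_all add: tdim_def)

lemma block_subset:
  assumes "k < length is"
  shows "set (block A is k) \<subseteq> {..<tdim A is}"
proof -
  have "tdim A is = tdim A (take k is) + nvars A (is ! k) + tdim A (drop (Suc k) is)"
    by (subst id_take_nth_drop[OF assms]) (simp add: tdim_def)
  then show ?thesis by (auto simp: block_def)
qed

lemma sat_prefix:
  assumes "wff L \<phi> (length xs)"
  shows "sat M \<phi> (xs @ ys) \<longleftrightarrow> sat M \<phi> xs"
proof -
  have "sat M (ren \<phi> (\<lambda>v. v)) (xs @ ys) \<longleftrightarrow> sat M \<phi> xs" using assms by (rule sat_ren) (simp add: nth_append)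
  then show ?thesis by (simp add: ren_id)
qed

locale interpretation_setting = functor_setting L' T' L T G
  for L' :: "'q language" and T' :: "'q fm set" and L :: "'r language" and T :: "'r fm set"
    and G :: "('q, 'r) gfunctor" +
  assumes ctbl: "countable (dom L')" "countable T'"
begin

lemma proves_Foralls:
  assumes "wff L' \<phi> n"
    and "\<And>M b. M \<in> Mod L' T' \<Longrightarrow> b \<in> lists (carrier M) \<Longrightarrow> length b = n \<Longrightarrow> sat M \<phi> b"
  shows "proves L' T' (Foralls n \<phi>)"
  by (rule completeness[OF ctbl Q.sentences]) (use assms in auto)

definition defining :: "(('r, nat) rstruct \<Rightarrow> nat list set) \<Rightarrow> nat list \<Rightarrow> 'q fm" where
  "defining E is = (SOME \<phi>. wff L' \<phi> (sum_list (map (\<lambda>i. length (targets i)) is)) \<and>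
     (\<forall>M\<in>Mod L' T'. \<forall>pts. wf_points M pts \<longrightarrow> map fst pts = is \<longrightarrow>
       (sat M \<phi> (concat (map snd pts)) \<longleftrightarrow> realizes M E pts)))"

definition total_rel :: "('r, nat) rstruct \<Rightarrow> nat list set" where
  "total_rel N = UNIV"

definition equality_rel :: "('r, nat) rstruct \<Rightarrow> nat list set" where
  "equality_rel N = {[a, a] | a. True}"

definition symbol_rel :: "'r \<Rightarrow> ('r, nat) rstruct \<Rightarrow> nat list set" where
  "symbol_rel R N = rel N R"

text \<open>
The points of this sort are the names that denote something, and two of them are equivalent if
they denote the same element.
\<close>

definition sortF :: "('q, nat) isort" where
  "sortF = \<lparr>idx = UNIV, nvars = (\<lambda>i. length (targets i)),
     fml = (\<lambda>i. defining total_rel [i]), eqv = (\<lambda>i j. defining equality_rel [i, j])\<rparr>"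

definition interpF :: "('r, 'q) interp" where
  "interpF = \<lparr>isort_of = sortF, rel_of = (\<lambda>R. defining (symbol_rel R))\<rparr>"

lemma sortF_simps [simp]: "idx sortF = UNIV" "nvars sortF i = length (targets i)"
  by (simp_all add: sortF_def)

lemma interpF_simps [simp]: "isort_of interpF = sortF"
  by (simp add: interpF_def)

lemma borel_invariant_total: "borel_invariant total_rel"
  using R.lists_sets by (simp add: borel_invariant_def total_rel_def del: in_lists_conv_set)

lemma borel_invariant_equality: "borel_invariant equality_rel"
  unfolding borel_invariant_def
proof (intro conjI allI ballI)
  show "{N \<in> R.Md. as \<in> lists (carrier N) \<and> as \<in> equality_rel N} \<in> sets R.MdB" for as
  proof (cases "\<exists>a. as = [a, a]")
    case True
    then have "{N \<in> R.Md. as \<in> lists (carrier N) \<and> as \<in> equality_rel N} = {N \<in> R.Md. as \<in> lists (carrier N)}"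
      by (auto simp: equality_rel_def)
    then show ?thesis using R.lists_sets by (simp del: in_lists_conv_set)
  next
    case False
    then have "{N \<in> R.Md. as \<in> lists (carrier N) \<and> as \<in> equality_rel N} = {}"
      by (auto simp: equality_rel_def)
    then show ?thesis by (simp only: sets.empty_sets)
  qed
  fix f :: "'r arrow" and as assume f: "f \<in> Arr L T" and as: "as \<in> lists (carrier (src f))"
  show "as \<in> equality_rel (src f) \<longleftrightarrow> map (fun_of f) as \<in> equality_rel (trg f)"
  proof
    assume "map (fun_of f) as \<in> equality_rel (trg f)"
    then obtain x y where "as = [x, y]" "fun_of f x = fun_of f y"
      by (auto simp: equality_rel_def map_eq_Cons_conv)
    with as R.fun_of_eq_iff[OF f] show "as \<in> equality_rel (src f)" by (auto simp: equality_rel_def)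
  qed (auto simp: equality_rel_def)
qed

lemma borel_invariant_symbol: "borel_invariant (symbol_rel R)"
  unfolding borel_invariant_def symbol_rel_def
proof (intro conjI allI ballI)
  show "{N \<in> R.Md. as \<in> lists (carrier N) \<and> as \<in> rel N R} \<in> sets R.MdB" for as
  proof -
    have "{N \<in> R.Md. as \<in> lists (carrier N) \<and> as \<in> rel N R} = {N \<in> R.Md. as \<in> rel N R}"
      using R.relD by blast
    then show ?thesis using R.rel_sets by simp
  qed
qed (rule R.ArrD(6))

lemma tdim_sortF: "tdim sortF is = sum_list (map (\<lambda>i. length (targets i)) is)"
  by (simp add: tdim_def sortF_def)

lemma defining_iff:
  assumes "borel_invariant E"
  shows "wff L' (defining E is) (tdim sortF is)"
    and "M \<in> Mod L' T' \<Longrightarrow> wf_points M pts \<Longrightarrow>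
      sat M (defining E (map fst pts)) (concat (map snd pts)) \<longleftrightarrow> realizes M E pts"
  using someI_ex[OF definable[OF assms, of "is"]] someI_ex[OF definable[OF assms, of "map fst pts"]]
  unfolding defining_def[symmetric] tdim_sortF by simp_all

lemma wff_fml: "wff L' (fml sortF i) (length (targets i))"
  using defining_iff(1)[OF borel_invariant_total, of "[i]"] by (simp add: sortF_def tdim_def)

lemma wff_eqv: "wff L' (eqv sortF i j) (length (targets i) + length (targets j))"
  using defining_iff(1)[OF borel_invariant_equality, of "[i, j]"] by (simp add: sortF_def tdim_def)

lemma wff_rel_of: "wff L' (rel_of interpF R is) (tdim sortF is)"
  using defining_iff(1)[OF borel_invariant_symbol] by (simp add: interpF_def)

lemma sat_fml:
  assumes "M \<in> Mod L' T'" "xs \<in> lists (carrier M)" "length xs = length (targets i)"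
  shows "sat M (fml sortF i) xs \<longleftrightarrow> (\<exists>a. denotes M (i, xs) a)"
  using defining_iff(2)[OF borel_invariant_total assms(1), of "[(i, xs)]"] assms(2,3)
  by (auto simp: sortF_def wf_points_def realizes_def total_rel_def list_all2_Cons1)

lemma sat_eqv:
  assumes "M \<in> Mod L' T'" "xs \<in> lists (carrier M)" "length xs = length (targets i)"
    "ys \<in> lists (carrier M)" "length ys = length (targets j)"
  shows "sat M (eqv sortF i j) (xs @ ys) \<longleftrightarrow> (\<exists>a. denotes M (i, xs) a \<and> denotes M (j, ys) a)"
  using defining_iff(2)[OF borel_invariant_equality assms(1), of "[(i, xs), (j, ys)]"] assms(2-)
  by (auto simp: sortF_def wf_points_def realizes_def equality_rel_def list_all2_Cons1)

lemma sat_rel_of: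
  assumes "M \<in> Mod L' T'" "wf_points M pts"
  shows "sat M (rel_of interpF R (map fst pts)) (concat (map snd pts)) \<longleftrightarrow>
     (\<exists>as. list_all2 (denotes M) pts as \<and> as \<in> rel (Ob M) R)"
  using defining_iff(2)[OF borel_invariant_symbol assms] by (simp add: interpF_def realizes_def symbol_rel_def)

lemma is_isort_sortF: "is_isort L' T' sortF"
  unfolding is_isort_def Let_def sortF_simps
proof (intro conjI ballI)
  show "wff L' (fml sortF i) (length (targets i))" for i by (rule wff_fml)
  show "wff L' (eqv sortF i j) (length (targets i) + length (targets j))" for i j by (rule wff_eqv)
next
  fix i j
  let ?m = "length (targets i)" and ?n = "length (targets j)"
  show "proves L' T' (Foralls (?m + ?n) (Imp (eqv sortF i j) (And (fml sortF i) (sub (fml sortF j) [?m..<?m + ?n]))))"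
  proof (rule proves_Foralls)
    show "wff L' (Imp (eqv sortF i j) (And (fml sortF i) (sub (fml sortF j) [?m..<?m + ?n]))) (?m + ?n)"
      using wff_eqv wff_mono[OF wff_fml[of i]] by (auto intro!: wff_sub wff_fml)
    fix M b assume M: "M \<in> Mod L' T'" and b: "b \<in> lists (carrier M)" "length b = ?m + ?n"
    obtain xs ys where xy: "b = xs @ ys" "length xs = ?m" "length ys = ?n" using split_list_length[OF b(2)] by blast
    have l: "xs \<in> lists (carrier M)" "ys \<in> lists (carrier M)" using b(1) xy(1) by auto
    have "map ((!) b) [?m..<?m + ?n] = ys" using map_nth_mid[of xs ?m ys _ "[]"] xy by simp
    then have "sat M (sub (fml sortF j) [?m..<?m + ?n]) b \<longleftrightarrow> (\<exists>a. denotes M (j, ys) a)"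
      using sat_sub[of L' "fml sortF j" "[?m..<?m + ?n]" M b] sat_fml[OF M l(2) xy(3)] by (simp add: wff_fml)
    moreover have "sat M (fml sortF i) b \<longleftrightarrow> (\<exists>a. denotes M (i, xs) a)"
      using sat_prefix[of L' "fml sortF i" xs] wff_fml[of i] xy sat_fml[OF M l(1) xy(2)] by simp
    ultimately show "sat M (Imp (eqv sortF i j) (And (fml sortF i) (sub (fml sortF j) [?m..<?m + ?n]))) b"
      using sat_eqv[OF M l(1) xy(2) l(2) xy(3)] xy(1) by auto
  qed
next
  fix i
  let ?m = "length (targets i)"
  show "proves L' T' (Foralls ?m (Imp (fml sortF i) (sub (eqv sortF i i) ([0..<?m] @ [0..<?m]))))"
  proof (rule proves_Foralls)
    show "wff L' (Imp (fml sortF i) (sub (eqv sortF i i) ([0..<?m] @ [0..<?m]))) ?m"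
      using wff_eqv[of i i] by (auto intro!: wff_sub wff_fml)
    fix M xs assume M: "M \<in> Mod L' T'" and l: "xs \<in> lists (carrier M)" "length xs = ?m"
    have "map ((!) xs) [0..<?m] = xs" using l(2) by (metis map_nth)
    then have "sat M (sub (eqv sortF i i) ([0..<?m] @ [0..<?m])) xs \<longleftrightarrow> (\<exists>a. denotes M (i, xs) a)"
      using sat_sub[of L' "eqv sortF i i" "[0..<?m] @ [0..<?m]" M xs] sat_eqv[OF M l l] by (simp add: wff_eqv)
    then show "sat M (Imp (fml sortF i) (sub (eqv sortF i i) ([0..<?m] @ [0..<?m]))) xs"
      using sat_fml[OF M l] by simp
  qed
next
  fix i j
  let ?m = "length (targets i)" and ?n = "length (targets j)"
  show "proves L' T' (Foralls (?m + ?n) (Imp (eqv sortF i j) (sub (eqv sortF j i) ([?m..<?m + ?n] @ [0..<?m]))))"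
  proof (rule proves_Foralls)
    show "wff L' (Imp (eqv sortF i j) (sub (eqv sortF j i) ([?m..<?m + ?n] @ [0..<?m]))) (?m + ?n)"
      using wff_eqv[of i j] wff_eqv[of j i] by (auto intro!: wff_sub)
    fix M b assume M: "M \<in> Mod L' T'" and b: "b \<in> lists (carrier M)" "length b = ?m + ?n"
    obtain xs ys where xy: "b = xs @ ys" "length xs = ?m" "length ys = ?n" using split_list_length[OF b(2)] by blast
    have l: "xs \<in> lists (carrier M)" "ys \<in> lists (carrier M)" using b(1) xy(1) by auto
    have "map ((!) b) ([?m..<?m + ?n] @ [0..<?m]) = ys @ xs"
      using map_nth_mid[of xs ?m ys _ "[]"] map_nth_mid[of "[]" 0 xs ?m ys] xy by simp
    then have "sat M (sub (eqv sortF j i) ([?m..<?m + ?n] @ [0..<?m])) b \<longleftrightarrow> sat M (eqv sortF j i) (ys @ xs)"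
      using sat_sub[of L' "eqv sortF j i" "[?m..<?m + ?n] @ [0..<?m]" M b] wff_eqv[of j i] by simp
    then show "sat M (Imp (eqv sortF i j) (sub (eqv sortF j i) ([?m..<?m + ?n] @ [0..<?m]))) b"
      using sat_eqv[OF M l(1) xy(2) l(2) xy(3)] sat_eqv[OF M l(2) xy(3) l(1) xy(2)] xy(1) by auto
  qed
next
  fix i j k
  let ?m = "length (targets i)" and ?n = "length (targets j)" and ?p = "length (targets k)"
  let ?\<phi> = "Imp (And (eqv sortF i j) (sub (eqv sortF j k) [?m..<?m + ?n + ?p]))
               (sub (eqv sortF i k) ([0..<?m] @ [?m + ?n..<?m + ?n + ?p]))"
  show "proves L' T' (Foralls (?m + ?n + ?p) ?\<phi>)"
  proof (rule proves_Foralls)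
    show "wff L' ?\<phi> (?m + ?n + ?p)"
      using wff_mono[OF wff_eqv[of i j]] wff_eqv[of j k] wff_eqv[of i k] by (auto intro!: wff_sub)
    fix M b assume M: "M \<in> Mod L' T'" and b: "b \<in> lists (carrier M)" "length b = ?m + ?n + ?p"
    obtain xs b' where xb: "b = xs @ b'" "length xs = ?m" "length b' = ?n + ?p"
      using split_list_length[of b ?m "?n + ?p"] b(2) by auto
    obtain ys zs where yz: "b' = ys @ zs" "length ys = ?n" "length zs = ?p" using split_list_length[OF xb(3)] by blast
    have l: "xs \<in> lists (carrier M)" "ys \<in> lists (carrier M)" "zs \<in> lists (carrier M)"
      using b(1) xb(1) yz(1) by auto
    have 1: "sat M (eqv sortF i j) b \<longleftrightarrow> (\<exists>a. denotes M (i, xs) a \<and> denotes M (j, ys) a)"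
      using sat_prefix[of L' "eqv sortF i j" "xs @ ys" M zs] wff_eqv[of i j]
        sat_eqv[OF M l(1) xb(2) l(2) yz(2)] xb yz by simp
    have "map ((!) b) [?m..<?m + ?n + ?p] = ys @ zs"
      using map_nth_mid[of xs ?m "ys @ zs" "?m + ?n + ?p" "[]"] xb yz by simp
    then have 2: "sat M (sub (eqv sortF j k) [?m..<?m + ?n + ?p]) b \<longleftrightarrow> (\<exists>a. denotes M (j, ys) a \<and> denotes M (k, zs) a)"
      using sat_sub[of L' "eqv sortF j k" "[?m..<?m + ?n + ?p]" M b] wff_eqv[of j k]
        sat_eqv[OF M l(2) yz(2) l(3) yz(3)] by simp
    have "map ((!) b) ([0..<?m] @ [?m + ?n..<?m + ?n + ?p]) = xs @ zs"
      using map_nth_mid[of "xs @ ys" "?m + ?n" zs "?m + ?n + ?p" "[]"] map_nth_mid[of "[]" 0 xs ?m "ys @ zs"] xb yz by simp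
    then have 3: "sat M (sub (eqv sortF i k) ([0..<?m] @ [?m + ?n..<?m + ?n + ?p])) b \<longleftrightarrow>
        (\<exists>a. denotes M (i, xs) a \<and> denotes M (k, zs) a)"
      using sat_sub[of L' "eqv sortF i k" "[0..<?m] @ [?m + ?n..<?m + ?n + ?p]" M b] wff_eqv[of i k]
        sat_eqv[OF M l(1) xb(2) l(3) yz(3)] by simp
    show "sat M ?\<phi> b" unfolding sat_Imp sat_And 1 2 3 using denotes_unique[OF M] by blast
  qed
qed simp


lemma tdim_points:
  assumes "wf_points M pts"
  shows "tdim sortF (map fst pts) = length (concat (map snd pts))"
proof -
  have "map (\<lambda>pt. length (targets (fst pt))) pts = map (\<lambda>pt. length (snd pt)) pts"
    using assms by (simp add: wf_points_def)
  then show ?thesis unfolding tdim_sortF length_concat map_map comp_def by (rule arg_cong)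
qed

lemma wf_points_nth:
  assumes "wf_points M pts" "k < length pts"
  shows "snd (pts ! k) \<in> lists (carrier M)" "length (snd (pts ! k)) = length (targets (fst (pts ! k)))"
  using bspec[OF assms(1)[unfolded wf_points_def] nth_mem[OF assms(2)]] by blast+

lemma wf_points_take: "wf_points M pts \<Longrightarrow> wf_points M (take k pts)"
  by (meson in_set_takeD wf_points_def)

lemma block_nth:
  assumes w: "wf_points M pts" and k: "k < length pts"
  shows "map ((!) (concat (map snd pts) @ w)) (block sortF (map fst pts) k) = snd (pts ! k)"
proof -
  have "concat (map snd pts) = concat (map snd (take k pts)) @ snd (pts ! k) @ concat (map snd (drop (Suc k) pts))"
    by (subst id_take_nth_drop[OF k]) simp
  moreover have "tdim sortF (take k (map fst pts)) = length (concat (map snd (take k pts)))"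
    using tdim_points[OF wf_points_take[OF w]] by (simp add: take_map)
  ultimately show ?thesis unfolding block_def
    using map_nth_mid[of "concat (map snd (take k pts))" _ "snd (pts ! k)"] wf_points_nth[OF w k] k by simp
qed

lemma wf_points_split:
  "z \<in> lists (carrier M) \<Longrightarrow> length z = tdim sortF is \<Longrightarrow>
     \<exists>pts. map fst pts = is \<and> concat (map snd pts) = z \<and> wf_points M pts"
proof (induction "is" arbitrary: z)
  case Nil
  then show ?case by (intro exI[of _ "[]"]) (simp add: wf_points_def)
next
  case (Cons i "is")
  obtain xs z' where z: "z = xs @ z'" "length xs = length (targets i)" "length z' = tdim sortF is"
    using split_list_length[of z "length (targets i)" "tdim sortF is"] Cons.prems(2) by auto
  obtain pts where p: "map fst pts = is" "concat (map snd pts) = z'" "wf_points M pts"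
    using Cons.IH[OF _ z(3)] Cons.prems(1) z(1) by auto
  have "wf_points M ((i, xs) # pts)" using p(3) Cons.prems(1) z by (auto simp: wf_points_def)
  then show ?case using p z by (intro exI[of _ "(i, xs) # pts"]) simp
qed

lemma sat_sub_fml:
  assumes M: "M \<in> Mod L' T'" and w: "wf_points M pts" and k: "k < length pts"
  shows "sat M (sub (fml sortF (map fst pts ! k)) (block sortF (map fst pts) k)) (concat (map snd pts)) \<longleftrightarrow>
    (\<exists>a. denotes M (pts ! k) a)"
  using sat_sub[of L' "fml sortF (map fst pts ! k)" "block sortF (map fst pts) k" M "concat (map snd pts)"]
    block_nth[OF w k, of "[]"] sat_fml[OF M wf_points_nth[OF w k]] wff_fml k by simp

lemma sat_sub_eqv:
  assumes M: "M \<in> Mod L' T'" and w: "wf_points M pts" "wf_points M qts" and k: "k < length pts" "l < length qts"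
    and z: "map ((!) z) vs = snd (pts ! k) @ snd (qts ! l)"
    and len: "length vs = length (targets (fst (pts ! k))) + length (targets (fst (qts ! l)))"
  shows "sat M (sub (eqv sortF (fst (pts ! k)) (fst (qts ! l))) vs) z \<longleftrightarrow>
    (\<exists>a. denotes M (pts ! k) a \<and> denotes M (qts ! l) a)"
  using sat_sub[of L' "eqv sortF (fst (pts ! k)) (fst (qts ! l))" vs M z] z len
    sat_eqv[OF M wf_points_nth[OF w(1) k(1)] wf_points_nth[OF w(2) k(2)]] wff_eqv by simp

lemma list_all2_denotes_iff:
  assumes "M \<in> Mod L' T'" "\<And>k. k < length pts \<Longrightarrow> \<exists>a. denotes M (pts ! k) a \<and> denotes M (qts ! k) a"
    "length pts = length qts" "list_all2 (denotes M) pts as"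
  shows "list_all2 (denotes M) qts as"
proof (rule list_all2_all_nthI)
  show "length qts = length as" using assms(3,4) by (simp add: list_all2_lengthD)
  fix k assume "k < length qts"
  then have k: "k < length pts" using assms(3) by simp
  obtain a where a: "denotes M (pts ! k) a" "denotes M (qts ! k) a" using assms(2)[OF k] by blast
  have "denotes M (pts ! k) (as ! k)" using list_all2_nthD[OF assms(4) k] .
  with a denotes_unique[OF assms(1)] show "denotes M (qts ! k) (as ! k)" by blast
qed

lemma is_subsort_rel_of:
  "is_subsort L' T' (isort_power sortF n) (rel_of interpF R)"
proof -
  have i: "idx (isort_power sortF n) = {is. length is = n}" and
    nv: "nvars (isort_power sortF n) = tdim sortF" and
    fm: "fml (isort_power sortF n) is = Conj {..<n} (\<lambda>k. sub (fml sortF (is ! k)) (block sortF is k))" and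
    ev: "eqv (isort_power sortF n) is js = Conj {..<n} (\<lambda>k. sub (eqv sortF (is ! k) (js ! k))
              (block sortF is k @ map (\<lambda>v. tdim sortF is + v) (block sortF js k)))" for "is" js
    by (simp_all add: isort_power_def)
  show ?thesis
    unfolding is_subsort_def i nv fm ev Let_def
  proof (intro conjI ballI)
    show "wff L' (rel_of interpF R is) (tdim sortF is)" for "is" by (rule wff_rel_of)
  next
    fix "is" :: "nat list" assume "is \<in> {is. length is = n}"
    then have len: "length is = n" by simp
    show "proves L' T' (Foralls (tdim sortF is)
       (Imp (rel_of interpF R is) (Conj {..<n} (\<lambda>k. sub (fml sortF (is ! k)) (block sortF is k)))))"
    proof (rule proves_Foralls)
      show "wff L' (Imp (rel_of interpF R is) (Conj {..<n} (\<lambda>k. sub (fml sortF (is ! k)) (block sortF is k)))) (tdim sortF is)"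
        using len block_subset[of _ "is" sortF] by (auto simp: wff_rel_of wff_fml intro!: wff_sub)
      fix M z assume M: "M \<in> Mod L' T'" and "z \<in> lists (carrier M)" "length z = tdim sortF is"
      then obtain pts where p: "map fst pts = is" "concat (map snd pts) = z" "wf_points M pts"
        using wf_points_split by blast
      have pl: "length pts = n" using p(1) len by auto
      show "sat M (Imp (rel_of interpF R is) (Conj {..<n} (\<lambda>k. sub (fml sortF (is ! k)) (block sortF is k)))) z"
        unfolding sat_Imp sat.simps
      proof (intro impI ballI)
        fix k assume r: "sat M (rel_of interpF R is) z" and k: "k \<in> {..<n}"
        from r obtain as where "list_all2 (denotes M) pts as" using sat_rel_of[OF M p(3), of R] p(1,2) by auto
        from list_all2_nthD[OF this] have "denotes M (pts ! k) (as ! k)" using k pl by simp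
        then show "sat M (sub (fml sortF (is ! k)) (block sortF is k)) z"
          using sat_sub_fml[OF M p(3), of k] k pl p(1,2) by auto
      qed
    qed
  next
    fix "is" js :: "nat list" assume "is \<in> {is. length is = n}" "js \<in> {is. length is = n}"
    then have len: "length is = n" "length js = n" by simp_all
    let ?m = "tdim sortF is" and ?n = "tdim sortF js"
    let ?E = "Conj {..<n} (\<lambda>k. sub (eqv sortF (is ! k) (js ! k)) (block sortF is k @ map (\<lambda>v. ?m + v) (block sortF js k)))"
    show "proves L' T' (Foralls (?m + ?n) (Imp (And ?E (rel_of interpF R is)) (sub (rel_of interpF R js) [?m..<?m + ?n])))"
    proof (rule proves_Foralls)
      have "wff L' ?E (?m + ?n)"
      proof (simp only: wff.simps, rule ballI)
        fix k assume "k \<in> {..<n}"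
        then have "set (block sortF is k) \<subseteq> {..<?m}" "set (block sortF js k) \<subseteq> {..<?n}"
          using block_subset[of k "is" sortF] block_subset[of k js sortF] len by simp_all
        then show "wff L' (sub (eqv sortF (is ! k) (js ! k)) (block sortF is k @ map (\<lambda>v. ?m + v) (block sortF js k))) (?m + ?n)"
          by (intro wff_sub) (auto simp: wff_eqv)
      qed
      then show "wff L' (Imp (And ?E (rel_of interpF R is)) (sub (rel_of interpF R js) [?m..<?m + ?n])) (?m + ?n)"
        using wff_mono[OF wff_rel_of] by (auto simp: wff_rel_of intro!: wff_sub)
      fix M b assume M: "M \<in> Mod L' T'" and b: "b \<in> lists (carrier M)" "length b = ?m + ?n"
      obtain z w where zw: "b = z @ w" "length z = ?m" "length w = ?n" using split_list_length[OF b(2)] by blast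
      obtain pts where p: "map fst pts = is" "concat (map snd pts) = z" "wf_points M pts"
        using wf_points_split[OF _ zw(2)] b(1) zw(1) by auto
      obtain qts where q: "map fst qts = js" "concat (map snd qts) = w" "wf_points M qts"
        using wf_points_split[OF _ zw(3)] b(1) zw(1) by auto
      have pl: "length pts = n" "length qts = n" using p(1) q(1) len by auto
      have 1: "sat M ?E b \<longleftrightarrow> (\<forall>k<n. \<exists>a. denotes M (pts ! k) a \<and> denotes M (qts ! k) a)"
      proof -
        have "sat M (sub (eqv sortF (is ! k) (js ! k)) (block sortF is k @ map (\<lambda>v. ?m + v) (block sortF js k))) b \<longleftrightarrow>
          (\<exists>a. denotes M (pts ! k) a \<and> denotes M (qts ! k) a)" if k: "k < n" for k
        proof -
          have e: "is ! k = fst (pts ! k)" "js ! k = fst (qts ! k)" using p(1) q(1) pl k by auto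
          have "map ((!) b) (block sortF is k) = snd (pts ! k)"
            using block_nth[OF p(3), of k w] k pl p(1,2) zw(1) by simp
          moreover have "map ((!) b) (map (\<lambda>v. ?m + v) (block sortF js k)) = snd (qts ! k)"
          proof -
            have "map ((!) b) (map (\<lambda>v. ?m + v) (block sortF js k)) = map ((!) w) (block sortF js k)"
              using zw by (simp add: comp_def nth_append)
            also have "\<dots> = snd (qts ! k)" using block_nth[OF q(3), of k "[]"] k pl q(1,2) by simp
            finally show ?thesis .
          qed
          ultimately show ?thesis unfolding e
            by (intro sat_sub_eqv[OF M p(3) q(3)]) (use k pl e in simp_all)
        qed
        then show ?thesis by (simp add: Ball_def)
      qed
      have 2: "sat M (rel_of interpF R is) b \<longleftrightarrow> (\<exists>as. list_all2 (denotes M) pts as \<and> as \<in> rel (Ob M) R)"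
        using sat_prefix[of L' "rel_of interpF R is" z M w] wff_rel_of[of R "is"] zw
          sat_rel_of[OF M p(3), of R] p(1,2) by simp
      have "map ((!) b) [?m..<?m + ?n] = w" using map_nth_mid[of z ?m w "?m + ?n" "[]"] zw by simp
      then have 3: "sat M (sub (rel_of interpF R js) [?m..<?m + ?n]) b \<longleftrightarrow>
          (\<exists>as. list_all2 (denotes M) qts as \<and> as \<in> rel (Ob M) R)"
        using sat_sub[of L' "rel_of interpF R js" "[?m..<?m + ?n]" M b] wff_rel_of[of R js]
          sat_rel_of[OF M q(3), of R] q(1,2) by simp
      show "sat M (Imp (And ?E (rel_of interpF R is)) (sub (rel_of interpF R js) [?m..<?m + ?n])) b"
        unfolding sat_Imp sat_And 1 2 3 using list_all2_denotes_iff[OF M, of pts qts] pl by auto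
    qed
  qed
qed

lemma map_fst_nth: "set vs \<subseteq> {..<length pts} \<Longrightarrow> map (\<lambda>v. map fst pts ! v) vs = map fst (map ((!) pts) vs)"
  by (auto simp: subset_iff)

lemma wff_interp_fm: "wff L \<phi> (length is) \<Longrightarrow> wff L' (interp_fm interpF \<phi> is) (tdim sortF is)"
proof (induction \<phi> arbitrary: "is")
  case (Atom R vs)
  then have vs: "set vs \<subseteq> {..<length is}" by simp
  have l: "length (concat (map (block sortF is) vs)) = tdim sortF (map ((!) is) vs)"
    by (simp add: length_concat tdim_sortF comp_def)
  show ?case unfolding interp_fm.simps interpF_simps
  proof (rule wff_sub)
    show "wff L' (rel_of interpF R (map ((!) is) vs)) (length (concat (map (block sortF is) vs)))"
      unfolding l by (rule wff_rel_of)
    show "set (concat (map (block sortF is) vs)) \<subseteq> {..<tdim sortF is}"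
      using block_subset[of _ "is" sortF] vs by fastforce
  qed
next
  case (Eq j k)
  then show ?case unfolding interp_fm.simps interpF_simps
    using block_subset[of _ "is" sortF] by (intro wff_sub) (auto simp: wff_eqv)
next
  case (Neg \<phi>)
  then show ?case by simp
next
  case (Conj I \<phi>)
  then show ?case by simp
next
  case (Disj I \<phi>)
  then show ?case by simp
next
  case (Forall \<phi>)
  have "wff L' (interp_fm interpF \<phi> (i # is)) (tdim sortF (i # is))" for i
    by (rule Forall.IH) (use Forall.prems in simp)
  then show ?case using wff_mono[OF wff_fml] by simp
next
  case (Exists \<phi>)
  have "wff L' (interp_fm interpF \<phi> (i # is)) (tdim sortF (i # is))" for i
    by (rule Exists.IH) (use Exists.prems in simp)
  then show ?case using wff_mono[OF wff_fml] by simp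
qed

lemma sat_fml_prefix:
  assumes "M \<in> Mod L' T'" "xs \<in> lists (carrier M)" "length xs = length (targets i)"
  shows "sat M (fml sortF i) (xs @ z) \<longleftrightarrow> (\<exists>a. denotes M (i, xs) a)"
  using sat_prefix[of L' "fml sortF i" xs M z] wff_fml[of i] assms(3) sat_fml[OF assms] by simp

lemma denotes_wf: "denotes M (i, xs) a \<Longrightarrow> xs \<in> lists (carrier M) \<and> length xs = length (targets i) \<and> a \<in> carrier (Ob M)"
  using denotes_lists[of M "(i, xs)" a] by (simp add: denotes_def)

text \<open>
Truth of the translated formula at names is truth of the formula at the elements named.  Quantifiers
match because every element has a name.
\<close>

lemma sat_interp_fm:
  assumes M: "M \<in> Mod L' T'"
  shows "list_all2 (denotes M) pts as \<Longrightarrow> wff L \<phi> (length pts) \<Longrightarrow>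
     sat M (interp_fm interpF \<phi> (map fst pts)) (concat (map snd pts)) \<longleftrightarrow> sat (Ob M) \<phi> as"
proof (induction \<phi> arbitrary: pts as)
  case (Atom R vs)
  have w: "wf_points M pts" using list_all2_denotes_wf[OF Atom.prems(1)] .
  have vs: "set vs \<subseteq> {..<length pts}" using Atom.prems(2) by simp
  let ?q = "map ((!) pts) vs"
  have v: "list_all2 (denotes M) ?q (map ((!) as) vs)"
    unfolding list_all2_map1 list_all2_map2 using list_all2_nthD[OF Atom.prems(1)] vs
    by (intro list.rel_refl_strong) auto
  have "wf_points M ?q" using list_all2_denotes_wf[OF v] .
  have c: "map ((!) (concat (map snd pts))) (concat (map (block sortF (map fst pts)) vs)) = concat (map snd ?q)"
    unfolding map_concat map_map comp_def
    using block_nth[OF w, of _ "[]"] vs by (intro arg_cong[of _ _ concat] map_cong refl) auto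
  have l: "length (concat (map (block sortF (map fst pts)) vs)) = tdim sortF (map fst ?q)"
    using vs by (auto simp: length_concat tdim_sortF comp_def subset_iff intro!: arg_cong[of _ _ sum_list])
  have "sat M (interp_fm interpF (Atom R vs) (map fst pts)) (concat (map snd pts)) \<longleftrightarrow>
    sat M (rel_of interpF R (map fst ?q)) (concat (map snd ?q))"
    unfolding interp_fm.simps interpF_simps map_fst_nth[OF vs] c[symmetric]
    by (rule sat_sub[of L']) (unfold l, rule wff_rel_of)
  also have "\<dots> \<longleftrightarrow> map ((!) as) vs \<in> rel (Ob M) R"
    unfolding sat_rel_of[OF M \<open>wf_points M ?q\<close>] using v list_all2_denotes_unique[OF M _ v] by blast
  finally show ?case by simp
next
  case (Eq j k)
  have w: "wf_points M pts" using list_all2_denotes_wf[OF Eq.prems(1)] .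
  have jk: "j < length pts" "k < length pts" using Eq.prems(2) by simp_all
  have "sat M (interp_fm interpF (Eq j k) (map fst pts)) (concat (map snd pts)) \<longleftrightarrow>
      (\<exists>a. denotes M (pts ! j) a \<and> denotes M (pts ! k) a)"
    unfolding interp_fm.simps interpF_simps nth_map[OF jk(1)] nth_map[OF jk(2)]
    by (rule sat_sub_eqv[OF M w w jk]) (use block_nth[OF w jk(1), of "[]"] block_nth[OF w jk(2), of "[]"] jk in simp_all)
  also have "\<dots> \<longleftrightarrow> as ! j = as ! k"
    using list_all2_nthD[OF Eq.prems(1) jk(1)] list_all2_nthD[OF Eq.prems(1) jk(2)] denotes_unique[OF M] by metis
  finally show ?case by simp
next
  case (Neg \<phi>)
  from Neg.IH[OF Neg.prems(1)] Neg.prems(2) show ?case by simp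
next
  case (Conj I \<phi>)
  from Conj.IH[OF rangeI Conj.prems(1)] Conj.prems(2) show ?case by simp
next
  case (Disj I \<phi>)
  from Disj.IH[OF rangeI Disj.prems(1)] Disj.prems(2) show ?case by simp
next
  case (Forall \<phi>)
  let ?z = "concat (map snd pts)" and ?is = "map fst pts"
  have IH: "sat M (interp_fm interpF \<phi> (i # ?is)) (xs @ ?z) \<longleftrightarrow> sat (Ob M) \<phi> (a # as)" if "denotes M (i, xs) a" for i xs a
    using Forall.IH[of "(i, xs) # pts" "a # as"] Forall.prems that by simp
  have "sat M (interp_fm interpF (Forall \<phi>) ?is) ?z \<longleftrightarrow>
     (\<forall>i. \<forall>xs\<in>lists (carrier M). length xs = length (targets i) \<longrightarrow> sat M (fml sortF i) (xs @ ?z) \<longrightarrow>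
        sat M (interp_fm interpF \<phi> (i # ?is)) (xs @ ?z))" by simp
  also have "\<dots> \<longleftrightarrow> (\<forall>i xs a. denotes M (i, xs) a \<longrightarrow> sat M (interp_fm interpF \<phi> (i # ?is)) (xs @ ?z))"
    using sat_fml_prefix[OF M] denotes_wf by blast
  also have "\<dots> \<longleftrightarrow> (\<forall>i xs a. denotes M (i, xs) a \<longrightarrow> sat (Ob M) \<phi> (a # as))"
    using IH by blast
  also have "\<dots> \<longleftrightarrow> (\<forall>a\<in>carrier (Ob M). sat (Ob M) \<phi> (a # as))"
    using denotes_exists[OF M] denotes_wf by (metis surj_pair)
  finally show ?case by simp
next
  case (Exists \<phi>)
  let ?z = "concat (map snd pts)" and ?is = "map fst pts"
  have IH: "sat M (interp_fm interpF \<phi> (i # ?is)) (xs @ ?z) \<longleftrightarrow> sat (Ob M) \<phi> (a # as)" if "denotes M (i, xs) a" for i xs a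
    using Exists.IH[of "(i, xs) # pts" "a # as"] Exists.prems that by simp
  have "sat M (interp_fm interpF (Exists \<phi>) ?is) ?z \<longleftrightarrow>
     (\<exists>i. \<exists>xs\<in>lists (carrier M). length xs = length (targets i) \<and> sat M (fml sortF i) (xs @ ?z) \<and>
        sat M (interp_fm interpF \<phi> (i # ?is)) (xs @ ?z))" by simp
  also have "\<dots> \<longleftrightarrow> (\<exists>i xs a. denotes M (i, xs) a \<and> sat M (interp_fm interpF \<phi> (i # ?is)) (xs @ ?z))"
    using sat_fml_prefix[OF M] denotes_wf by blast
  also have "\<dots> \<longleftrightarrow> (\<exists>i xs a. denotes M (i, xs) a \<and> sat (Ob M) \<phi> (a # as))"
    using IH by blast
  also have "\<dots> \<longleftrightarrow> (\<exists>a\<in>carrier (Ob M). sat (Ob M) \<phi> (a # as))"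
    using denotes_exists[OF M] denotes_wf by (metis surj_pair)
  finally show ?case by simp
qed

theorem is_interp_interpF: "is_interp L T L' T' interpF"
  unfolding is_interp_def interpF_simps
proof (intro conjI allI impI ballI)
  show "is_isort L' T' sortF" by (rule is_isort_sortF)
  show "is_subsort L' T' (isort_power sortF n) (rel_of interpF R)" for R n by (rule is_subsort_rel_of)
  fix \<phi> assume \<phi>: "\<phi> \<in> T"
  then have w: "wff L \<phi> 0" using R.sentences by (simp add: is_theory_def)
  show "proves L' T' (interp_fm interpF \<phi> [])"
  proof (rule completeness[OF ctbl Q.sentences])
    show "wff L' (interp_fm interpF \<phi> []) 0" using wff_interp_fm[of \<phi> "[]"] w by simp
    fix M assume M: "M \<in> Mod L' T'"
    have "sat (Ob M) \<phi> []" using R.MdD(4)[OF Ob_in[OF M]] \<phi> by (simp add: is_model_def)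
    then show "sat M (interp_fm interpF \<phi> []) []" using sat_interp_fm[OF M, of "[]" "[]" \<phi>] w by simp
  qed
qed

end

section \<open>The functor induced by the interpretation\<close>

context interpretation_setting
begin

definition names_of :: "('q, nat) rstruct \<Rightarrow> nat \<Rightarrow> (nat \<times> nat list) set" where
  "names_of M a = {pt. denotes M pt a}"

lemma denotes_carrier: "denotes M pt a \<Longrightarrow> a \<in> carrier (Ob M)"
  by (simp add: denotes_def)

lemma points_eq:
  assumes M: "M \<in> Mod L' T'"
  shows "pt \<in> points sortF M \<longleftrightarrow> (\<exists>a. denotes M pt a)"
proof -
  obtain i xs where pt: "pt = (i, xs)" by fastforce
  show ?thesis unfolding pt points_def using sat_fml[OF M, of xs i] denotes_wf[of M i xs] by auto
qed

lemma point_class_eq: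
  assumes M: "M \<in> Mod L' T'" and v: "denotes M pt a"
  shows "point_class sortF M pt = names_of M a"
proof -
  have "(pt, qt) \<in> point_eqv sortF M \<longleftrightarrow> denotes M qt a" for qt
  proof -
    obtain i xs j ys where pt: "pt = (i, xs)" "qt = (j, ys)" by (metis surj_pair)
    have x: "xs \<in> lists (carrier M)" "length xs = length (targets i)" using denotes_wf[of M i xs a] v pt by simp_all
    have "(pt, qt) \<in> point_eqv sortF M \<longleftrightarrow> pt \<in> points sortF M \<and> qt \<in> points sortF M \<and> sat M (eqv sortF i j) (xs @ ys)"
      by (simp add: point_eqv_def pt)
    also have "\<dots> \<longleftrightarrow> qt \<in> points sortF M \<and> sat M (eqv sortF i j) (xs @ ys)"
      using points_eq[OF M, of pt] v by blast
    also have "\<dots> \<longleftrightarrow> (\<exists>b. denotes M pt b \<and> denotes M qt b)"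
    proof (cases "\<exists>b. denotes M qt b")
      case True
      then have y: "ys \<in> lists (carrier M)" "length ys = length (targets j)" using denotes_wf[of M j ys] pt by auto
      show ?thesis using sat_eqv[OF M x y] True points_eq[OF M, of qt] pt by simp
    next
      case False
      then show ?thesis using points_eq[OF M, of qt] by blast
    qed
    also have "\<dots> \<longleftrightarrow> denotes M qt a" using v denotes_unique[OF M] by blast
    finally show ?thesis .
  qed
  then show ?thesis by (auto simp: point_class_def names_of_def)
qed

lemma isort_val_eq:
  assumes M: "M \<in> Mod L' T'"
  shows "isort_val sortF M = names_of M ` carrier (Ob M)"
proof -
  have "isort_val sortF M = {point_class sortF M pt | pt. pt \<in> points sortF M}"
    by (auto simp: isort_val_def quotient_def point_class_def)
  also have "\<dots> = {point_class sortF M pt | pt a. denotes M pt a}" using points_eq[OF M] by blast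
  also have "\<dots> = {names_of M a | pt a. denotes M pt a}" using point_class_eq[OF M] by blast
  also have "\<dots> = names_of M ` carrier (Ob M)" using denotes_exists[OF M] denotes_carrier by blast
  finally show ?thesis .
qed

lemma inj_on_names_of:
  assumes M: "M \<in> Mod L' T'"
  shows "inj_on (names_of M) (carrier (Ob M))"
proof (rule inj_onI)
  fix a b assume a: "a \<in> carrier (Ob M)" and "names_of M a = names_of M b"
  moreover obtain pt where "denotes M pt a" using denotes_exists[OF M a] ..
  ultimately have "denotes M pt a" "denotes M pt b" by (auto simp: names_of_def)
  then show "a = b" by (rule denotes_unique[OF M])
qed

lemma map_point_class:
  assumes M: "M \<in> Mod L' T'"
  shows "list_all2 (denotes M) pts as \<Longrightarrow> map (point_class sortF M) pts = map (names_of M) as"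
  by (induction rule: list_all2_induct) (simp_all add: point_class_eq[OF M])

lemma power_subsort_val_eq:
  assumes M: "M \<in> Mod L' T'" and R: "L R = Some n"
  shows "power_subsort_val sortF n (rel_of interpF R) M = map (names_of M) ` rel (Ob M) R"
proof
  show "power_subsort_val sortF n (rel_of interpF R) M \<subseteq> map (names_of M) ` rel (Ob M) R"
  proof
    fix c assume "c \<in> power_subsort_val sortF n (rel_of interpF R) M"
    then obtain pts where p: "c = map (point_class sortF M) pts" "pts \<in> lists (points sortF M)"
      "sat M (rel_of interpF R (map fst pts)) (concat (map snd pts))" by (auto simp: power_subsort_val_def)
    have "wf_points M pts" unfolding wf_points_def
    proof
      fix pt assume "pt \<in> set pts"
      then have "pt \<in> points sortF M" using p(2) by (simp add: in_lists_conv_set)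
      then obtain a where "denotes M (fst pt, snd pt) a" using points_eq[OF M, of pt] by auto
      from denotes_wf[OF this] show "snd pt \<in> lists (carrier M) \<and> length (snd pt) = length (targets (fst pt))" by blast
    qed
    from sat_rel_of[OF M this] p(3) obtain as where "list_all2 (denotes M) pts as" "as \<in> rel (Ob M) R" by blast
    then show "c \<in> map (names_of M) ` rel (Ob M) R" using map_point_class[OF M] p(1) by blast
  qed
  show "map (names_of M) ` rel (Ob M) R \<subseteq> power_subsort_val sortF n (rel_of interpF R) M"
  proof
    fix c assume "c \<in> map (names_of M) ` rel (Ob M) R"
    then obtain as where as: "c = map (names_of M) as" "as \<in> rel (Ob M) R" by blast
    have l: "as \<in> lists (carrier (Ob M))" "length as = n"
      using R.relD[OF Ob_in[OF M] as(2)] R by simp_all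
    obtain pts where v: "list_all2 (denotes M) pts as" using list_all2_denotes_exists[OF M l(1)] ..
    have "sat M (rel_of interpF R (map fst pts)) (concat (map snd pts))"
      using sat_rel_of[OF M list_all2_denotes_wf[OF v]] v as(2) by blast
    moreover have "pts \<in> lists (points sortF M)"
      using v points_eq[OF M] by (induction rule: list_all2_induct) auto
    moreover have "length pts = n" using list_all2_lengthD[OF v] l(2) by simp
    ultimately show "c \<in> power_subsort_val sortF n (rel_of interpF R) M"
      unfolding power_subsort_val_def using map_point_class[OF M v] as(1)
      by (intro CollectI exI[of _ pts]) (simp only: simp_thms)
  qed
qed

lemma names_of_image:
  assumes f: "f \<in> Arr L' T'" and a: "a \<in> carrier (Ob (src f))"
  shows "(\<lambda>(i, xs). (i, map (fun_of f) xs)) ` names_of (src f) a = names_of (trg f) (arr_map f a)"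
proof
  show "(\<lambda>(i, xs). (i, map (fun_of f) xs)) ` names_of (src f) a \<subseteq> names_of (trg f) (arr_map f a)"
    using denotes_transport[OF f] by (auto simp: names_of_def)
  show "names_of (trg f) (arr_map f a) \<subseteq> (\<lambda>(i, xs). (i, map (fun_of f) xs)) ` names_of (src f) a"
  proof
    fix pt assume "pt \<in> names_of (trg f) (arr_map f a)"
    then obtain i ys where pt: "pt = (i, ys)" "denotes (trg f) (i, ys) (arr_map f a)" by (cases pt) (auto simp: names_of_def)
    have "ys \<in> lists (fun_of f ` carrier (src f))"
      using denotes_wf[OF pt(2)] Q.ArrD(3)[OF f] permsD(2)[OF Q.ArrD(4)[OF f]] by simp
    then obtain xs where xs: "xs \<in> lists (carrier (src f))" "ys = map (fun_of f) xs" unfolding lists_image by blast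
    then have "denotes (src f) (i, xs) a" using denotes_invariant[OF f xs(1) a] pt(2) by simp
    then show "pt \<in> (\<lambda>(i, xs). (i, map (fun_of f) xs)) ` names_of (src f) a"
      using pt(1) xs(2) by (intro image_eqI[of _ _ "(i, xs)"]) (simp_all add: names_of_def)
  qed
qed

lemma sets_pointsB: "sets (pointsB L' T' sortF) = sigma_sets (SIGMA M : Mod L' T'. points sortF M)
    {S. S \<subseteq> (SIGMA M : Mod L' T'. points sortF M) \<and> (\<forall>x. {M \<in> Mod L' T'. (M, x) \<in> S} \<in> sets (ModB L' T'))}"
  unfolding pointsB_def Let_def by (rule sets_measure_of) auto

lemma sets_isortB: "sets (isortB L' T' sortF) = sigma_sets (SIGMA M : Mod L' T'. isort_val sortF M)
    {S. S \<subseteq> (SIGMA M : Mod L' T'. isort_val sortF M) \<and>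
       {(M, x). M \<in> Mod L' T' \<and> x \<in> points sortF M \<and> (M, point_class sortF M x) \<in> S} \<in> sets (pointsB L' T' sortF)}"
  unfolding isortB_def Let_def by (rule sets_measure_of) auto

lemma space_isortB: "space (isortB L' T' sortF) = (SIGMA M : Mod L' T'. isort_val sortF M)"
  unfolding isortB_def Let_def by (rule space_measure_of) auto

lemma points_sets: "{M \<in> Mod L' T'. pt \<in> points sortF M} \<in> sets (ModB L' T')"
proof -
  have "{M \<in> Mod L' T'. pt \<in> points sortF M} = {M \<in> space (ModB L' T'). \<exists>a. denotes M pt a}"
    unfolding space_ModB by (intro Collect_cong conj_cong refl) (rule points_eq)
  also have "\<dots> \<in> sets (ModB L' T')"
    by (intro sets.sets_Collect_countable_Ex) (use denotes_sets in simp)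
  finally show ?thesis .
qed

lemma pointsB_section:
  assumes "S \<in> sets (pointsB L' T' sortF)"
  shows "{M \<in> Mod L' T'. (M, pt) \<in> S} \<in> sets (ModB L' T')"
  using assms unfolding sets_pointsB
proof induction
  case (Basic S)
  then show ?case by blast
next
  case (Compl S)
  have "{M \<in> Mod L' T'. (M, pt) \<in> (SIGMA M : Mod L' T'. points sortF M) - S} =
    {M \<in> Mod L' T'. pt \<in> points sortF M} - {M \<in> Mod L' T'. (M, pt) \<in> S}" by blast
  then show ?case using points_sets Compl.IH by simp
next
  case (Union S)
  have "{M \<in> Mod L' T'. (M, pt) \<in> \<Union> (range S)} = (\<Union>n. {M \<in> Mod L' T'. (M, pt) \<in> S n})" by blast
  then show ?case using Union.IH by auto
qed auto

lemma isortB_section: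
  assumes "S \<in> sets (isortB L' T' sortF)"
  shows "{M \<in> Mod L' T'. pt \<in> points sortF M \<and> (M, point_class sortF M pt) \<in> S} \<in> sets (ModB L' T')"
  using assms unfolding sets_isortB
proof induction
  case (Basic S)
  then have "{(M, x). M \<in> Mod L' T' \<and> x \<in> points sortF M \<and> (M, point_class sortF M x) \<in> S} \<in> sets (pointsB L' T' sortF)"
    by blast
  from pointsB_section[OF this, of pt] show ?case by simp
next
  case (Compl S)
  have "point_class sortF M pt \<in> isort_val sortF M" if "pt \<in> points sortF M" for M
    using that by (auto simp: isort_val_def quotient_def point_class_def)
  then have "{M \<in> Mod L' T'. pt \<in> points sortF M \<and> (M, point_class sortF M pt) \<in> (SIGMA M : Mod L' T'. isort_val sortF M) - S} =
    {M \<in> Mod L' T'. pt \<in> points sortF M} - {M \<in> Mod L' T'. pt \<in> points sortF M \<and> (M, point_class sortF M pt) \<in> S}" by blast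
  then show ?case using points_sets Compl.IH by simp
next
  case (Union S)
  have "{M \<in> Mod L' T'. pt \<in> points sortF M \<and> (M, point_class sortF M pt) \<in> \<Union> (range S)} =
    (\<Union>n. {M \<in> Mod L' T'. pt \<in> points sortF M \<and> (M, point_class sortF M pt) \<in> S n})" by blast
  then show ?case using Union.IH by auto
qed auto

text \<open>
The elements of \<open>Ob M\<close> already form an initial segment of the natural numbers, so each class of names can be
coded by the element that its members denote.
\<close>

lemma coding_exists: "\<exists>e. is_coding L' T' sortF e"
proof -
  define e :: "('q, nat) rstruct \<times> (nat \<times> nat list) set \<Rightarrow> nat"
    where "e = (\<lambda>(M, c). inv_into (carrier (Ob M)) (names_of M) c)"
  have e: "e (M, names_of M a) = a" if "M \<in> Mod L' T'" "a \<in> carrier (Ob M)" for M a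
    using inv_into_f_f[OF inj_on_names_of[OF that(1)] that(2)] by (simp add: e_def)
  have "e \<in> isortB L' T' sortF \<rightarrow>\<^sub>M count_space UNIV"
  proof (rule measurableI)
    fix A :: "nat set"
    let ?S = "e -` A \<inter> space (isortB L' T' sortF)"
    let ?P = "{(M, x). M \<in> Mod L' T' \<and> x \<in> points sortF M \<and> (M, point_class sortF M x) \<in> ?S}"
    have "{M \<in> Mod L' T'. (M, pt) \<in> ?P} \<in> sets (ModB L' T')" for pt
    proof -
      have "(M, pt) \<in> ?P \<longleftrightarrow> (\<exists>a. a \<in> A \<and> denotes M pt a)" if M: "M \<in> Mod L' T'" for M
      proof (cases "\<exists>a. denotes M pt a")
        case True
        then obtain a where a: "denotes M pt a" ..
        then have c: "a \<in> carrier (Ob M)" by (simp add: denotes_def)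
        have "point_class sortF M pt = names_of M a" by (rule point_class_eq[OF M a])
        moreover have "(M, names_of M a) \<in> space (isortB L' T' sortF)"
          using M c isort_val_eq[OF M] by (auto simp: space_isortB)
        ultimately have "(M, pt) \<in> ?P \<longleftrightarrow> a \<in> A" using e[OF M c] M points_eq[OF M, of pt] a by auto
        then show ?thesis using a denotes_unique[OF M] by blast
      next
        case False
        then show ?thesis using points_eq[OF M, of pt] by blast
      qed
      then have "{M \<in> Mod L' T'. (M, pt) \<in> ?P} = {M \<in> space (ModB L' T'). \<exists>a. a \<in> A \<and> denotes M pt a}" by auto
      also have "\<dots> \<in> sets (ModB L' T')"
        by (intro sets.sets_Collect_countable_Ex sets.sets_Collect_conj sets.sets_Collect_const) (use denotes_sets in simp)
      finally show ?thesis .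
    qed
    then have "?P \<in> sets (pointsB L' T' sortF)"
      unfolding sets_pointsB by (intro sigma_sets.Basic) auto
    then show "?S \<in> sets (isortB L' T' sortF)"
      unfolding sets_isortB by (intro sigma_sets.Basic) (auto simp: space_isortB)
  qed simp
  moreover have "\<exists>S. init_seg S \<and> bij_betw (\<lambda>c. e (M, c)) (isort_val sortF M) S" if M: "M \<in> Mod L' T'" for M
  proof (intro exI conjI)
    show "init_seg (carrier (Ob M))" using R.MdD(1)[OF Ob_in[OF M]] .
    show "bij_betw (\<lambda>c. e (M, c)) (isort_val sortF M) (carrier (Ob M))"
      unfolding isort_val_eq[OF M] e_def
      using bij_betw_inv_into[OF inj_on_imp_bij_betw[OF inj_on_names_of[OF M]]] by simp
  qed
  ultimately show ?thesis unfolding is_coding_def by blast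
qed

end

locale coding_setting = interpretation_setting L' T' L T G
  for L' :: "'q language" and T' :: "'q fm set" and L :: "'r language" and T :: "'r fm set"
    and G :: "('q, 'r) gfunctor" +
  fixes e :: "('q, nat) rstruct \<times> (nat \<times> nat list) set \<Rightarrow> nat"
  assumes coding: "is_coding L' T' sortF e"
begin

text \<open>
The bijection from \<open>Ob M\<close> to the underlying set of the model induced by the interpretation: an element goes
to the code of the class of its names.
\<close>

definition code_of :: "('q, nat) rstruct \<Rightarrow> nat \<Rightarrow> nat" where
  "code_of M = restrict (\<lambda>a. e (M, names_of M a)) (carrier (Ob M))"

definition coding_iso :: "('q, nat) rstruct \<Rightarrow> 'r arrow" where
  "coding_iso M = arrow (Ob M) (code_of M)"

abbreviation "Star \<equiv> star_obj L interpF e"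

lemma code_of_perm:
  assumes M: "M \<in> Mod L' T'"
  shows "code_of M \<in> perms (carrier (Ob M))"
proof -
  obtain S where S: "init_seg S" "bij_betw (\<lambda>c. e (M, c)) (isort_val sortF M) S"
    using coding M unfolding is_coding_def by blast
  have "bij_betw (names_of M) (carrier (Ob M)) (isort_val sortF M)"
    unfolding isort_val_eq[OF M] by (rule inj_on_imp_bij_betw[OF inj_on_names_of[OF M]])
  from bij_betw_trans[OF this S(2)] have "bij_betw (\<lambda>a. e (M, names_of M a)) (carrier (Ob M)) S"
    by (simp add: comp_def)
  moreover from this have "carrier (Ob M) = S" using init_seg_bij_eq R.MdD(1)[OF Ob_in[OF M]] S(1) by blast
  moreover have "bij_betw (code_of M) (carrier (Ob M)) S \<longleftrightarrow> bij_betw (\<lambda>a. e (M, names_of M a)) (carrier (Ob M)) S"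
    by (rule bij_betw_cong) (simp add: code_of_def)
  ultimately show ?thesis by (simp add: perms_def code_of_def)
qed

lemma coding_iso_in: "M \<in> Mod L' T' \<Longrightarrow> coding_iso M \<in> Arr L T"
  unfolding coding_iso_def by (rule R.arrow_in_Arr[OF Ob_in code_of_perm])

lemma Star_eq:
  assumes M: "M \<in> Mod L' T'"
  shows "Star M = push (Ob M) (code_of M)"
proof (rule rstruct.equality)
  show "carrier (Star M) = carrier (push (Ob M) (code_of M))"
    by (simp add: star_obj_def isort_val_eq[OF M] image_image code_of_def)
  show "rel (Star M) = rel (push (Ob M) (code_of M))"
  proof
    fix R
    show "rel (Star M) R = rel (push (Ob M) (code_of M)) R"
    proof (cases "L R")
      case None
      then have "rel (Ob M) R = {}" using R.relD[OF Ob_in[OF M], of _ R] by auto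
      then show ?thesis by (simp add: star_obj_def push_def None)
    next
      case (Some n)
      have "map (\<lambda>c. e (M, c)) (map (names_of M) as) = map (code_of M) as" if "as \<in> rel (Ob M) R" for as
        using R.relD[OF Ob_in[OF M] that] by (simp add: code_of_def in_lists_conv_set)
      then show ?thesis
        by (simp only: star_obj_def push_def Some rstruct.simps option.simps interpF_simps
            power_subsort_val_eq[OF M Some] image_image cong: image_cong)
    qed
  qed
qed simp

lemma coding_iso_ends: "src (coding_iso M) = Ob M" "M \<in> Mod L' T' \<Longrightarrow> trg (coding_iso M) = Star M" "fun_of (coding_iso M) = code_of M"
  by (simp_all add: coding_iso_def Star_eq)

lemma Star_carrier: "M \<in> Mod L' T' \<Longrightarrow> carrier (Star M) = carrier (Ob M)"
  using R.ArrD(3)[OF coding_iso_in] by (simp add: coding_iso_ends)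

lemma code_of_sets: "{M \<in> Mod L' T'. a \<in> carrier (Ob M) \<and> code_of M a = b} \<in> sets (ModB L' T')"
proof -
  let ?S = "e -` {b} \<inter> space (isortB L' T' sortF)"
  have S: "?S \<in> sets (isortB L' T' sortF)"
    by (rule measurable_sets[OF conjunct1[OF coding[unfolded is_coding_def]]]) simp
  have "a \<in> carrier (Ob M) \<and> code_of M a = b \<longleftrightarrow>
     (\<exists>pt. denotes M pt a \<and> pt \<in> points sortF M \<and> (M, point_class sortF M pt) \<in> ?S)" if M: "M \<in> Mod L' T'" for M
  proof
    assume a: "a \<in> carrier (Ob M) \<and> code_of M a = b"
    then obtain pt where pt: "denotes M pt a" using denotes_exists[OF M] by blast
    have "(M, names_of M a) \<in> space (isortB L' T' sortF)"
      using a M isort_val_eq[OF M] by (auto simp: space_isortB)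
    then have "(M, point_class sortF M pt) \<in> ?S" using a point_class_eq[OF M pt] by (auto simp: code_of_def)
    then show "\<exists>pt. denotes M pt a \<and> pt \<in> points sortF M \<and> (M, point_class sortF M pt) \<in> ?S"
      using pt points_eq[OF M] by blast
  next
    assume "\<exists>pt. denotes M pt a \<and> pt \<in> points sortF M \<and> (M, point_class sortF M pt) \<in> ?S"
    then obtain pt where pt: "denotes M pt a" "(M, point_class sortF M pt) \<in> ?S" by blast
    then show "a \<in> carrier (Ob M) \<and> code_of M a = b"
      using point_class_eq[OF M pt(1)] by (simp add: code_of_def denotes_def)
  qed
  then have "{M \<in> Mod L' T'. a \<in> carrier (Ob M) \<and> code_of M a = b} = {M \<in> space (ModB L' T').
     \<exists>pt. denotes M pt a \<and> pt \<in> points sortF M \<and> (M, point_class sortF M pt) \<in> ?S}" by auto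
  also have "\<dots> \<in> sets (ModB L' T')"
  proof (rule sets.sets_Collect_countable_Ex)
    fix pt
    have "{M \<in> space (ModB L' T'). denotes M pt a \<and> pt \<in> points sortF M \<and> (M, point_class sortF M pt) \<in> ?S} =
      {M \<in> Mod L' T'. denotes M pt a} \<inter> {M \<in> Mod L' T'. pt \<in> points sortF M \<and> (M, point_class sortF M pt) \<in> ?S}" by auto
    then show "{M \<in> space (ModB L' T'). denotes M pt a \<and> pt \<in> points sortF M \<and> (M, point_class sortF M pt) \<in> ?S} \<in> sets (ModB L' T')"
      using sets.Int[OF denotes_sets isortB_section[OF S]] by (simp only:)
  qed
  finally show ?thesis .
qed

lemma coding_iso_measurable: "coding_iso \<in> ModB L' T' \<rightarrow>\<^sub>M ArrB L T"
proof (rule R.measurable_ArrB_I)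
  show "(\<lambda>M. src (coding_iso M)) \<in> ModB L' T' \<rightarrow>\<^sub>M ModB L T" using Ob_measurable by (simp add: coding_iso_ends)
qed (use coding_iso_in code_of_sets in \<open>simp_all add: coding_iso_ends\<close>)

text \<open>
The functor \<open>G\<close>, conjugated by the isomorphisms \<open>coding_iso\<close>.
\<close>

definition conj_arr :: "'q arrow \<Rightarrow> 'r arrow" where
  "conj_arr f = comp_arr (coding_iso (trg f)) (comp_arr (on_arr G f) (inv_arr (coding_iso (src f))))"

lemma conj_arr_in:
  assumes f: "f \<in> Arr L' T'"
  shows "conj_arr f \<in> Arr L T" "src (conj_arr f) = Star (src f)" "trg (conj_arr f) = Star (trg f)"
proof -
  note s = coding_iso_in[OF Q.ArrD(1)[OF f]] and t = coding_iso_in[OF Q.ArrD(2)[OF f]]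
  show "conj_arr f \<in> Arr L T" unfolding conj_arr_def
    by (intro R.comp_in_Arr on_arr_in[OF f] R.inv_in_Arr s t) (simp_all add: coding_iso_ends on_arr_ends f)
  show "src (conj_arr f) = Star (src f)" "trg (conj_arr f) = Star (trg f)"
    using Q.ArrD(1,2)[OF f] by (simp_all add: conj_arr_def coding_iso_ends)
qed

lemma conj_arr_apply:
  assumes f: "f \<in> Arr L' T'" and a: "a \<in> carrier (Ob (src f))"
  shows "fun_of (conj_arr f) (code_of (src f) a) = code_of (trg f) (arr_map f a)"
proof -
  note s = coding_iso_in[OF Q.ArrD(1)[OF f]]
  have n: "code_of (src f) a \<in> carrier (Ob (src f))" using permsD(5)[OF code_of_perm[OF Q.ArrD(1)[OF f]] a] .
  have "fun_of (inv_arr (coding_iso (src f))) (code_of (src f) a) = a"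
    using R.inv_arr_apply[OF s, of a "code_of (src f) a"] a n by (simp add: coding_iso_ends)
  then show ?thesis
    using n Star_carrier[OF Q.ArrD(1)[OF f]] Q.ArrD(1)[OF f]
    by (simp add: conj_arr_def compose_def coding_iso_ends arr_map_def)
qed

lemma code_of_surj:
  assumes "M \<in> Mod L' T'" "k \<in> carrier (Ob M)"
  obtains a where "a \<in> carrier (Ob M)" "k = code_of M a"
proof -
  have "k \<in> code_of M ` carrier (Ob M)" using permsD(2)[OF code_of_perm[OF assms(1)]] assms(2) by simp
  then show ?thesis using that by blast
qed

text \<open>
On classes of names, an isomorphism acts elementwise; by \<open>names_of_image\<close> this is how \<open>G\<close> moves the
elements denoted.
\<close>

lemma star_arr_eq:
  assumes f: "f \<in> Arr L' T'"
  shows "star_arr L interpF e f = conj_arr f"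
proof (rule arrow.equality)
  note M = Q.ArrD(1)[OF f] and N = Q.ArrD(2)[OF f]
  show "fun_of (star_arr L interpF e f) = fun_of (conj_arr f)"
  proof (rule extensionalityI)
    show "fun_of (star_arr L interpF e f) \<in> extensional (carrier (Ob (src f)))"
      by (simp add: star_arr_def Star_carrier[OF M])
    show "fun_of (conj_arr f) \<in> extensional (carrier (Ob (src f)))"
      using permsD(4)[OF R.ArrD(4)[OF conj_arr_in(1)[OF f]]] conj_arr_in(2)[OF f] Star_carrier[OF M] by simp
    fix k assume k: "k \<in> carrier (Ob (src f))"
    obtain a where a: "a \<in> carrier (Ob (src f))" "k = code_of (src f) a" using code_of_surj[OF M k] .
    have inj: "inj_on (\<lambda>c. e (src f, c)) (isort_val sortF (src f))"
      using coding M unfolding is_coding_def bij_betw_def by blast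
    have "inv_into (isort_val sortF (src f)) (\<lambda>c. e (src f, c)) k = names_of (src f) a"
      by (rule inv_into_f_eq[OF inj]) (use a isort_val_eq[OF M] in \<open>auto simp: code_of_def\<close>)
    then have "fun_of (star_arr L interpF e f) k = e (trg f, names_of (trg f) (arr_map f a))"
      using k Star_carrier[OF M] names_of_image[OF f a(1)] by (simp add: star_arr_def)
    also have "\<dots> = code_of (trg f) (arr_map f a)"
      using arr_map_in[OF f a(1)] Ob_carrier[OF f] by (simp add: code_of_def)
    also have "\<dots> = fun_of (conj_arr f) k" using conj_arr_apply[OF f a(1)] a(2) by simp
    finally show "fun_of (star_arr L interpF e f) k = fun_of (conj_arr f) k" .
  qed
qed (simp_all add: star_arr_def conj_arr_in[OF f])

lemma arr_map_in_trg: "f \<in> Arr L' T' \<Longrightarrow> a \<in> carrier (Ob (src f)) \<Longrightarrow> arr_map f a \<in> carrier (Ob (trg f))"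
  using arr_map_in Ob_carrier by blast

lemma borel_functor_star: "borel_functor L' T' L T (star_functor L interpF e)"
proof -
  have obj: "Star \<in> ModB L' T' \<rightarrow>\<^sub>M ModB L T"
  proof -
    have "(\<lambda>M. trg (coding_iso M)) \<in> ModB L' T' \<rightarrow>\<^sub>M ModB L T"
      using measurable_compose[OF coding_iso_measurable R.trg_measurable] .
    then show ?thesis by (rule measurable_cong[THEN iffD1, rotated]) (simp add: coding_iso_ends)
  qed
  have arr: "star_arr L interpF e \<in> ArrB L' T' \<rightarrow>\<^sub>M ArrB L T"
  proof -
    have "conj_arr \<in> ArrB L' T' \<rightarrow>\<^sub>M ArrB L T"
      unfolding conj_arr_def[abs_def]
    proof (intro R.comp_arr_measurable)
      show "on_arr G \<in> ArrB L' T' \<rightarrow>\<^sub>M ArrB L T" by (rule on_arr_measurable)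
      show "(\<lambda>f. coding_iso (trg f)) \<in> ArrB L' T' \<rightarrow>\<^sub>M ArrB L T"
        using measurable_compose[OF Q.trg_measurable coding_iso_measurable] .
      show "(\<lambda>f. inv_arr (coding_iso (src f))) \<in> ArrB L' T' \<rightarrow>\<^sub>M ArrB L T"
        using measurable_compose[OF measurable_compose[OF Q.src_measurable coding_iso_measurable] R.inv_arr_measurable] .
    qed (simp_all add: coding_iso_ends on_arr_ends)
    then show ?thesis by (rule measurable_cong[THEN iffD1, rotated]) (simp add: star_arr_eq)
  qed
  have ident: "conj_arr (id_arr M) = id_arr (Star M)" if M: "M \<in> Mod L' T'" for M
  proof (rule R.arrow_eqI)
    note i = Q.id_in_Arr[OF M]
    show "conj_arr (id_arr M) \<in> Arr L T" by (rule conj_arr_in(1)[OF i])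
    have "Star M \<in> Mod L T" using R.ArrD(2)[OF coding_iso_in[OF M]] M by (simp add: coding_iso_ends)
    then show "id_arr (Star M) \<in> Arr L T" by (rule R.id_in_Arr)
    fix k assume "k \<in> carrier (src (conj_arr (id_arr M)))"
    then have k: "k \<in> carrier (Ob M)" using conj_arr_in(2)[OF i] Star_carrier[OF M] by simp
    obtain a where a: "a \<in> carrier (Ob M)" "k = code_of M a" using code_of_surj[OF M k] .
    show "fun_of (conj_arr (id_arr M)) k = fun_of (id_arr (Star M)) k"
      using conj_arr_apply[OF i, of a] a k arr_map_id[OF M a(1)] Star_carrier[OF M] by simp
  qed (simp_all add: conj_arr_in[OF Q.id_in_Arr[OF M]])
  have comp: "conj_arr (comp_arr h f) = comp_arr (conj_arr h) (conj_arr f)"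
    if f: "f \<in> Arr L' T'" and h: "h \<in> Arr L' T'" and fh: "src h = trg f" for f h
  proof (rule R.arrow_eqI)
    note hf = Q.comp_in_Arr[OF f h fh] and M = Q.ArrD(1)[OF f]
    show "conj_arr (comp_arr h f) \<in> Arr L T" by (rule conj_arr_in(1)[OF hf])
    show "comp_arr (conj_arr h) (conj_arr f) \<in> Arr L T"
      by (rule R.comp_in_Arr) (simp_all add: conj_arr_in f h fh)
    show "src (conj_arr (comp_arr h f)) = src (comp_arr (conj_arr h) (conj_arr f))"
      by (simp add: conj_arr_in f h hf)
    show "trg (conj_arr (comp_arr h f)) = trg (comp_arr (conj_arr h) (conj_arr f))"
      by (simp add: conj_arr_in f h hf)
    fix k assume "k \<in> carrier (src (conj_arr (comp_arr h f)))"
    then have k: "k \<in> carrier (Ob (src f))" using conj_arr_in(2)[OF hf] Star_carrier[OF M] by simp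
    obtain a where a: "a \<in> carrier (Ob (src f))" "k = code_of (src f) a" using code_of_surj[OF M k] .
    have "fun_of (conj_arr (comp_arr h f)) k = code_of (trg h) (arr_map h (arr_map f a))"
      using conj_arr_apply[OF hf, of a] a arr_map_comp[OF f h fh a(1)] by simp
    also have "\<dots> = fun_of (conj_arr h) (code_of (trg f) (arr_map f a))"
      using conj_arr_apply[OF h, of "arr_map f a"] arr_map_in_trg[OF f a(1)] fh by simp
    also have "\<dots> = fun_of (comp_arr (conj_arr h) (conj_arr f)) k"
      using conj_arr_apply[OF f a(1)] a(2) k Star_carrier[OF M] conj_arr_in(2)[OF f] by (simp add: compose_def)
    finally show "fun_of (conj_arr (comp_arr h f)) k = fun_of (comp_arr (conj_arr h) (conj_arr f)) k" .
  qed
  show ?thesis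
    unfolding borel_functor_def star_functor_def gfunctor.simps
  proof (intro conjI ballI impI obj arr)
    fix f assume f: "f \<in> Arr L' T'"
    show "src (star_arr L interpF e f) = Star (src f)" "trg (star_arr L interpF e f) = Star (trg f)"
      by (simp_all add: star_arr_def)
    fix h assume h: "h \<in> Arr L' T'" and fh: "src h = trg f"
    show "star_arr L interpF e (comp_arr h f) = comp_arr (star_arr L interpF e h) (star_arr L interpF e f)"
      unfolding star_arr_eq[OF f] star_arr_eq[OF h] star_arr_eq[OF Q.comp_in_Arr[OF f h fh]] by (rule comp[OF f h fh])
  next
    fix M assume M: "M \<in> Mod L' T'"
    show "star_arr L interpF e (id_arr M) = id_arr (Star M)"
      unfolding star_arr_eq[OF Q.id_in_Arr[OF M]] by (rule ident[OF M])
  qed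
qed

lemma coding_iso_natural:
  assumes f: "f \<in> Arr L' T'"
  shows "comp_arr (coding_iso (trg f)) (on_arr G f) = comp_arr (star_arr L interpF e f) (coding_iso (src f))"
proof (rule R.arrow_eqI)
  note M = Q.ArrD(1)[OF f] and N = Q.ArrD(2)[OF f]
  show "comp_arr (coding_iso (trg f)) (on_arr G f) \<in> Arr L T"
    by (rule R.comp_in_Arr[OF on_arr_in[OF f] coding_iso_in[OF N]]) (simp add: coding_iso_ends on_arr_ends f)
  show "comp_arr (star_arr L interpF e f) (coding_iso (src f)) \<in> Arr L T"
    unfolding star_arr_eq[OF f]
    by (rule R.comp_in_Arr[OF coding_iso_in[OF M] conj_arr_in(1)[OF f]]) (simp add: coding_iso_ends conj_arr_in f M)
  show "src (comp_arr (coding_iso (trg f)) (on_arr G f)) = src (comp_arr (star_arr L interpF e f) (coding_iso (src f)))"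
    by (simp add: coding_iso_ends on_arr_ends f)
  show "trg (comp_arr (coding_iso (trg f)) (on_arr G f)) = trg (comp_arr (star_arr L interpF e f) (coding_iso (src f)))"
    by (simp add: star_arr_eq[OF f] conj_arr_in f coding_iso_ends N)
  fix a assume "a \<in> carrier (src (comp_arr (coding_iso (trg f)) (on_arr G f)))"
  then have a: "a \<in> carrier (Ob (src f))" by (simp add: on_arr_ends f)
  then show "fun_of (comp_arr (coding_iso (trg f)) (on_arr G f)) a = fun_of (comp_arr (star_arr L interpF e f) (coding_iso (src f))) a"
    using conj_arr_apply[OF f a] by (simp add: star_arr_eq[OF f] compose_def coding_iso_ends on_arr_ends f arr_map_def)
qed

theorem borel_nat_iso_star: "borel_nat_iso L' T' L T G (star_functor L interpF e)"
  unfolding borel_nat_iso_def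
  using G_functor borel_functor_star coding_iso_measurable coding_iso_natural
  by (auto simp: star_functor_def coding_iso_ends intro!: exI[of _ coding_iso])

end

theorem theorem1p1:
  fixes L :: "'r language" and L' :: "'q language"
    and T :: "'r fm set" and T' :: "'q fm set"
    and G :: "('q, 'r) gfunctor"
  assumes "countable (dom L)" and "countable (dom L')"
    and "is_theory L T" and "countable T"
    and "is_theory L' T'" and "countable T'"
    and "borel_functor L' T' L T G"
  shows "\<exists>F :: ('r, 'q) interp.
    is_interp L T L' T' F \<and>
    (\<exists>e. is_coding L' T' (isort_of F) e) \<and>
    (\<forall>e. is_coding L' T' (isort_of F) e \<longrightarrow> borel_nat_iso L' T' L T G (star_functor L F e))"
proof -
  interpret interpretation_setting L' T' L T G
    by unfold_locales (use assms in auto)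
  have "borel_nat_iso L' T' L T G (star_functor L interpF e)" if "is_coding L' T' sortF e" for e
  proof -
    interpret coding_setting L' T' L T G e by unfold_locales (rule that)
    show ?thesis by (rule borel_nat_iso_star)
  qed
  then show ?thesis using is_interp_interpF coding_exists by (intro exI[of _ interpF]) simp
qed

end
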